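(* For every $d\geq 4$, there exists a smooth complete weighted manifold $(\mathbb{R}^d,g,\mu)$ satisfying the $\mathrm{CD}(1,\infty)$ condition and $\operatorname{Ric}_g\geq 0$ such that $$\lambda_{d+2}(\mathbb{R}^d,g,\mu)<2=\lambda_{d+2}(\mathbb{R}^d,|\cdot|,\gamma^d).$$
   Context: A weighted manifold $(M^d,g,\mu)$ is a complete smooth Riemannian manifold $(M,g)$ together with a measure $\mathrm{d}\mu=e^{-W}\,\mathrm{dvol}_g$, with $W$ smooth. It satisfies $\mathrm{CD}(\rho,\infty)$ if $\operatorname{Ric}_g+\nabla_g^2W\geq\rho g$. For $k\geq 1$ the $k$-th variational eigenvalue is $$\lambda_k(M,g,\mu):=\inf_{E\subset W^{1,2}(M,g,\mu),\ \dim E=k}\ \sup_{0\neq f\in E}\frac{\int_M|\nabla f|_g^2\,\mathrm{d}\mu}{\int_M f^2\,\mathrm{d}\mu}.$$ $|\cdot|$ denotes the Euclidean metric and $\gamma^d(\mathrm{d}x)=(2\pi)^{-d/2}e^{-|x|^2/2}\,\mathrm{d}x$ the standard Gaussian measure on $\mathbb{R}^d$. *)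

theory Defs
  imports "HOL-Analysis.Analysis"
begin

section \<open>Smooth functions on \<open>\<real>\<^sup>d\<close>\<close>

definition partial :: "'n \<Rightarrow> (real^'n \<Rightarrow> real) \<Rightarrow> (real^'n \<Rightarrow> real)" where
  "partial i f = (\<lambda>x. frechet_derivative f (at x) (axis i 1))"

text \<open>All iterated partial derivatives are (Frechet) differentiable everywhere, hence continuous;
  this is the usual \<open>C\<^sup>\<infinity>\<close> property.\<close>

definition smooth :: "(real^'n \<Rightarrow> real) \<Rightarrow> bool" where
  "smooth f \<longleftrightarrow> (\<forall>is x. foldr partial is f differentiable (at x))"

definition test_function :: "(real^'n \<Rightarrow> real) \<Rightarrow> bool" where
  "test_function \<phi> \<longleftrightarrow> smooth \<phi> \<and> compact (closure (support_on UNIV \<phi>))"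


section \<open>Riemannian metrics on \<open>\<real>\<^sup>d\<close>\<close>

text \<open>A Riemannian metric is given by its matrix in the global coordinates of \<open>\<real>\<^sup>d\<close>;
  tangent vectors are elements of \<open>\<real>\<^sup>d\<close>.\<close>

type_synonym 'n tensor2 = "real^'n \<Rightarrow> real^'n^'n"

definition quad_form :: "real^'n^'n \<Rightarrow> real^'n \<Rightarrow> real" where
  "quad_form A v = v \<bullet> (A *v v)"

definition riemannian_metric :: "'n::finite tensor2 \<Rightarrow> bool" where
  "riemannian_metric g \<longleftrightarrow>
     (\<forall>i j. smooth (\<lambda>x. g x $ i $ j)) \<and>
     (\<forall>x. transpose (g x) = g x) \<and>
     (\<forall>x v. v \<noteq> 0 \<longrightarrow> quad_form (g x) v > 0)"

text \<open>A \<^const>\<open>valid_path\<close> need not have bounded derivative near its exceptional points, so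
  integrability of the speed has to be demanded (otherwise the integral would default to 0).\<close>

definition path_has_length :: "'n::finite tensor2 \<Rightarrow> (real \<Rightarrow> real^'n) \<Rightarrow> real \<Rightarrow> bool" where
  "path_has_length g \<gamma> L \<longleftrightarrow>
     ((\<lambda>t. sqrt (quad_form (g (\<gamma> t)) (vector_derivative \<gamma> (at t)))) has_integral L) {0..1}"

definition riem_dist :: "'n::finite tensor2 \<Rightarrow> real^'n \<Rightarrow> real^'n \<Rightarrow> real" where
  "riem_dist g x y =
     Inf {L. \<exists>\<gamma>. valid_path \<gamma> \<and> pathstart \<gamma> = x \<and> pathfinish \<gamma> = y \<and> path_has_length g \<gamma> L}"

definition complete_metric :: "'n::finite tensor2 \<Rightarrow> bool" where
  "complete_metric g \<longleftrightarrow> Metric_space.mcomplete UNIV (riem_dist g)"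


section \<open>Curvature\<close>

text \<open>\<open>christoffel g k i j = \<Gamma>\<^sup>k\<^sub>i\<^sub>j\<close>, so that \<open>\<nabla>\<^sub>i \<partial>\<^sub>j = \<Sum>\<^sub>k \<Gamma>\<^sup>k\<^sub>i\<^sub>j \<partial>\<^sub>k\<close>.\<close>

definition christoffel :: "'n::finite tensor2 \<Rightarrow> 'n \<Rightarrow> 'n \<Rightarrow> 'n \<Rightarrow> real^'n \<Rightarrow> real" where
  "christoffel g k i j x =
     (1/2) * (\<Sum>l\<in>UNIV. matrix_inv (g x) $ k $ l *
        (partial i (\<lambda>y. g y $ j $ l) x + partial j (\<lambda>y. g y $ i $ l) x
           - partial l (\<lambda>y. g y $ i $ j) x))"

text \<open>The \<open>\<partial>\<^sub>l\<close>-component of \<open>R(\<partial>\<^sub>i,\<partial>\<^sub>j)\<partial>\<^sub>k\<close>, where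
  \<open>R(X,Y)Z = \<nabla>\<^sub>X\<nabla>\<^sub>Y Z - \<nabla>\<^sub>Y\<nabla>\<^sub>X Z - \<nabla>\<^bsub>[X,Y]\<^esub> Z\<close>.
  With this sign \<open>Ric(Y,Z) = tr (X \<mapsto> R(X,Y)Z)\<close>, which is positive on round spheres.\<close>

definition riemann :: "'n::finite tensor2 \<Rightarrow> 'n \<Rightarrow> 'n \<Rightarrow> 'n \<Rightarrow> 'n \<Rightarrow> real^'n \<Rightarrow> real" where
  "riemann g l i j k x =
     partial i (christoffel g l j k) x - partial j (christoffel g l i k) x
     + (\<Sum>m\<in>UNIV. christoffel g l i m x * christoffel g m j k x
                - christoffel g l j m x * christoffel g m i k x)"

definition ricci :: "'n::finite tensor2 \<Rightarrow> 'n tensor2" where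
  "ricci g x = (\<chi> j k. \<Sum>i\<in>UNIV. riemann g i i j k x)"

definition hessian :: "'n::finite tensor2 \<Rightarrow> (real^'n \<Rightarrow> real) \<Rightarrow> 'n tensor2" where
  "hessian g W x =
     (\<chi> i j. partial i (partial j W) x - (\<Sum>k\<in>UNIV. christoffel g k i j x * partial k W x))"

definition ricci_nonneg :: "'n::finite tensor2 \<Rightarrow> bool" where
  "ricci_nonneg g \<longleftrightarrow> (\<forall>x v. quad_form (ricci g x) v \<ge> 0)"

definition CD_infinity :: "real \<Rightarrow> 'n::finite tensor2 \<Rightarrow> (real^'n \<Rightarrow> real) \<Rightarrow> bool" where
  "CD_infinity \<rho> g W \<longleftrightarrow>
     (\<forall>x v. quad_form (ricci g x + hessian g W x) v \<ge> \<rho> * quad_form (g x) v)"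


section \<open>Weighted manifolds\<close>

definition weighted_manifold :: "'n::finite tensor2 \<Rightarrow> (real^'n \<Rightarrow> real) \<Rightarrow> bool" where
  "weighted_manifold g W \<longleftrightarrow> riemannian_metric g \<and> complete_metric g \<and> smooth W"

text \<open>The measure \<open>e\<^sup>-\<^sup>W dvol\<^sub>g\<close>, with \<open>dvol\<^sub>g = sqrt (det g) dx\<close>.\<close>

definition weighted_measure :: "'n::finite tensor2 \<Rightarrow> (real^'n \<Rightarrow> real) \<Rightarrow> (real^'n) measure" where
  "weighted_measure g W = density lborel (\<lambda>x. ennreal (exp (- W x) * sqrt (det (g x))))"

definition flat_metric :: "'n::finite tensor2" where
  "flat_metric = (\<lambda>x. mat 1)"

definition gaussian_measure :: "(real^'n::finite) measure" where
  "gaussian_measure =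
     density lborel (\<lambda>x. ennreal ((2 * pi) powr (- real CARD('n) / 2) * exp (- (norm x)\<^sup>2 / 2)))"


section \<open>The Sobolev space \<open>W\<^sup>1\<^sup>,\<^sup>2\<close> and the variational eigenvalues\<close>

definition locally_integrable :: "(real^'n \<Rightarrow> 'b::{banach, second_countable_topology}) \<Rightarrow> bool" where
  "locally_integrable f \<longleftrightarrow>
     f \<in> borel_measurable borel \<and> (\<forall>K. compact K \<longrightarrow> set_integrable lborel K f)"

text \<open>The coordinate components of the weak differential \<open>df\<close>; these do not depend on a metric or
  weight.\<close>

definition has_weak_differential :: "(real^'n \<Rightarrow> real) \<Rightarrow> (real^'n \<Rightarrow> real^'n) \<Rightarrow> bool" where
  "has_weak_differential f v \<longleftrightarrow> locally_integrable f \<and> locally_integrable v \<and>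
     (\<forall>\<phi> i. test_function \<phi> \<longrightarrow>
        (LINT x|lborel. f x * partial i \<phi> x) = - (LINT x|lborel. v x $ i * \<phi> x))"

text \<open>Unique up to null sets if it exists.\<close>

definition weak_differential :: "(real^'n \<Rightarrow> real) \<Rightarrow> (real^'n \<Rightarrow> real^'n)" where
  "weak_differential f = (SOME v. has_weak_differential f v)"

text \<open>The gradient of \<open>f\<close> is \<open>g\<^sup>-\<^sup>1 df\<close>, so \<open>|\<nabla>f|\<^sup>2\<^sub>g\<close> is the quadratic form of the
  inverse matrix at \<open>df\<close>.\<close>

definition grad_norm_sq :: "'n::finite tensor2 \<Rightarrow> (real^'n \<Rightarrow> real) \<Rightarrow> real^'n \<Rightarrow> real" where
  "grad_norm_sq g f x = quad_form (matrix_inv (g x)) (weak_differential f x)"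

text \<open>Functions are not identified when they agree almost everywhere; the identification is made
  in \<open>sobolev_subspace\<close> below, where a subspace contains every representative of its elements.\<close>

definition W12 :: "'n::finite tensor2 \<Rightarrow> (real^'n) measure \<Rightarrow> (real^'n \<Rightarrow> real) set" where
  "W12 g \<mu> = {f. f \<in> borel_measurable borel \<and> integrable \<mu> (\<lambda>x. (f x)\<^sup>2) \<and>
                 (\<exists>v. has_weak_differential f v) \<and> integrable \<mu> (grad_norm_sq g f)}"

definition ae_independent :: "(real^'n) measure \<Rightarrow> nat \<Rightarrow> (nat \<Rightarrow> real^'n \<Rightarrow> real) \<Rightarrow> bool" where
  "ae_independent \<mu> k b \<longleftrightarrow>
     (\<forall>c. (AE x in \<mu>. (\<Sum>i<k. c i * b i x) = 0) \<longrightarrow> (\<forall>i<k. c i = 0))"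

definition ae_span :: "(real^'n) measure \<Rightarrow> nat \<Rightarrow> (nat \<Rightarrow> real^'n \<Rightarrow> real) \<Rightarrow> (real^'n \<Rightarrow> real) set" where
  "ae_span \<mu> k b =
     {f. f \<in> borel_measurable borel \<and> (\<exists>c. AE x in \<mu>. f x = (\<Sum>i<k. c i * b i x))}"

text \<open>Preimages, in the space of functions, of the \<open>k\<close>-dimensional linear subspaces of \<open>W\<^sup>1\<^sup>,\<^sup>2\<close>
  modulo almost everywhere equality.\<close>

definition sobolev_subspace ::
    "'n::finite tensor2 \<Rightarrow> (real^'n) measure \<Rightarrow> nat \<Rightarrow> (real^'n \<Rightarrow> real) set \<Rightarrow> bool" where
  "sobolev_subspace g \<mu> k E \<longleftrightarrow>
     E \<subseteq> W12 g \<mu> \<and> (\<exists>b. ae_independent \<mu> k b \<and> (\<forall>i<k. b i \<in> E) \<and> E = ae_span \<mu> k b)"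

definition rayleigh :: "'n::finite tensor2 \<Rightarrow> (real^'n) measure \<Rightarrow> (real^'n \<Rightarrow> real) \<Rightarrow> real" where
  "rayleigh g \<mu> f = (LINT x|\<mu>. grad_norm_sq g f x) / (LINT x|\<mu>. (f x)\<^sup>2)"

text \<open>Meant for \<open>k \<ge> 1\<close>. Extended reals are used so that no boundedness is presupposed.\<close>

definition variational_eigenvalue :: "nat \<Rightarrow> 'n::finite tensor2 \<Rightarrow> (real^'n) measure \<Rightarrow> ereal" where
  "variational_eigenvalue k g \<mu> =
     (INF E\<in>{E. sobolev_subspace g \<mu> k E}.
        SUP f\<in>{f\<in>E. \<not> (AE x in \<mu>. f x = 0)}. ereal (rayleigh g \<mu> f))"

end

theory Submission
  imports Defs
begin

text \<open>
  The example is the higher-dimensional cigar. With \<open>L = ln \<surd>(1 + |x|\<^sup>2)\<close> put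
  \<open>g = (d - 2) |dx|\<^sup>2 / (1 + |x|\<^sup>2)\<close> and \<open>W = (d - 2) L\<^sup>2 / 2 - d L\<close>. In the variable \<open>t\<close> with
  \<open>|x| = sinh t\<close> the metric is \<open>(d - 2) (dt\<^sup>2 + tanh\<^sup>2 t d\<theta>\<^sup>2)\<close>: a capped half-cylinder over the sphere
  of radius \<open>\<surd>(d - 2)\<close>, the radius at which the Ricci curvature of the cross-section \<open>S\<^sup>d\<^sup>-\<^sup>1\<close> equals
  its metric, while along the end \<open>W\<close> grows like half the square of arc length. On the model
  \<open>S\<^sup>d\<^sup>-\<^sup>1 \<times> \<real>\<close> with a Gaussian weight on the line, the constants, the linear function on the line
  (eigenvalue 1) and the \<open>d\<close> coordinate functions of the sphere (eigenvalue
  \<open>(d - 1)/(d - 2)\<close>, below 2 once \<open>d \<ge> 4\<close>) are \<open>d + 2\<close> independent functions below level 2. The cap,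
  which makes the manifold an \<open>\<real>\<^sup>d\<close>, does not spoil this.

  Geometry. The metric is conformally flat, so its curvature is an explicit computation
  (\<open>cigar_ricci\<close>, \<open>cigar_hessian\<close>), which gives \<open>Ric \<ge> 0\<close> and
  \<open>Ric + Hess W = (1 + L / (1 + |x|\<^sup>2)) g\<close>. Completeness (\<open>cigar_complete\<close>) holds because a
  smoothed logarithm of the Euclidean distance to a fixed point is Lipschitz for the cigar distance.

  Spectrum of the cigar. The weighted volume is a multiple of \<open>exp (- (d - 2) L\<^sup>2 / 2) dx\<close>. The test
  space is spanned by 1, by \<open>L\<close> minus its mean, and by \<open>x\<^sub>i / \<surd>(1 + |x|\<^sup>2)\<close>. Reflection at the origin
  makes the even and the odd part orthogonal for both quadratic forms
  (\<open>variational_eigenvalue_upper_bound\<close>), so each part is treated alone. If \<open>A\<close> denotes the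
  nonnegative weighted Laplacian, then \<open>A L = 2 L - (L + L exp (- 2 L)) - const\<close>; the bracket is an
  increasing function of \<open>L\<close>, hence positively correlated with \<open>L\<close>, and the Rayleigh quotient of the
  centred \<open>L\<close> is below 2 (\<open>radial_gap\<close>). The odd functions satisfy \<open>A f = \<kappa> f\<close> with a function
  \<open>\<kappa> < 2\<close> away from the origin (\<open>angular_gap\<close>, \<open>angular_gap_pos\<close>), and a compactness
  argument in the coefficients makes the gap uniform (\<open>quadratic_forms_comparable\<close>).

  The Gaussian. The space spanned by 1, the \<open>x\<^sub>i\<close> and one second Hermite polynomial gives the upper
  bound 2. For the lower bound, a space of dimension \<open>d + 2\<close> contains a nonzero \<open>f\<close> orthogonal to 1
  and to all \<open>x\<^sub>i\<close>, and such \<open>f\<close> satisfy \<open>\<integral> |\<nabla>f|\<^sup>2 \<ge> 2 \<integral> f\<^sup>2\<close> (\<open>second_order_poincare\<close>). To see this,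
  approximate \<open>f\<close> by a polynomial \<open>p\<close> with the same orthogonality (\<open>polynomials_dense\<close>) and solve
  \<open>A u = p\<close>, where \<open>A\<close> is now the Ornstein-Uhlenbeck operator, by a polynomial \<open>u\<close>
  (\<open>ou_surjective\<close>). Then \<open>\<integral> f p = \<integral> \<nabla>f \<bullet> \<nabla>u\<close>, and Bochner's identity
  together with the Poincare inequality for the partial derivatives of \<open>u\<close> gives \<open>2 \<integral> |\<nabla>u|\<^sup>2 \<le> \<integral> p\<^sup>2\<close>.
\<close>

section \<open>Smooth functions\<close>

lemma partial_eq_GDERIV:
  assumes "GDERIV f x :> D"
  shows "partial i f x = D $ i"
proof -
  have "frechet_derivative f (at x) = (\<lambda>h. h \<bullet> D)"
    using assms unfolding gderiv_def by (metis frechet_derivative_at)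
  then show ?thesis by (simp add: partial_def inner_commute inner_axis)
qed

lemma differentiable_eq_GDERIV_partial:
  assumes "f differentiable (at x)"
  shows "GDERIV f x :> (\<chi> i. partial i f x)"
proof -
  have D: "(f has_derivative frechet_derivative f (at x)) (at x)"
    using assms by (simp add: frechet_derivative_works)
  then have lin: "linear (frechet_derivative f (at x))" by (rule has_derivative_linear)
  have "frechet_derivative f (at x) h = h \<bullet> (\<chi> i. partial i f x)" for h
  proof -
    have "frechet_derivative f (at x) h = frechet_derivative f (at x) (\<Sum>i\<in>UNIV. h $ i *s axis i 1)"
      by (simp only: basis_expansion)
    also have "\<dots> = (\<Sum>i\<in>UNIV. h $ i * frechet_derivative f (at x) (axis i 1))"
      by (simp only: linear_sum[OF lin] linear_cmul[OF lin] scalar_mult_eq_scaleR real_scaleR_def)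
    finally show ?thesis by (simp add: inner_vec_def partial_def)
  qed
  then have "frechet_derivative f (at x) = (\<lambda>h. h \<bullet> (\<chi> i. partial i f x))" by (rule ext)
  with D show ?thesis unfolding gderiv_def by simp
qed

text \<open>Smoothness is proved by exhibiting a set of functions whose partial derivatives lie again in the
  algebra that the set generates.\<close>

inductive algebra_hull :: "(real^'n \<Rightarrow> real) set \<Rightarrow> (real^'n \<Rightarrow> real) \<Rightarrow> bool" for G where
  base: "f \<in> G \<Longrightarrow> algebra_hull G f"
| const: "algebra_hull G (\<lambda>x. c)"
| add: "algebra_hull G f \<Longrightarrow> algebra_hull G h \<Longrightarrow> algebra_hull G (\<lambda>x. f x + h x)"
| mult: "algebra_hull G f \<Longrightarrow> algebra_hull G h \<Longrightarrow> algebra_hull G (\<lambda>x. f x * h x)"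

lemma partial_add:
  assumes "\<And>x. f differentiable (at x)" "\<And>x. g differentiable (at x)"
  shows "partial i (\<lambda>x. f x + g x) = (\<lambda>x. partial i f x + partial i g x)"
proof
  fix x
  show "partial i (\<lambda>x. f x + g x) x = partial i f x + partial i g x"
    using partial_eq_GDERIV[OF GDERIV_add[OF differentiable_eq_GDERIV_partial[OF assms(1)]
      differentiable_eq_GDERIV_partial[OF assms(2)]]] by simp
qed

lemma partial_mult:
  assumes "\<And>x. f differentiable (at x)" "\<And>x. g differentiable (at x)"
  shows "partial i (\<lambda>x. f x * g x) = (\<lambda>x. f x * partial i g x + g x * partial i f x)"
proof
  fix x
  show "partial i (\<lambda>x. f x * g x) x = f x * partial i g x + g x * partial i f x"
    using partial_eq_GDERIV[OF GDERIV_mult[OF differentiable_eq_GDERIV_partial[OF assms(1)]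
      differentiable_eq_GDERIV_partial[OF assms(2)]]] by simp
qed

lemma partial_const: "partial i (\<lambda>x. c) = (\<lambda>x. 0)"
  using partial_eq_GDERIV[OF GDERIV_const] by (auto simp: fun_eq_iff)

text \<open>The product rule carries closedness under partial derivatives from the generators to the whole
  algebra, so every iterated partial derivative stays in it and is in particular differentiable.\<close>

lemma smooth_algebra_hull:
  assumes G: "\<And>f i x. f \<in> G \<Longrightarrow> f differentiable (at x) \<and> algebra_hull G (partial i f)"
    and f: "algebra_hull G f"
  shows "smooth f"
proof -
  have step: "(\<forall>x. f differentiable (at x)) \<and> algebra_hull G (partial i f)" if "algebra_hull G f" for f i
    using that
  proof (induction rule: algebra_hull.induct)
    case (base f) then show ?case using G by blast
  next
    case (const c) then show ?case by (simp add: partial_const algebra_hull.const)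
  next
    case (add f h) then show ?case by (auto simp: partial_add intro!: algebra_hull.add)
  next
    case (mult f h) then show ?case
      by (auto simp: partial_mult intro!: algebra_hull.add algebra_hull.mult)
  qed
  have "algebra_hull G (foldr partial is f)" for "is"
    by (induction "is") (use f step in auto)
  then show ?thesis unfolding smooth_def using step by blast
qed

lemma smooth_differentiable: "smooth f \<Longrightarrow> f differentiable (at x)"
  unfolding smooth_def by (drule spec[of _ "[]"]) simp

lemma smooth_partial: "smooth f \<Longrightarrow> smooth (partial i f)"
  unfolding smooth_def
proof (intro allI)
  fix "is" x assume *: "\<forall>is x. foldr partial is f differentiable at x"
  show "foldr partial is (partial i f) differentiable at x" using *[rule_format, of "is @ [i]"] by simp
qed

lemma smooth_algebra_hull_smooth: "algebra_hull {f. smooth f} f \<Longrightarrow> smooth f"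
  by (rule smooth_algebra_hull)
     (auto simp: smooth_differentiable smooth_partial intro!: algebra_hull.base)

lemma smooth_mult: "smooth f \<Longrightarrow> smooth g \<Longrightarrow> smooth (\<lambda>x. f x * g x)"
  by (rule smooth_algebra_hull_smooth) (simp add: algebra_hull.intros)

lemma algebra_hull_prod:
  "finite A \<Longrightarrow> (\<And>j. j \<in> A \<Longrightarrow> algebra_hull G (f j)) \<Longrightarrow> algebra_hull G (\<lambda>x. \<Prod>j\<in>A. f j x)"
  by (induction A rule: finite_induct) (auto intro: algebra_hull.intros)

lemma GDERIV_coord: "GDERIV (\<lambda>x. x $ i) x :> axis i 1"
  unfolding gderiv_def
  by (simp add: inner_axis bounded_linear_imp_has_derivative[OF bounded_linear_vec_nth])

lemma partial_coord: "partial j (\<lambda>x. x $ i) = (\<lambda>x. if i = j then 1 else 0)"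
  by (rule ext, subst partial_eq_GDERIV[OF GDERIV_coord]) (simp add: axis_def)

lemma GDERIV_inner_self: "GDERIV (\<lambda>x. x \<bullet> x) x :> 2 *\<^sub>R x"
  unfolding gderiv_def by (auto simp: inner_commute intro!: derivative_eq_intros)

lemma GDERIV_imp_differentiable: "GDERIV f x :> D \<Longrightarrow> f differentiable (at x)"
  unfolding gderiv_def differentiable_def by blast

lemma smooth_algebra_hull_coords:
  fixes H :: "(real^'n \<Rightarrow> real) set"
  defines "C \<equiv> range (\<lambda>i (x :: real^'n). x $ i)"
  assumes H: "\<And>f i x. f \<in> H \<Longrightarrow> f differentiable (at x) \<and> algebra_hull (H \<union> C) (partial i f)"
    and f: "algebra_hull (H \<union> C) f"
  shows "smooth f"
proof (rule smooth_algebra_hull[OF _ f])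
  fix f i x assume "f \<in> H \<union> C"
  then consider "f \<in> H" | j where "f = (\<lambda>x. x $ j)" by (auto simp: C_def)
  then show "f differentiable (at x) \<and> algebra_hull (H \<union> C) (partial i f)"
  proof cases
    case 1
    then show ?thesis by (rule H)
  next
    case 2
    then show ?thesis using GDERIV_imp_differentiable[OF GDERIV_coord]
      by (simp add: partial_coord algebra_hull.const)
  qed
qed

lemma GDERIV_imp_DERIV_line:
  "GDERIV f (x + t *\<^sub>R v) :> D \<Longrightarrow> ((\<lambda>s. f (x + s *\<^sub>R v)) has_real_derivative v \<bullet> D) (at t)"
proof -
  assume "GDERIV f (x + t *\<^sub>R v) :> D"
  then have "(f has_derivative (\<lambda>h. h \<bullet> D)) (at (x + t *\<^sub>R v))"
    by (simp add: gderiv_def)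
  moreover have "((\<lambda>s. x + s *\<^sub>R v) has_derivative (\<lambda>h. h *\<^sub>R v)) (at t)"
    by (auto intro!: derivative_eq_intros)
  ultimately have "((\<lambda>s. f (x + s *\<^sub>R v)) has_derivative (\<lambda>h. (h *\<^sub>R v) \<bullet> D)) (at t)"
    using has_derivative_compose by blast
  then show ?thesis unfolding has_field_derivative_def
    by (simp add: mult.commute[of "_ \<bullet> _"] mult_commute_abs)
qed

section \<open>Compactly supported bump functions\<close>

text \<open>The usual flat function \<open>exp (- 1 / t)\<close> together with its quotients by powers of \<open>t\<close>; the
  derivatives of the former are combinations of the latter.\<close>

definition flat_exp :: "nat \<Rightarrow> real \<Rightarrow> real" where
  "flat_exp k t = (if t > 0 then exp (- 1 / t) / t ^ k else 0)"

lemma flat_exp_nonneg: "0 \<le> flat_exp k t"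
  by (simp add: flat_exp_def)

text \<open>One term of the exponential series of \<open>1 / t\<close>. For \<open>m = 2\<close> it gives the derivative 0 at the
  origin, for \<open>m = 0\<close> boundedness.\<close>

lemma flat_exp_bound:
  assumes "t \<ge> 0"
  shows "flat_exp k t \<le> fact (k + m) * t ^ m"
proof (cases "t > 0")
  case True
  have "(1 / t) ^ (k + m) / fact (k + m) \<le> exp (1 / t)"
    using sum_le_suminf[OF summable_exp_generic, of "{k + m}" "1 / t"] True
    by (simp add: exp_def divide_inverse mult.commute)
  then have "(1 / t) ^ (k + m) \<le> exp (1 / t) * fact (k + m)"
    by (simp add: pos_divide_le_eq)
  then have "(1 / t) ^ (k + m) * exp (- 1 / t) \<le> (exp (1 / t) * fact (k + m)) * exp (- 1 / t)"
    by (intro mult_right_mono) auto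
  also have "\<dots> = (exp (1 / t) * exp (- (1 / t))) * fact (k + m)" by simp
  also have "\<dots> = fact (k + m)" by (simp only: exp_minus_inverse mult_1)
  finally have "(1 / t) ^ (k + m) * exp (- 1 / t) \<le> fact (k + m)" .
  then have "(1 / t) ^ (k + m) * exp (- 1 / t) * t ^ m \<le> fact (k + m) * t ^ m"
    using True by (intro mult_right_mono) auto
  moreover have "(1 / t) ^ (k + m) * exp (- 1 / t) * t ^ m = flat_exp k t"
    using True by (simp add: flat_exp_def power_add field_simps)
  ultimately show ?thesis by simp
qed (use assms in \<open>simp add: flat_exp_def\<close>)

lemma flat_exp_DERIV:
  "(flat_exp k has_real_derivative flat_exp (k + 2) t - k * flat_exp (k + 1) t) (at t)"
proof -
  consider "t > 0" | "t < 0" | "t = 0" by linarith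
  then show ?thesis
  proof cases
    case 1
    have *: "((\<lambda>t. exp (- 1 / t) / t ^ k) has_real_derivative flat_exp (k + 2) t - k * flat_exp (k + 1) t) (at t)"
    proof -
      have "((\<lambda>t. exp (- 1 / t)) has_real_derivative exp (- 1 / t) / t\<^sup>2) (at t)"
        using 1 by (auto intro!: derivative_eq_intros simp: power2_eq_square)
      from DERIV_divide[OF this DERIV_pow[of k t]] 1 have
        "((\<lambda>t. exp (- 1 / t) / t ^ k) has_real_derivative
          (exp (- 1 / t) / t\<^sup>2 * t ^ k - exp (- 1 / t) * (real k * t ^ (k - Suc 0))) / (t ^ k * t ^ k)) (at t)"
        by simp
      moreover have "(exp (- 1 / t) / t\<^sup>2 * t ^ k - exp (- 1 / t) * (real k * t ^ (k - Suc 0))) / (t ^ k * t ^ k)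
          = flat_exp (k + 2) t - k * flat_exp (k + 1) t"
        using 1 by (cases k) (simp_all add: flat_exp_def diff_divide_distrib power_add power2_eq_square)
      ultimately show ?thesis by simp
    qed
    have "\<forall>\<^sub>F u in nhds t. u > 0" using 1 by (intro order_tendstoD(1)[OF filterlim_ident])
    then have "\<forall>\<^sub>F u in nhds t. flat_exp k u = exp (- 1 / u) / u ^ k"
      by eventually_elim (simp add: flat_exp_def)
    from DERIV_cong_ev[OF refl this refl] * show ?thesis by blast
  next
    case 2
    have "\<forall>\<^sub>F u in nhds t. u < 0" using 2 by (intro order_tendstoD(2)[OF filterlim_ident])
    then have "\<forall>\<^sub>F u in nhds t. flat_exp k u = 0"
      by eventually_elim (simp add: flat_exp_def)
    from DERIV_cong_ev[OF refl this refl, of 0] have "(flat_exp k has_real_derivative 0) (at t)" by simp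
    then show ?thesis using 2 by (simp add: flat_exp_def)
  next
    case 3
    obtain C :: real where C: "flat_exp k h \<le> C * h\<^sup>2" if "h \<ge> 0" for h
      using flat_exp_bound[of _ k 2] by blast
    have *: "norm (flat_exp k h / h) \<le> \<bar>C\<bar> * \<bar>h\<bar>" for h
    proof (cases "h > 0")
      case True
      have "flat_exp k h \<le> \<bar>C\<bar> * h\<^sup>2"
        using C[of h] True by (meson abs_ge_self less_imp_le mult_right_mono order_trans zero_le_power2)
      then show ?thesis using True flat_exp_nonneg[of k h]
        by (simp add: pos_divide_le_eq power2_eq_square mult.assoc)
    next
      case False
      then show ?thesis by (simp add: flat_exp_def mult_nonneg_nonpos)
    qed
    have **: "((\<lambda>h. \<bar>C\<bar> * \<bar>h\<bar>) \<longlongrightarrow> 0) (at 0)"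
      by (intro tendsto_mult_right_zero tendsto_rabs_zero tendsto_ident_at)
    have "((\<lambda>h. flat_exp k h / h) \<longlongrightarrow> 0) (at 0)"
      using Lim_null_comparison[OF always_eventually[OF allI] **, of "\<lambda>h. flat_exp k h / h"] * by blast
    moreover have "flat_exp k 0 = 0" "flat_exp (k + 2) 0 - k * flat_exp (k + 1) 0 = 0"
      by (simp_all add: flat_exp_def)
    ultimately show ?thesis unfolding DERIV_def using 3 by simp
  qed
qed

lemma flat_exp_le_1: "flat_exp 0 t \<le> 1"
  using flat_exp_bound[of t 0 0] by (cases "t \<ge> 0") (auto simp: flat_exp_def)

text \<open>A product of one-dimensional bumps, supported in a box. As \<open>k\<close> grows it increases to the indicator
  function of the open box, which is what the uniqueness of weak differentials needs.\<close>

definition bump :: "real^'n \<Rightarrow> real^'n \<Rightarrow> real \<Rightarrow> real^'n \<Rightarrow> real" where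
  "bump a b k x = (\<Prod>j\<in>UNIV. flat_exp 0 (k * (x $ j - a $ j)) * flat_exp 0 (k * (b $ j - x $ j)))"

lemma flat_exp_coord_GDERIV:
  "GDERIV (\<lambda>x. flat_exp k (s * x $ i + c)) x :>
     (flat_exp (k + 2) (s * x $ i + c) - k * flat_exp (k + 1) (s * x $ i + c)) *\<^sub>R (s *\<^sub>R axis i 1)"
proof -
  have "GDERIV (\<lambda>x. s * x $ i + c) x :> s *\<^sub>R axis i 1"
    using GDERIV_add[OF GDERIV_mult[OF GDERIV_const[of s] GDERIV_coord[of i x]] GDERIV_const[of c]] by simp
  from GDERIV_DERIV_compose[OF this flat_exp_DERIV] show ?thesis .
qed

lemma bump_smooth:
  fixes a b :: "real^'n"
  shows "smooth (bump a b k)"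
proof -
  define G :: "(real^'n \<Rightarrow> real) set" where "G = {(\<lambda>x. flat_exp k (s * x $ i + c)) | k s i c. True}"
  have base: "algebra_hull G (\<lambda>x. flat_exp k (s * x $ i + c))" for k s i c
    by (rule algebra_hull.base) (auto simp: G_def)
  show ?thesis
  proof (rule smooth_algebra_hull[of G])
    fix f i x assume "f \<in> G"
    then obtain m s j c where f: "f = (\<lambda>x. flat_exp m (s * x $ j + c))" by (auto simp: G_def)
    have "partial i f = (\<lambda>x. (flat_exp (m + 2) (s * x $ j + c) + (- real m) * flat_exp (m + 1) (s * x $ j + c)) * (s * axis j 1 $ i))"
      unfolding f by (rule ext, subst partial_eq_GDERIV[OF flat_exp_coord_GDERIV]) simp
    moreover have "algebra_hull G \<dots>"
      by (intro algebra_hull.mult algebra_hull.add algebra_hull.const base)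
    ultimately show "f differentiable (at x) \<and> algebra_hull G (partial i f)"
      using GDERIV_imp_differentiable[OF flat_exp_coord_GDERIV] f by auto
  next
    have "bump a b k = (\<lambda>x. \<Prod>j\<in>UNIV. flat_exp 0 (k * x $ j + (- k * a $ j)) * flat_exp 0 ((- k) * x $ j + k * b $ j))"
      by (auto simp: bump_def fun_eq_iff algebra_simps)
    moreover have "algebra_hull G \<dots>"
      by (intro algebra_hull_prod algebra_hull.mult base finite)
    ultimately show "algebra_hull G (bump a b k)" by simp
  qed
qed

lemma bump_nonneg: "0 \<le> bump a b k x"
  by (auto simp: bump_def flat_exp_nonneg intro!: prod_nonneg)

lemma bump_le_1: "bump a b k x \<le> 1"
  unfolding bump_def
  by (rule prod_le_1) (auto simp: flat_exp_nonneg flat_exp_le_1 intro: mult_le_one)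

lemma bump_outside:
  assumes "x \<notin> box a b" "k > 0"
  shows "bump a b k x = 0"
proof -
  obtain j where "\<not> (a $ j < x $ j \<and> x $ j < b $ j)"
    using assms(1) by (auto simp: mem_box_cart)
  then have "flat_exp 0 (k * (x $ j - a $ j)) * flat_exp 0 (k * (b $ j - x $ j)) = 0"
    using assms(2) by (auto simp: flat_exp_def zero_less_mult_iff)
  then show ?thesis unfolding bump_def by (intro prod_zero) auto
qed

lemma bump_le_indicator:
  assumes "k > 0" shows "\<bar>bump a b k x\<bar> \<le> indicator (cbox a b) x"
  using bump_le_1[of a b k x] bump_nonneg[of a b k x] bump_outside[OF _ assms, of x a b]
    box_subset_cbox[of a b]
  by (cases "x \<in> cbox a b") auto

lemma test_function_mult_bump:
  assumes "smooth f" "k > 0"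
  shows "test_function (\<lambda>x. f x * bump a b k x)"
proof -
  have "support_on UNIV (\<lambda>x. f x * bump a b k x) \<subseteq> cbox a b"
    using bump_outside[of _ a b k] assms(2) box_subset_cbox[of a b] by (force simp: support_on_def)
  then have "compact (closure (support_on UNIV (\<lambda>x. f x * bump a b k x)))"
    by (metis bounded_cbox bounded_subset compact_closure)
  then show ?thesis unfolding test_function_def
    using smooth_mult[OF assms(1) bump_smooth] by blast
qed

lemma bump_tendsto_indicator:
  fixes a b x :: "real^'n"
  shows "(\<lambda>n. bump a b (real (Suc n)) x) \<longlonglongrightarrow> indicat_real (box a b) x"
proof (cases "x \<in> box a b")
  case False
  then show ?thesis by (simp add: bump_outside)
next
  case True
  have *: "(\<lambda>n. flat_exp 0 (real (Suc n) * t)) \<longlonglongrightarrow> 1" if "t > 0" for t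
  proof -
    have "(\<lambda>n. exp (- (1 / t) * inverse (real (Suc n)))) \<longlonglongrightarrow> exp (- (1 / t) * 0)"
      by (intro tendsto_exp tendsto_mult_left LIMSEQ_inverse_real_of_nat)
    moreover have "flat_exp 0 (real (Suc n) * t) = exp (- (1 / t) * inverse (real (Suc n)))" for n
      using that by (simp add: flat_exp_def divide_inverse mult.commute)
    ultimately show ?thesis by simp
  qed
  have pos: "x $ j - a $ j > 0" "b $ j - x $ j > 0" for j
    using True by (simp_all add: mem_box_cart)
  have "(\<lambda>n. bump a b (real (Suc n)) x) \<longlonglongrightarrow> (\<Prod>j\<in>(UNIV::'n set). 1 * 1)"
    unfolding bump_def by (intro tendsto_prod tendsto_mult * pos)
  then show ?thesis using True by simp
qed

section \<open>Integration by parts on \<open>\<real>\<^sup>d\<close>\<close>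

lemma lborel_translation:
  fixes f :: "'a::euclidean_space \<Rightarrow> real"
  assumes "f \<in> borel_measurable borel"
  shows "integrable lborel (\<lambda>x. f (x + c)) \<longleftrightarrow> integrable lborel f"
    and "(LINT x|lborel. f (x + c)) = (LINT x|lborel. f x)"
proof -
  have [measurable]: "f \<in> borel_measurable borel" by fact
  have "integrable (distr lborel borel ((+) c)) f \<longleftrightarrow> integrable lborel (\<lambda>x. f (c + x))"
    by (rule integrable_distr_eq) simp_all
  then show "integrable lborel (\<lambda>x. f (x + c)) \<longleftrightarrow> integrable lborel f"
    by (simp add: lborel_distr_plus add.commute)
  have "(LINT x|distr lborel borel ((+) c). f x) = (LINT x|lborel. f (c + x))"
    by (rule integral_distr) simp_all
  then show "(LINT x|lborel. f (x + c)) = (LINT x|lborel. f x)"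
    by (simp add: lborel_distr_plus add.commute)
qed

lemma lborel_reflection:
  fixes f :: "'a::euclidean_space \<Rightarrow> real"
  assumes "f \<in> borel_measurable borel"
  shows "(LINT x|lborel. f (- x)) = (LINT x|lborel. f x)"
proof -
  have [measurable]: "f \<in> borel_measurable borel" by fact
  have "lborel = distr lborel borel (\<lambda>x::'a. - x)"
    using lborel_affine[of "-1" "0::'a"] by (simp add: density_1)
  then have "(LINT x|lborel. f x) = (LINT x|distr lborel borel uminus. f x)" by simp
  also have "\<dots> = (LINT x|lborel. f (- x))"
    by (rule integral_distr) simp_all
  finally show ?thesis ..
qed

lemma integral_odd_eq_0:
  fixes f :: "'a::euclidean_space \<Rightarrow> real"
  assumes "f \<in> borel_measurable borel" "\<And>x. f (- x) = - f x"
  shows "(LINT x|lborel. f x) = 0"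
  using lborel_reflection[OF assms(1)] assms(2) by simp

text \<open>The integral of \<open>F (x + v) - F x\<close> vanishes by translation invariance. By the fundamental theorem of
  calculus and Fubini's theorem it is also the integral of \<open>DF\<close>.\<close>

lemma integral_directional_derivative_eq_0:
  fixes F DF :: "'a::euclidean_space \<Rightarrow> real"
  assumes D: "\<And>x s. ((\<lambda>s. F (x + s *\<^sub>R v)) has_real_derivative DF (x + s *\<^sub>R v)) (at s)"
    and cont: "continuous_on UNIV DF"
    and F: "integrable lborel F" and DF: "integrable lborel DF"
  shows "(LINT x|lborel. DF x) = 0"
proof -
  have [measurable]: "DF \<in> borel_measurable borel" "F \<in> borel_measurable borel"
    using F DF by auto
  let ?h = "\<lambda>s x. indicator {0..1::real} s * DF (x + s *\<^sub>R v)"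
  have int: "integrable (lborel \<Otimes>\<^sub>M lborel) (case_prod ?h)"
  proof (rule lborel_pair.Fubini_integrable)
    show "case_prod ?h \<in> borel_measurable (lborel \<Otimes>\<^sub>M lborel)" by measurable
    have "(LINT x|lborel. norm (?h s x)) = indicator {0..1} s * (LINT x|lborel. \<bar>DF x\<bar>)" for s
      using lborel_translation(2)[of "\<lambda>x. \<bar>DF x\<bar>" "s *\<^sub>R v"] by (simp add: abs_mult)
    then show "integrable lborel (\<lambda>s. LINT x|lborel. norm (case_prod ?h (s, x)))" by simp
    show "AE s in lborel. integrable lborel (\<lambda>x. case_prod ?h (s, x))"
      using lborel_translation(1)[of DF] DF by simp
  qed
  have "(LINT x|lborel. DF x) = (LINT s|lborel. indicator {0..1::real} s * (LINT x|lborel. DF x))"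
    by simp
  also have "\<dots> = (LINT s|lborel. (LINT x|lborel. ?h s x))"
    using lborel_translation(2)[of DF] by simp
  also have "\<dots> = (LINT x|lborel. (LINT s|lborel. ?h s x))"
    using lborel_pair.Fubini_integral[OF int] by simp
  also have "\<dots> = (LINT x|lborel. F (x + v) - F x)"
  proof (rule Bochner_Integration.integral_cong[OF refl])
    fix x
    have "(LINT s|lborel. indicator {0..1::real} s *\<^sub>R DF (x + s *\<^sub>R v)) = F (x + 1 *\<^sub>R v) - F (x + 0 *\<^sub>R v)"
    proof (rule integral_FTC_atLeastAtMost)
      show "((\<lambda>s. F (x + s *\<^sub>R v)) has_vector_derivative DF (x + s *\<^sub>R v)) (at s within {0..1})" for s
        using D has_field_derivative_at_within has_real_derivative_iff_has_vector_derivative by blast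
      show "continuous_on {0..1} (\<lambda>s. DF (x + s *\<^sub>R v))"
        by (intro continuous_on_compose2[OF cont] continuous_intros) auto
    qed simp
    then show "(LINT s|lborel. ?h s x) = F (x + v) - F x" by simp
  qed
  also have "\<dots> = 0"
    using lborel_translation[of F v] F by simp
  finally show ?thesis .
qed

lemma continuous_on_nth:
  fixes f :: "'a::topological_space \<Rightarrow> real^'n"
  assumes "continuous_on S f"
  shows "continuous_on S (\<lambda>x. f x $ i)"
  by (rule bounded_linear.continuous_on[OF bounded_linear_vec_nth assms])

lemma integral_partial_derivative_eq_0:
  fixes F :: "real^'n \<Rightarrow> real"
  assumes D: "\<And>x. GDERIV F x :> DF x"
    and cont: "continuous_on UNIV (\<lambda>x. DF x $ i)"
    and F: "integrable lborel F" and DF: "integrable lborel (\<lambda>x. DF x $ i)"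
  shows "(LINT x|lborel. DF x $ i) = 0"
proof (rule integral_directional_derivative_eq_0[where v="axis i 1", OF _ cont F DF])
  show "((\<lambda>s. F (x + s *\<^sub>R axis i 1)) has_real_derivative DF (x + s *\<^sub>R axis i 1) $ i) (at s)" for x s
    using GDERIV_imp_DERIV_line[OF D, of x "axis i 1" s] by (simp add: inner_axis')
qed

section \<open>Weak differentials\<close>

lemma smooth_continuous: "smooth f \<Longrightarrow> continuous_on S f"
  by (intro differentiable_imp_continuous_on)
     (simp add: differentiable_on_def differentiable_at_withinI smooth_differentiable)

lemma test_function_support:
  assumes "test_function \<phi>"
  obtains K where "compact K" "\<And>x. x \<notin> K \<Longrightarrow> \<phi> x = 0" "\<And>x i. x \<notin> K \<Longrightarrow> partial i \<phi> x = 0"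
proof
  define K where "K = closure (support_on UNIV \<phi>)"
  show "compact K" using assms by (simp add: K_def test_function_def)
  show *: "\<phi> x = 0" if "x \<notin> K" for x
    using that closure_subset[of "support_on UNIV \<phi>"] by (auto simp: K_def support_on_def)
  show "partial i \<phi> x = 0" if "x \<notin> K" for x i
  proof -
    have "(\<phi> has_derivative (\<lambda>h. h \<bullet> 0)) (at x)"
    proof (rule has_derivative_transform_within_open[of "\<lambda>_. 0" _ x UNIV "- K"])
      show "open (- K)" unfolding K_def by (intro open_Compl closed_closure)
      show "x \<in> - K" using that by simp
    qed (use * in auto)
    then have "GDERIV \<phi> x :> 0" by (simp add: gderiv_def)
    from partial_eq_GDERIV[OF this] show ?thesis by simp
  qed
qed

lemma integrable_compact_support:
  fixes f :: "'a::euclidean_space \<Rightarrow> real"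
  assumes "continuous_on UNIV f" "compact K" "\<And>x. x \<notin> K \<Longrightarrow> f x = 0"
  shows "integrable lborel f"
proof -
  have "integrable lborel (\<lambda>x. indicator K x *\<^sub>R f x)"
    using assms(1,2) by (intro borel_integrable_compact) (auto intro: continuous_on_subset)
  moreover have "(\<lambda>x. indicator K x *\<^sub>R f x) = f"
    using assms(3) by (auto simp: fun_eq_iff indicator_def)
  ultimately show ?thesis by simp
qed

lemma continuous_locally_integrable:
  fixes f :: "real^'n \<Rightarrow> 'b::{banach, second_countable_topology}"
  shows "continuous_on UNIV f \<Longrightarrow> locally_integrable f"
  unfolding locally_integrable_def set_integrable_def
  by (auto intro!: borel_integrable_compact borel_measurable_continuous_onI intro: continuous_on_subset)

lemma C1_has_weak_differential:
  fixes f :: "real^'n \<Rightarrow> real"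
  assumes D: "\<And>x. GDERIV f x :> v x" and v: "continuous_on UNIV v"
  shows "has_weak_differential f v"
  unfolding has_weak_differential_def
proof (intro conjI allI impI)
  have f: "continuous_on UNIV f"
    using D by (auto simp: gderiv_def continuous_on_eq_continuous_at intro: has_derivative_continuous)
  show "locally_integrable f" "locally_integrable v"
    using f v by (auto intro: continuous_locally_integrable)
  fix \<phi> :: "real^'n \<Rightarrow> real" and i
  assume \<phi>: "test_function \<phi>"
  then have sm: "smooth \<phi>" by (simp add: test_function_def)
  obtain K where K: "compact K" "\<And>x. x \<notin> K \<Longrightarrow> \<phi> x = 0" "\<And>x i. x \<notin> K \<Longrightarrow> partial i \<phi> x = 0"
    using test_function_support[OF \<phi>] by metis
  have c1: "continuous_on UNIV (\<lambda>x. f x * partial i \<phi> x)"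
    by (intro continuous_intros f smooth_continuous smooth_partial sm)
  have c2: "continuous_on UNIV (\<lambda>x. \<phi> x * v x $ i)"
    by (intro continuous_intros continuous_on_nth v smooth_continuous sm)
  have i1: "integrable lborel (\<lambda>x. f x * partial i \<phi> x)"
    using K by (intro integrable_compact_support[OF c1 K(1)]) auto
  have i2: "integrable lborel (\<lambda>x. \<phi> x * v x $ i)"
    using K by (intro integrable_compact_support[OF c2 K(1)]) auto
  have i3: "integrable lborel (\<lambda>x. f x * \<phi> x)"
    using K by (intro integrable_compact_support[OF _ K(1)]) (auto intro: continuous_on_mult[OF f smooth_continuous[OF sm]])
  have "(LINT x|lborel. (f x *\<^sub>R (\<chi> i. partial i \<phi> x) + \<phi> x *\<^sub>R v x) $ i) = 0"
  proof (rule integral_partial_derivative_eq_0[where F="\<lambda>x. f x * \<phi> x"])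
    show "GDERIV (\<lambda>x. f x * \<phi> x) x :> f x *\<^sub>R (\<chi> i. partial i \<phi> x) + \<phi> x *\<^sub>R v x" for x
      by (intro GDERIV_mult D differentiable_eq_GDERIV_partial smooth_differentiable sm)
    show "continuous_on UNIV (\<lambda>x. (f x *\<^sub>R (\<chi> i. partial i \<phi> x) + \<phi> x *\<^sub>R v x) $ i)"
      using continuous_on_add[OF c1 c2] by simp
    show "integrable lborel (\<lambda>x. (f x *\<^sub>R (\<chi> i. partial i \<phi> x) + \<phi> x *\<^sub>R v x) $ i)"
      using i1 i2 by simp
  qed (rule i3)
  then have "(LINT x|lborel. f x * partial i \<phi> x) + (LINT x|lborel. \<phi> x * v x $ i) = 0"
    using i1 i2 by simp
  then show "(LINT x|lborel. f x * partial i \<phi> x) = - (LINT x|lborel. v x $ i * \<phi> x)"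
    by (simp add: mult.commute)
qed

text \<open>Lebesgue differentiation along cubes.\<close>

lemma integral_boxes_0_imp_AE_0:
  fixes h :: "real^'n \<Rightarrow> real"
  assumes h: "locally_integrable h"
    and 0: "\<And>a b. (LINT x:cbox a b|lborel. h x) = 0"
  shows "AE x in lborel. h x = 0"
proof -
  have si: "set_integrable lborel (cbox a b) h" for a b
    using h by (simp add: locally_integrable_def)
  have int0: "integral (cbox a b) h = 0" for a b
    using set_borel_integral_eq_integral(2)[OF si] 0 by metis
  obtain N where N: "negligible N" "\<And>x e. \<lbrakk>x \<notin> N; 0 < e\<rbrakk> \<Longrightarrow> \<exists>d>0. \<forall>t. 0 < t \<and> t < d \<longrightarrow>
     norm (integral (cbox x (x + t *\<^sub>R One)) h /\<^sub>R t ^ DIM(real^'n) - h x) < e"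
    using integrable_ccontinuous_explicit[of h] set_borel_integral_eq_integral(1)[OF si] by metis
  have h0: "h x = 0" if x: "x \<notin> N" for x
  proof (rule ccontr)
    assume "h x \<noteq> 0"
    then obtain d where d: "d > 0" "\<And>t. 0 < t \<and> t < d \<Longrightarrow> norm (0 /\<^sub>R t ^ DIM(real^'n) - h x) < \<bar>h x\<bar>"
      using N(2)[OF x, of "\<bar>h x\<bar>"] int0 by auto
    from d(2)[of "d/2"] d(1) show False by simp
  qed
  have "AE x in lebesgue. x \<notin> N"
    using N(1) AE_not_in negligible_iff_null_sets by blast
  then have "AE x in lebesgue. h x = 0"
    by eventually_elim (use h0 in auto)
  then show ?thesis by (simp add: AE_completion_iff)
qed

text \<open>Testing with bumps that increase to the indicator of a box shows that the difference of the two weak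
  differentials has integral zero over every box.\<close>

lemma weak_differential_unique:
  fixes v w :: "real^'n \<Rightarrow> real^'n"
  assumes v: "has_weak_differential f v" and w: "has_weak_differential f w"
  shows "AE x in lborel. v x = w x"
proof -
  have "AE x in lborel. v x $ i - w x $ i = 0" for i
  proof (rule integral_boxes_0_imp_AE_0)
    have [measurable]: "v \<in> borel_measurable borel" "w \<in> borel_measurable borel"
      using v w by (auto simp: has_weak_differential_def locally_integrable_def)
    have nth: "u \<in> borel_measurable borel \<Longrightarrow> (\<lambda>x. u x $ i) \<in> borel_measurable borel" for u :: "real^'n \<Rightarrow> real^'n"
      by (rule borel_measurable_continuous_on[where f="\<lambda>y. y $ i"])
         (auto intro!: continuous_on_nth continuous_intros)
    have comp: "set_integrable lborel K (\<lambda>x. u x $ i)" if "locally_integrable u" "compact K"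
      for u :: "real^'n \<Rightarrow> real^'n" and K
    proof -
      have "integrable lborel (\<lambda>x. (indicator K x *\<^sub>R u x) $ i)"
        using that integrable_bounded_linear[OF bounded_linear_vec_nth] 
        unfolding locally_integrable_def set_integrable_def by blast
      then show ?thesis by (simp add: set_integrable_def)
    qed
    have lv: "locally_integrable v" and lw: "locally_integrable w"
      using v w by (auto simp: has_weak_differential_def)
    have si: "set_integrable lborel K (\<lambda>x. v x $ i - w x $ i)" if "compact K" for K
      using comp[OF lv that] comp[OF lw that] by (rule set_integral_diff)
    show li: "locally_integrable (\<lambda>x. v x $ i - w x $ i)"
      unfolding locally_integrable_def using si
      by (auto intro!: borel_measurable_diff nth)
    have m[measurable]: "(\<lambda>x. v x $ i - w x $ i) \<in> borel_measurable borel"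
      using li by (simp add: locally_integrable_def)
    note of_nat_Suc [simp del]
    fix a b :: "real^'n"
    let ?b = "\<lambda>n. bump a b (real (Suc n))"
    have test: "test_function (?b n)" for n
      using test_function_mult_bump[of "\<lambda>_. 1" "real (Suc n)" a b] by (simp add: smooth_algebra_hull_smooth algebra_hull.const)
    have bm[measurable]: "?b n \<in> borel_measurable borel" for n
      by (intro borel_measurable_continuous_onI smooth_continuous bump_smooth)
    have ind: "integrable lborel (\<lambda>x. indicator (cbox a b) x * (u x $ i))" if "locally_integrable u" for u :: "real^'n \<Rightarrow> real^'n"
      using comp[OF that, of "cbox a b"] by (simp add: set_integrable_def)
    have bi: "integrable lborel (\<lambda>x. u x $ i * ?b n x)" if "locally_integrable u" for u :: "real^'n \<Rightarrow> real^'n" and n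
    proof (rule Bochner_Integration.integrable_bound[OF ind[OF that]])
      have "u \<in> borel_measurable borel" using that by (simp add: locally_integrable_def)
      from nth[OF this] show "(\<lambda>x. u x $ i * ?b n x) \<in> borel_measurable lborel" by simp
      have "\<bar>u x $ i\<bar> * \<bar>?b n x\<bar> \<le> \<bar>u x $ i\<bar> * indicator (cbox a b) x" for x
        by (intro mult_left_mono bump_le_indicator) auto
      then show "AE x in lborel. norm (u x $ i * ?b n x) \<le> norm (indicator (cbox a b) x * (u x $ i))"
        by (simp add: abs_mult mult.commute)
    qed
    have z: "(LINT x|lborel. (v x $ i - w x $ i) * ?b n x) = 0" for n
    proof -
      have "(LINT x|lborel. v x $ i * ?b n x) = (LINT x|lborel. w x $ i * ?b n x)"
      proof -
        have *: "(LINT x|lborel. f x * partial i (?b n) x) = - (LINT x|lborel. u x $ i * ?b n x)"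
          if "has_weak_differential f u" for u
          using that test[of n] unfolding has_weak_differential_def by blast
        show ?thesis using *[OF v] *[OF w] by simp
      qed
      then show ?thesis using bi[OF lv, of n] bi[OF lw, of n] by (simp add: left_diff_distrib)
    qed
    have "(\<lambda>n. LINT x|lborel. (v x $ i - w x $ i) * ?b n x) \<longlonglongrightarrow>
          (LINT x|lborel. (v x $ i - w x $ i) * indicat_real (box a b) x)"
    proof (rule integral_dominated_convergence[where w="\<lambda>x. norm (indicator (cbox a b) x *\<^sub>R (v x $ i - w x $ i))"])
      show "integrable lborel (\<lambda>x. norm (indicator (cbox a b) x *\<^sub>R (v x $ i - w x $ i)))"
        using si[of "cbox a b"] by (simp only: set_integrable_def compact_cbox integrable_norm)
      show "AE x in lborel. (\<lambda>n. (v x $ i - w x $ i) * ?b n x) \<longlonglongrightarrow> (v x $ i - w x $ i) * indicat_real (box a b) x"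
        by (intro always_eventually allI tendsto_mult_left bump_tendsto_indicator)
      fix n
      have "\<bar>v x $ i - w x $ i\<bar> * \<bar>?b n x\<bar> \<le> \<bar>v x $ i - w x $ i\<bar> * indicator (cbox a b) x" for x
        by (intro mult_left_mono bump_le_indicator) auto
      then show "AE x in lborel. norm ((v x $ i - w x $ i) * ?b n x) \<le> norm (indicator (cbox a b) x *\<^sub>R (v x $ i - w x $ i))"
        by (simp add: abs_mult mult.commute)
    qed simp_all
    then have "(LINT x|lborel. (v x $ i - w x $ i) * indicat_real (box a b) x) = 0"
      unfolding z using LIMSEQ_unique tendsto_const by blast
    moreover have "(LINT x:cbox a b|lborel. v x $ i - w x $ i) = (LINT x|lborel. (v x $ i - w x $ i) * indicat_real (box a b) x)"
    proof -
      have "AE x in lborel. x \<in> box a b \<longleftrightarrow> x \<in> cbox a b"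
      proof -
        have "cbox a b - box a b \<in> null_sets lborel"
          by (simp add: null_sets_def emeasure_lborel_cbox_eq emeasure_lborel_box_eq emeasure_Diff emeasure_lborel_cbox_finite box_subset_cbox)
        then show ?thesis
          using AE_not_in[of "cbox a b - box a b" lborel] box_subset_cbox[of a b] by (auto elim!: eventually_mono)
      qed
      then show ?thesis unfolding set_lebesgue_integral_def
        by (intro integral_cong_AE) (auto elim!: eventually_mono simp: indicator_def)
    qed
    ultimately show "(LINT x:cbox a b|lborel. v x $ i - w x $ i) = 0" by simp
  qed
  then have "AE x in lborel. \<forall>i\<in>UNIV. v x $ i - w x $ i = 0"
    by (intro AE_finite_allI) auto
  then show ?thesis by eventually_elim (simp add: vec_eq_iff)
qed

text \<open>The definition of the weak differential by choice is thereby harmless: any known candidate, such as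
  the classical gradient, agrees with it almost everywhere.\<close>

lemma weak_differential_AE:
  assumes "has_weak_differential f v"
  shows "AE x in lborel. weak_differential f x = v x"
proof (rule weak_differential_unique[OF _ assms])
  show "has_weak_differential f (weak_differential f)"
    unfolding weak_differential_def by (rule someI[of "has_weak_differential f", OF assms])
qed

lemma has_weak_differential_cong_AE:
  fixes f g :: "real^'n \<Rightarrow> real"
  assumes g: "has_weak_differential g v" and f: "f \<in> borel_measurable borel" and ae: "AE x in lborel. f x = g x"
  shows "has_weak_differential f v"
proof -
  have gm: "g \<in> borel_measurable borel"
    using g by (simp add: has_weak_differential_def locally_integrable_def)
  have "set_integrable lborel K f" if "set_integrable lborel K g" "compact K" for K
  proof -
    have [measurable]: "K \<in> sets borel" using that(2) by (simp add: borel_compact)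
    have "integrable lborel (\<lambda>x. indicator K x *\<^sub>R f x) \<longleftrightarrow> integrable lborel (\<lambda>x. indicator K x *\<^sub>R g x)"
      using ae f gm by (intro integrable_cong_AE) (auto elim!: eventually_mono)
    with that show ?thesis by (simp add: set_integrable_def)
  qed
  moreover have "(LINT x|lborel. f x * partial i \<phi> x) = (LINT x|lborel. g x * partial i \<phi> x)" if "test_function \<phi>" for i \<phi>
  proof (rule integral_cong_AE)
    have "partial i \<phi> \<in> borel_measurable borel"
      using that by (intro borel_measurable_continuous_onI smooth_continuous smooth_partial) (simp add: test_function_def)
    then show "(\<lambda>x. f x * partial i \<phi> x) \<in> borel_measurable lborel" "(\<lambda>x. g x * partial i \<phi> x) \<in> borel_measurable lborel"
      using f gm by auto
  qed (use ae in \<open>auto elim!: eventually_mono\<close>)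
  ultimately show ?thesis using g f by (simp add: has_weak_differential_def locally_integrable_def)
qed

section \<open>Weights with all polynomial moments\<close>

text \<open>Continuous functions of polynomial growth: large enough to contain the trial functions, their gradients and
  the polynomials, small enough to be integrable against both the Gaussian and the weight of the cigar.\<close>

definition tempered :: "(real^'n \<Rightarrow> real) \<Rightarrow> bool" where
  "tempered F \<longleftrightarrow> continuous_on UNIV F \<and> (\<exists>C k. \<forall>x. \<bar>F x\<bar> \<le> C * (1 + x \<bullet> x) ^ k)"

lemma temperedI:
  assumes "continuous_on UNIV F" "\<And>x. \<bar>F x\<bar> \<le> C * (1 + x \<bullet> x) ^ k"
  shows "tempered F"
  using assms unfolding tempered_def by blast

lemma tempered_const: "tempered (\<lambda>x. c)"
  by (rule temperedI[where C="\<bar>c\<bar>" and k=0]) auto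

lemma tempered_coord: "tempered (\<lambda>x. x $ i)"
proof (rule temperedI[where C=1 and k=1])
  show "continuous_on UNIV (\<lambda>x::real^'a. x $ i)" by (intro continuous_intros continuous_on_nth)
  fix x :: "real^'a"
  have "\<bar>x $ i\<bar>\<^sup>2 \<le> x \<bullet> x"
    using component_le_norm_cart[of x i] by (metis abs_ge_zero power2_norm_eq_inner power_mono)
  moreover have "2 * \<bar>x $ i\<bar> \<le> 1 + \<bar>x $ i\<bar>\<^sup>2"
    using zero_le_power2[of "\<bar>x $ i\<bar> - 1"] by (simp add: power2_eq_square algebra_simps)
  ultimately show "\<bar>x $ i\<bar> \<le> 1 * (1 + x \<bullet> x) ^ 1" by simp
qed

lemma tempered_mult: 
  assumes "tempered F" "tempered H" shows "tempered (\<lambda>x. F x * H x)"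
proof -
  obtain C k C' k' where *: "\<And>x. \<bar>F x\<bar> \<le> C * (1 + x \<bullet> x) ^ k" "\<And>x. \<bar>H x\<bar> \<le> C' * (1 + x \<bullet> x) ^ k'"
    using assms unfolding tempered_def by metis
  have "\<bar>F x * H x\<bar> \<le> (C * C') * (1 + x \<bullet> x) ^ (k + k')" for x
    using mult_mono[OF *(1)[of x] *(2)[of x]] order_trans[OF abs_ge_zero *(1)[of x]]
    by (simp add: abs_mult power_add algebra_simps)
  then show ?thesis
    using assms by (intro temperedI) (auto simp: tempered_def intro: continuous_intros)
qed

lemma tempered_add:
  assumes "tempered F" "tempered H" shows "tempered (\<lambda>x. F x + H x)"
proof -
  obtain C k C' k' where *: "\<And>x. \<bar>F x\<bar> \<le> C * (1 + x \<bullet> x) ^ k" "\<And>x. \<bar>H x\<bar> \<le> C' * (1 + x \<bullet> x) ^ k'"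
    using assms unfolding tempered_def by metis
  have "\<bar>F x + H x\<bar> \<le> (\<bar>C\<bar> + \<bar>C'\<bar>) * (1 + x \<bullet> x) ^ (k + k')" for x
  proof -
    have p: "(1 + x \<bullet> x) ^ k \<le> (1 + x \<bullet> x) ^ (k + k')" "(1 + x \<bullet> x) ^ k' \<le> (1 + x \<bullet> x) ^ (k + k')"
      by (auto intro!: power_increasing)
    have "C * (1 + x \<bullet> x) ^ k \<le> \<bar>C\<bar> * (1 + x \<bullet> x) ^ (k + k')" "C' * (1 + x \<bullet> x) ^ k' \<le> \<bar>C'\<bar> * (1 + x \<bullet> x) ^ (k + k')"
      using p by (auto intro!: mult_mono)
    then show ?thesis using *[of x] by (simp add: algebra_simps)
  qed
  then show ?thesis
    using assms by (intro temperedI) (auto simp: tempered_def intro: continuous_intros)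
qed

lemma tempered_minus: "tempered F \<Longrightarrow> tempered (\<lambda>x. - F x)"
  using tempered_mult[OF tempered_const[of "-1"]] by simp

lemma tempered_diff: "tempered F \<Longrightarrow> tempered H \<Longrightarrow> tempered (\<lambda>x. F x - H x)"
  using tempered_add[OF _ tempered_minus] by simp

lemma tempered_sum: "(\<And>j. j \<in> A \<Longrightarrow> tempered (F j)) \<Longrightarrow> tempered (\<lambda>x. \<Sum>j\<in>A. F j x)"
  by (induction A rule: infinite_finite_induct) (auto intro: tempered_const tempered_add)

lemma tempered_power: "tempered F \<Longrightarrow> tempered (\<lambda>x. F x ^ k)"
  by (induction k) (auto intro: tempered_const tempered_mult)

lemma tempered_inner: "(\<And>i. tempered (\<lambda>x. v x $ i)) \<Longrightarrow> (\<And>i. tempered (\<lambda>x. w x $ i)) \<Longrightarrow> tempered (\<lambda>x. v x \<bullet> w x)"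
  unfolding inner_vec_def by (auto intro!: tempered_sum tempered_mult)

lemma tempered_linear: "tempered (\<lambda>x. c \<bullet> x)"
  by (intro tempered_inner tempered_const tempered_coord)

lemmas tempered_intros = tempered_const tempered_coord tempered_mult tempered_add tempered_minus
  tempered_diff tempered_sum tempered_power tempered_inner tempered_linear

lemma tempered_continuous: "tempered F \<Longrightarrow> continuous_on UNIV F"
  by (simp add: tempered_def)

lemma tempered_measurable: "tempered F \<Longrightarrow> F \<in> borel_measurable borel"
  by (simp add: tempered_def borel_measurable_continuous_onI)

text \<open>The open set where the function does not vanish would otherwise have positive measure.\<close>

lemma AE_lborel_continuous_eq_0:
  fixes F :: "real^'n \<Rightarrow> real"
  assumes "continuous_on UNIV F" "AE x in lborel. F x = 0"
  shows "F x = 0"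
proof (rule ccontr)
  assume "F x \<noteq> 0"
  let ?S = "{x. F x \<noteq> 0}"
  have op: "open ?S"
    by (intro open_Collect_neq assms(1) continuous_on_const)
  moreover have "AE x in lebesgue. F x = 0"
    using assms(2) by (simp add: AE_completion_iff)
  then have "?S \<in> null_sets lebesgue"
    using op AE_iff_null_sets[of ?S lebesgue] by simp
  ultimately show False
    using open_not_negligible[of ?S] \<open>F x \<noteq> 0\<close> by (auto simp: negligible_iff_null_sets)
qed

text \<open>The measures \<open>K exp (- U) dx\<close> with all polynomial moments; \<open>V\<close> is the gradient of \<open>U\<close>. Both the
  Gaussian measure and the weighted volume of the cigar are of this form.\<close>

locale rapid_weight =
  fixes U :: "real^'n \<Rightarrow> real" and V :: "real^'n \<Rightarrow> real^'n" and K :: real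
  assumes U: "\<And>x. GDERIV U x :> V x"
    and V: "\<And>i. tempered (\<lambda>x. V x $ i)"
    and K: "K > 0"
    and moments: "\<And>k. integrable lborel (\<lambda>x. (1 + x \<bullet> x) ^ k * exp (- U x))"
begin

text \<open>\<open>G\<close> is integration against the weighted measure \<open>M\<close>, written over the Lebesgue measure.\<close>

definition rho :: "real^'n \<Rightarrow> real" where "rho x = K * exp (- U x)"

definition M :: "(real^'n) measure" where "M = density lborel (\<lambda>x. ennreal (rho x))"

definition G :: "(real^'n \<Rightarrow> real) \<Rightarrow> real" where "G F = (LINT x|lborel. F x * rho x)"

lemma rho_pos: "rho x > 0" using K by (simp add: rho_def)

lemma rho_GDERIV: "GDERIV rho x :> - (rho x *\<^sub>R V x)"
proof -
  have "GDERIV (\<lambda>x. K * exp (- U x)) x :> K *\<^sub>R (exp (- U x) *\<^sub>R (- V x)) + exp (- U x) *\<^sub>R 0"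
    by (intro GDERIV_mult GDERIV_const GDERIV_DERIV_compose[where g=exp] GDERIV_minus U DERIV_exp)
  then show ?thesis by (simp add: rho_def[abs_def])
qed

lemma rho_continuous: "continuous_on UNIV rho"
  using rho_GDERIV by (auto simp: gderiv_def continuous_on_eq_continuous_at intro: has_derivative_continuous)

lemma rho_measurable [measurable]: "rho \<in> borel_measurable borel"
  by (rule borel_measurable_continuous_onI[OF rho_continuous])

lemma tempered_integrable:
  assumes "tempered F" shows "integrable lborel (\<lambda>x. F x * rho x)"
proof -
  obtain C k where C: "\<And>x. \<bar>F x\<bar> \<le> C * (1 + x \<bullet> x) ^ k"
    using assms unfolding tempered_def by metis
  have "integrable lborel (\<lambda>x. (K * C) * ((1 + x \<bullet> x) ^ k * exp (- U x)))"
    using moments by simp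
  then show ?thesis
  proof (rule Bochner_Integration.integrable_bound)
    show "(\<lambda>x. F x * rho x) \<in> borel_measurable lborel"
      using tempered_measurable[OF assms] by simp
    have "\<bar>F x * rho x\<bar> \<le> \<bar>(K * C) * ((1 + x \<bullet> x) ^ k * exp (- U x))\<bar>" for x
    proof -
      have "\<bar>F x * rho x\<bar> = \<bar>F x\<bar> * rho x" using rho_pos[of x] by (simp add: abs_mult)
      also have "\<dots> \<le> (C * (1 + x \<bullet> x) ^ k) * rho x"
        using C[of x] rho_pos[of x] by (intro mult_right_mono) auto
      also have "\<dots> = (K * C) * ((1 + x \<bullet> x) ^ k * exp (- U x))" by (simp add: rho_def)
      finally show ?thesis by simp
    qed
    then show "AE x in lborel. norm (F x * rho x) \<le> norm ((K * C) * ((1 + x \<bullet> x) ^ k * exp (- U x)))"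
      by simp
  qed
qed

lemma G_add: "tempered F \<Longrightarrow> tempered H \<Longrightarrow> G (\<lambda>x. F x + H x) = G F + G H"
  using tempered_integrable[of F] tempered_integrable[of H] by (simp add: G_def distrib_right)

lemma G_diff: "tempered F \<Longrightarrow> tempered H \<Longrightarrow> G (\<lambda>x. F x - H x) = G F - G H"
  using tempered_integrable[of F] tempered_integrable[of H] by (simp add: G_def left_diff_distrib)

lemma G_cmult: "G (\<lambda>x. c * F x) = c * G F"
  by (simp add: G_def mult.assoc)

lemma G_minus: "G (\<lambda>x. - F x) = - G F"
  using G_cmult[of "-1" F] by simp

lemma G_sum: "(\<And>j. j \<in> A \<Longrightarrow> tempered (F j)) \<Longrightarrow> G (\<lambda>x. \<Sum>j\<in>A. F j x) = (\<Sum>j\<in>A. G (F j))"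
  using tempered_integrable by (simp add: G_def sum_distrib_right)

lemma G_mono:
  assumes "tempered F" "tempered H" "\<And>x. F x \<le> H x"
  shows "G F \<le> G H"
  unfolding G_def using assms rho_pos
  by (intro integral_mono tempered_integrable mult_right_mono) (auto simp: less_imp_le)

lemma G_nonneg: "(\<And>x. 0 \<le> F x) \<Longrightarrow> 0 \<le> G F"
  unfolding G_def by (rule integral_nonneg_AE) (auto simp: less_imp_le[OF rho_pos])

lemma G_pos:
  assumes F: "tempered F" "\<And>x. 0 \<le> F x" and x0: "F x0 > 0"
  shows "G F > 0"
proof -
  have "G F \<noteq> 0"
  proof
    assume "G F = 0"
    then have "AE x in lborel. F x * rho x = 0"
      unfolding G_def using tempered_integrable[OF F(1)] F(2)
      by (subst (asm) integral_nonneg_eq_0_iff_AE) (auto simp: less_imp_le[OF rho_pos])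
    then have "F x0 * rho x0 = 0"
      by (intro AE_lborel_continuous_eq_0[where F="\<lambda>x. F x * rho x"])
        (auto intro: continuous_on_mult[OF tempered_continuous[OF F(1)] rho_continuous])
    with x0 rho_pos[of x0] show False by simp
  qed
  with G_nonneg[of F] F(2) show ?thesis by force
qed

lemma G_one_pos: "G (\<lambda>_. 1) > 0"
  by (rule G_pos[where F="\<lambda>_. 1"]) (auto intro: tempered_const)

lemma G_odd:
  assumes "tempered F" "\<And>x. F (- x) = - F x" "\<And>x. U (- x) = U x"
  shows "G F = 0"
  unfolding G_def
proof (rule integral_odd_eq_0)
  show "(\<lambda>x. F x * rho x) \<in> borel_measurable borel"
    using tempered_measurable[OF assms(1)] by simp
qed (simp add: rho_def assms)

lemma integration_by_parts:
  assumes "tempered F" "\<And>x. GDERIV F x :> D x" "tempered (\<lambda>x. D x $ i)"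
  shows "G (\<lambda>x. D x $ i) = G (\<lambda>x. F x * V x $ i)"
proof -
  have i1: "integrable lborel (\<lambda>x. D x $ i * rho x)" by (rule tempered_integrable[OF assms(3)])
  have i2: "integrable lborel (\<lambda>x. (F x * V x $ i) * rho x)"
    by (intro tempered_integrable tempered_mult assms(1) V)
  have eq: "(F x *\<^sub>R - (rho x *\<^sub>R V x) + rho x *\<^sub>R D x) $ i = D x $ i * rho x - (F x * V x $ i) * rho x" for x
    by (simp add: algebra_simps)
  have "(LINT x|lborel. (F x *\<^sub>R - (rho x *\<^sub>R V x) + rho x *\<^sub>R D x) $ i) = 0"
  proof (rule integral_partial_derivative_eq_0[where F="\<lambda>x. F x * rho x"])
    show "GDERIV (\<lambda>x. F x * rho x) x :> F x *\<^sub>R - (rho x *\<^sub>R V x) + rho x *\<^sub>R D x" for x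
      by (intro GDERIV_mult assms rho_GDERIV)
    show "integrable lborel (\<lambda>x. F x * rho x)" by (rule tempered_integrable[OF assms(1)])
    show "continuous_on UNIV (\<lambda>x. (F x *\<^sub>R - (rho x *\<^sub>R V x) + rho x *\<^sub>R D x) $ i)"
      unfolding eq by (intro continuous_intros tempered_continuous assms V rho_continuous)
    show "integrable lborel (\<lambda>x. (F x *\<^sub>R - (rho x *\<^sub>R V x) + rho x *\<^sub>R D x) $ i)"
      unfolding eq using i1 i2 by simp
  qed
  then show ?thesis unfolding eq G_def using i1 i2 by simp
qed

lemma AE_M: "(AE x in M. P x) \<longleftrightarrow> (AE x in lborel. P x)"
  unfolding M_def by (subst AE_density) (auto simp: rho_pos)

lemma integrable_M: "f \<in> borel_measurable borel \<Longrightarrow> integrable M f \<longleftrightarrow> integrable lborel (\<lambda>x. f x * rho x)"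
  for f :: "real^'n \<Rightarrow> real"
  unfolding M_def by (subst integrable_density) (auto simp: less_imp_le[OF rho_pos] mult.commute)

lemma integral_M: "f \<in> borel_measurable borel \<Longrightarrow> (LINT x|M. f x) = G f"
  unfolding M_def G_def by (subst integral_density) (auto simp: less_imp_le[OF rho_pos] mult.commute)

lemma grad_norm_sq_conformal:
  assumes "matrix_inv (g x) = A x *\<^sub>R mat 1"
  shows "grad_norm_sq g f x = A x * (weak_differential f x \<bullet> weak_differential f x)"
  by (simp add: grad_norm_sq_def quad_form_def assms flip: scaleR_matrix_vector_assoc)

text \<open>Allows computing with the classical gradient of a nice representative.\<close>

lemma rayleigh_eq_of_AE:
  assumes gA: "\<And>x. matrix_inv (g x) = A x *\<^sub>R mat 1" and A: "tempered A"
    and F: "tempered F" "\<And>x. GDERIV F x :> DF x" "\<And>i. tempered (\<lambda>x. DF x $ i)"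
    and f: "f \<in> borel_measurable borel" "AE x in lborel. f x = F x"
  shows "f \<in> W12 g M" and "rayleigh g M f = G (\<lambda>x. A x * (DF x \<bullet> DF x)) / G (\<lambda>x. (F x)\<^sup>2)"
proof -
  have cDF: "continuous_on UNIV DF"
    by (subst continuous_on_componentwise) (auto simp: Basis_vec_def inner_axis intro!: tempered_continuous F(3))
  have hF: "has_weak_differential f DF"
    by (rule has_weak_differential_cong_AE[OF C1_has_weak_differential[OF F(2) cDF] f])
  note wd = weak_differential_AE[OF hF]
  have mwd: "weak_differential f \<in> borel_measurable borel"
    using someI[of "has_weak_differential f", OF hF]
    by (simp add: weak_differential_def[symmetric] has_weak_differential_def locally_integrable_def)
  have gn: "grad_norm_sq g f = (\<lambda>x. A x * (weak_differential f x \<bullet> weak_differential f x))"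
    by (rule ext) (rule grad_norm_sq_conformal[OF gA])
  have mgn: "grad_norm_sq g f \<in> borel_measurable borel"
    unfolding gn using tempered_measurable[OF A] mwd by (intro borel_measurable_times borel_measurable_inner)
  have aegn: "AE x in lborel. grad_norm_sq g f x = A x * (DF x \<bullet> DF x)"
    using wd unfolding gn by eventually_elim simp
  have tE: "tempered (\<lambda>x. A x * (DF x \<bullet> DF x))" by (intro tempered_intros A F(3))
  have tN: "tempered (\<lambda>x. (F x)\<^sup>2)" by (intro tempered_intros F)
  have mf2: "(\<lambda>x. (f x)\<^sup>2) \<in> borel_measurable borel" using f(1) by simp
  have aeN: "AE x in lborel. (f x)\<^sup>2 * rho x = (F x)\<^sup>2 * rho x" using f(2) by eventually_elim simp
  have aeE: "AE x in lborel. grad_norm_sq g f x * rho x = (A x * (DF x \<bullet> DF x)) * rho x"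
    using aegn by eventually_elim simp
  have "integrable M (\<lambda>x. (f x)\<^sup>2)"
    using tempered_integrable[OF tN] aeN mf2 tempered_measurable[OF tN]
    by (subst integrable_M[OF mf2], subst integrable_cong_AE[of _ _ "\<lambda>x. (F x)\<^sup>2 * rho x"]) auto
  moreover have "integrable M (grad_norm_sq g f)"
    using tempered_integrable[OF tE] aeE mgn tempered_measurable[OF tE]
    by (subst integrable_M[OF mgn], subst integrable_cong_AE[of _ _ "\<lambda>x. (A x * (DF x \<bullet> DF x)) * rho x"]) auto
  ultimately show "f \<in> W12 g M"
    using f(1) hF by (auto simp: W12_def)
  have "(LINT x|M. (f x)\<^sup>2) = G (\<lambda>x. (F x)\<^sup>2)"
    unfolding integral_M[OF mf2] G_def using aeN mf2 tempered_measurable[OF tN]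
    by (intro integral_cong_AE) auto
  moreover have "(LINT x|M. grad_norm_sq g f x) = G (\<lambda>x. A x * (DF x \<bullet> DF x))"
    unfolding integral_M[OF mgn] G_def using aeE mgn tempered_measurable[OF tE]
    by (intro integral_cong_AE) auto
  ultimately show "rayleigh g M f = G (\<lambda>x. A x * (DF x \<bullet> DF x)) / G (\<lambda>x. (F x)\<^sup>2)"
    by (simp add: rayleigh_def)
qed

end

section \<open>An upper bound for the variational eigenvalue\<close>

context rapid_weight begin

text \<open>The trial space consists of the functions \<open>a + b h(x) + (c \<bullet> x) w(x)\<close> with \<open>h\<close> and \<open>w\<close> even. The first
  two summands are even and the last one is odd; since the measure is even, the mixed terms drop
  out of the \<open>L\<^sup>2\<close> norm and of the energy, and the bound for the whole space follows from the bounds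
  for \<open>h\<close> and for the odd part.\<close>

theorem variational_eigenvalue_upper_bound:
  fixes g :: "'n tensor2" and h w :: "real^'n \<Rightarrow> real"
  assumes gA: "\<And>x. matrix_inv (g x) = A x *\<^sub>R mat 1" and A: "tempered A"
    and Uev: "\<And>x. U (- x) = U x" and Aev: "\<And>x. A (- x) = A x"
    and h: "tempered h" "\<And>x. GDERIV h x :> Dh x" "\<And>i. tempered (\<lambda>x. Dh x $ i)"
    and hev: "\<And>x. h (- x) = h x" "\<And>x. Dh (- x) = - Dh x"
    and w: "tempered w" "\<And>x. GDERIV w x :> Dw x" "\<And>i. tempered (\<lambda>x. Dw x $ i)"
    and wev: "\<And>x. w (- x) = w x" "\<And>x. Dw (- x) = - Dw x"
    and h0: "G h = 0" and hpos: "G (\<lambda>x. (h x)\<^sup>2) > 0"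
    and wpos: "\<And>c. c \<noteq> 0 \<Longrightarrow> G (\<lambda>x. ((c \<bullet> x) * w x)\<^sup>2) > 0"
    and Eh: "G (\<lambda>x. A x * (Dh x \<bullet> Dh x)) \<le> \<Lambda> * G (\<lambda>x. (h x)\<^sup>2)"
    and Ew: "\<And>c. G (\<lambda>x. A x * ((w x *\<^sub>R c + (c \<bullet> x) *\<^sub>R Dw x) \<bullet> (w x *\<^sub>R c + (c \<bullet> x) *\<^sub>R Dw x)))
              \<le> \<Lambda> * G (\<lambda>x. ((c \<bullet> x) * w x)\<^sup>2)"
    and \<Lambda>: "0 \<le> \<Lambda>"
  shows "variational_eigenvalue (CARD('n) + 2) g M \<le> ereal \<Lambda>"
proof -
  define F where "F a b c x = a + b * h x + (c \<bullet> x) * w x" for a b :: real and c x :: "real^'n"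
  define Dl where "Dl c x = w x *\<^sub>R c + (c \<bullet> x) *\<^sub>R Dw x" for c x :: "real^'n"
  define DF where "DF b c x = b *\<^sub>R Dh x + Dl c x" for b :: real and c x :: "real^'n"
  note tw = tempered_intros h w A
  have tDl: "tempered (\<lambda>x. Dl c x $ i)" for c i
    unfolding Dl_def by (auto intro!: tw)
  have tDF: "tempered (\<lambda>x. DF b c x $ i)" for b c i
    unfolding DF_def by (auto intro!: tw tDl)
  have tF: "tempered (F a b c)" for a b c
    unfolding F_def[abs_def] by (auto intro!: tw)
  have DF: "GDERIV (F a b c) x :> DF b c x" for a b c x
  proof -
    have lin: "GDERIV (\<lambda>x. c \<bullet> x) x :> c"
      unfolding gderiv_def by (auto simp: inner_commute intro!: derivative_eq_intros)
    have "GDERIV (\<lambda>x. a + b * h x + (c \<bullet> x) * w x) x :>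
       0 + (b *\<^sub>R Dh x + h x *\<^sub>R 0) + ((c \<bullet> x) *\<^sub>R Dw x + w x *\<^sub>R c)"
      by (intro GDERIV_add GDERIV_mult GDERIV_const h w lin)
    then show ?thesis by (simp add: F_def[abs_def] DF_def Dl_def algebra_simps)
  qed
  have N: "G (\<lambda>x. (F a b c x)\<^sup>2) = a\<^sup>2 * G (\<lambda>_. 1) + b\<^sup>2 * G (\<lambda>x. (h x)\<^sup>2) + G (\<lambda>x. ((c \<bullet> x) * w x)\<^sup>2)" for a b c
  proof -
    have odd: "G (\<lambda>x. (a + b * h x) * ((c \<bullet> x) * w x)) = 0"
      by (rule G_odd) (auto intro!: tw simp: hev wev Uev)
    have "G (\<lambda>x. (F a b c x)\<^sup>2) = G (\<lambda>x. a\<^sup>2 * 1 + (2 * a * b) * h x + b\<^sup>2 * (h x)\<^sup>2 + 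
        2 * ((a + b * h x) * ((c \<bullet> x) * w x)) + ((c \<bullet> x) * w x)\<^sup>2)"
      by (rule arg_cong[where f=G]) (auto simp: F_def power2_eq_square algebra_simps)
    also have "\<dots> = a\<^sup>2 * G (\<lambda>_. 1) + (2 * a * b) * G h + b\<^sup>2 * G (\<lambda>x. (h x)\<^sup>2)
        + 2 * G (\<lambda>x. (a + b * h x) * ((c \<bullet> x) * w x)) + G (\<lambda>x. ((c \<bullet> x) * w x)\<^sup>2)"
      by (subst G_add G_cmult; (intro tw)?)+ simp
    finally show ?thesis using h0 odd by simp
  qed
  have E: "G (\<lambda>x. A x * (DF b c x \<bullet> DF b c x)) = b\<^sup>2 * G (\<lambda>x. A x * (Dh x \<bullet> Dh x)) + G (\<lambda>x. A x * (Dl c x \<bullet> Dl c x))" for b c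
  proof -
    have t1: "tempered (\<lambda>x. A x * (Dh x \<bullet> Dh x))" "tempered (\<lambda>x. A x * (Dh x \<bullet> Dl c x))"
        "tempered (\<lambda>x. A x * (Dl c x \<bullet> Dl c x))"
      by (auto intro!: tw tDl)
    have odd: "G (\<lambda>x. A x * (Dh x \<bullet> Dl c x)) = 0"
      by (rule G_odd[OF t1(2)]) (auto simp: Dl_def Aev hev wev Uev)
    have "G (\<lambda>x. A x * (DF b c x \<bullet> DF b c x)) = G (\<lambda>x. b\<^sup>2 * (A x * (Dh x \<bullet> Dh x)) +
        (2 * b) * (A x * (Dh x \<bullet> Dl c x)) + A x * (Dl c x \<bullet> Dl c x))"
      by (rule arg_cong[where f=G])
         (auto simp: DF_def power2_eq_square inner_add_left inner_add_right inner_commute algebra_simps)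
    also have "\<dots> = b\<^sup>2 * G (\<lambda>x. A x * (Dh x \<bullet> Dh x)) + (2 * b) * G (\<lambda>x. A x * (Dh x \<bullet> Dl c x)) + G (\<lambda>x. A x * (Dl c x \<bullet> Dl c x))"
      by (subst G_add G_cmult; (intro tempered_add tempered_mult tempered_const t1)?)+ simp
    finally show ?thesis using odd by simp
  qed
  note G1 = G_one_pos
  have EN: "G (\<lambda>x. A x * (DF b c x \<bullet> DF b c x)) \<le> \<Lambda> * G (\<lambda>x. (F a b c x)\<^sup>2)" for a b c
  proof -
    have "0 \<le> \<Lambda> * (a\<^sup>2 * G (\<lambda>_. 1))" using \<Lambda> G1 by simp
    moreover have "b\<^sup>2 * G (\<lambda>x. A x * (Dh x \<bullet> Dh x)) \<le> b\<^sup>2 * (\<Lambda> * G (\<lambda>x. (h x)\<^sup>2))"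
      using Eh by (rule mult_left_mono) simp
    ultimately show ?thesis using Ew[of c] unfolding E N Dl_def by (simp add: algebra_simps)
  qed
  have N0: "a = 0 \<and> b = 0 \<and> c = 0" if "G (\<lambda>x. (F a b c x)\<^sup>2) = 0" for a b c
  proof -
    have "0 \<le> a\<^sup>2 * G (\<lambda>_. 1)" "0 \<le> b\<^sup>2 * G (\<lambda>x. (h x)\<^sup>2)" using G1 hpos by auto
    moreover have "0 \<le> G (\<lambda>x. ((c \<bullet> x) * w x)\<^sup>2)" by (rule G_nonneg) simp
    ultimately have "a\<^sup>2 * G (\<lambda>_. 1) = 0" "b\<^sup>2 * G (\<lambda>x. (h x)\<^sup>2) = 0" "G (\<lambda>x. ((c \<bullet> x) * w x)\<^sup>2) = 0"
      using that unfolding N by linarith+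
    then show ?thesis using G1 hpos wpos[of c] by auto
  qed
  \<comment> \<open>Basis functions number 0 and 1 are the constant and \<open>h\<close>; number \<open>k + 2\<close> is the odd function of the \<open>k\<close>-th coordinate.\<close>
  obtain e :: "nat \<Rightarrow> 'n" where e: "bij_betw e {..<CARD('n)} UNIV"
    using ex_bij_betw_nat_finite[of "UNIV :: 'n set"] by (auto simp: atLeast0LessThan)
  define bs :: "nat \<Rightarrow> real^'n \<Rightarrow> real" where
    "bs k = (case k of 0 \<Rightarrow> F 1 0 0 | Suc 0 \<Rightarrow> F 0 1 0 | Suc (Suc k) \<Rightarrow> F 0 0 (axis (e k) 1))" for k
  define cv where "cv c = (\<Sum>k<CARD('n). c (Suc (Suc k)) *\<^sub>R axis (e k) 1 :: real^'n)" for c :: "nat \<Rightarrow> real"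
  have bs: "(\<Sum>k<CARD('n) + 2. c k * bs k x) = F (c 0) (c 1) (cv c) x" for c x
  proof -
    have "(\<Sum>k<CARD('n) + 2. c k * bs k x) = c 0 * bs 0 x + (c 1 * bs 1 x + (\<Sum>k<CARD('n). c (Suc (Suc k)) * bs (Suc (Suc k)) x))"
      by (simp add: sum.lessThan_Suc_shift del: sum.lessThan_Suc)
    also have "\<dots> = F (c 0) (c 1) (cv c) x"
      by (simp add: bs_def F_def cv_def inner_sum_left sum_distrib_left sum_distrib_right algebra_simps)
    finally show ?thesis .
  qed
  have cv_nth: "cv c $ e k = c (Suc (Suc k))" if "k < CARD('n)" for c k
  proof -
    have "cv c $ e k = (\<Sum>m<CARD('n). if m = k then c (Suc (Suc m)) else 0)"
    proof -
      have "e k = e m \<longleftrightarrow> m = k" if "m < CARD('n)" for m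
        using e that \<open>k < CARD('n)\<close> by (auto simp: bij_betw_def inj_on_def)
      then show ?thesis unfolding cv_def
        by (auto simp: axis_def if_distrib[of "\<lambda>y. _ * y"] intro!: sum.cong cong: if_cong)
    qed
    then show ?thesis using that by simp
  qed
  define S where "S = ae_span M (CARD('n) + 2) bs"
  have span: "\<exists>a b c. AE x in lborel. f x = F a b c x" if "f \<in> S" for f
    using that unfolding S_def ae_span_def bs AE_M by blast
  have bS: "bs k \<in> S" if "k < CARD('n) + 2" for k
  proof -
    have eq: "bs k x = (\<Sum>i<CARD('n) + 2. (if i = k then 1 else 0) * bs i x)" for x
      using that by (simp add: if_distrib[of "\<lambda>y. y * _"] cong: if_cong)
    have "bs k \<in> borel_measurable borel"
      unfolding bs_def by (auto split: nat.split intro!: tempered_measurable tF)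
    moreover have "\<exists>c. AE x in M. bs k x = (\<Sum>i<CARD('n) + 2. c i * bs i x)"
      by (rule exI[of _ "\<lambda>i. if i = k then 1 else 0"]) (rule always_eventually, rule allI, rule eq)
    ultimately show ?thesis unfolding S_def ae_span_def by blast
  qed
  have SW: "S \<subseteq> W12 g M"
  proof
    fix f assume f: "f \<in> S"
    then have "f \<in> borel_measurable borel" by (simp add: S_def ae_span_def)
    with span[OF f] show "f \<in> W12 g M"
      using rayleigh_eq_of_AE(1)[OF gA A tF DF tDF] by blast
  qed
  have "ae_independent M (CARD('n) + 2) bs"
    unfolding ae_independent_def bs AE_M
  proof (intro allI impI)
    fix c :: "nat \<Rightarrow> real" and i
    assume ae: "AE x in lborel. F (c 0) (c 1) (cv c) x = 0" and i: "i < CARD('n) + 2"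
    have "F (c 0) (c 1) (cv c) x = 0" for x
      using AE_lborel_continuous_eq_0[OF tempered_continuous[OF tF] ae] .
    then have "G (\<lambda>x. (F (c 0) (c 1) (cv c) x)\<^sup>2) = 0" by (simp add: G_def)
    from N0[OF this] have z: "c 0 = 0" "c 1 = 0" "cv c = 0" by auto
    consider "i = 0" | "i = 1" | k where "i = Suc (Suc k)" "k < CARD('n)"
      using i by (metis One_nat_def add_2_eq_Suc' less_Suc_eq_0_disj old.nat.exhaust)
    then show "c i = 0"
    proof cases
      case (3 k)
      then show ?thesis using cv_nth[of k c] z by simp
    qed (use z in auto)
  qed
  with SW bS have sub: "sobolev_subspace g M (CARD('n) + 2) S"
    unfolding sobolev_subspace_def S_def by blast
  have "ereal (rayleigh g M f) \<le> ereal \<Lambda>" if f: "f \<in> S" for f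
  proof -
    obtain a b c where abc: "AE x in lborel. f x = F a b c x" using span[OF f] by blast
    have "f \<in> borel_measurable borel" using f by (simp add: S_def ae_span_def)
    then have "rayleigh g M f = G (\<lambda>x. A x * (DF b c x \<bullet> DF b c x)) / G (\<lambda>x. (F a b c x)\<^sup>2)"
      using rayleigh_eq_of_AE(2)[OF gA A tF DF tDF _ abc] by blast
    moreover have "0 \<le> G (\<lambda>x. (F a b c x)\<^sup>2)" by (rule G_nonneg) simp
    ultimately have "rayleigh g M f \<le> \<Lambda>"
      using EN[of b c a] \<Lambda> by (cases "G (\<lambda>x. (F a b c x)\<^sup>2) = 0") (auto simp: divide_le_eq)
    then show ?thesis by simp
  qed
  then have "(SUP f\<in>{f\<in>S. \<not> (AE x in M. f x = 0)}. ereal (rayleigh g M f)) \<le> ereal \<Lambda>"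
    by (intro SUP_least) auto
  then show ?thesis
    unfolding variational_eigenvalue_def using sub by (intro INF_lower2[of S]) auto
qed

end

section \<open>The cigar metric\<close>

text \<open>The square of the Japanese bracket \<open>\<langle>x\<rangle> = \<surd>(1 + |x|\<^sup>2)\<close>; the function \<open>lq\<close> below is \<open>ln \<langle>x\<rangle>\<close>.\<close>

definition q :: "real^'n \<Rightarrow> real" where "q x = 1 + x \<bullet> x"

definition lq :: "real^'n \<Rightarrow> real" where "lq x = ln (q x) / 2"

text \<open>The parameter \<open>c\<close> will be \<open>d - 2\<close>.\<close>

definition cigar :: "real \<Rightarrow> 'n::finite tensor2" where
  "cigar c x = (c / q x) *\<^sub>R mat 1"

definition cigar_potential :: "real \<Rightarrow> real^'n \<Rightarrow> real" where
  "cigar_potential c x = c / 2 * (lq x)\<^sup>2 - (c + 2) * lq x"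

lemma q_ge_1: "q x \<ge> 1" by (simp add: q_def)

lemma q_pos: "q x > 0" using q_ge_1[of x] by linarith

lemma q_nonzero: "q x \<noteq> 0" using q_pos[of x] by linarith

lemma lq_nonneg: "lq x \<ge> 0" by (simp add: lq_def q_ge_1)

lemma q_GDERIV: "GDERIV q x :> 2 *\<^sub>R x"
  using GDERIV_add[OF GDERIV_const[of 1 x] GDERIV_inner_self[of x]] by (simp add: q_def[abs_def])

lemma inverse_q_GDERIV: "GDERIV (\<lambda>x. inverse (q x)) x :> (- 2 * inverse (q x) * inverse (q x)) *\<^sub>R x"
  using GDERIV_inverse[OF q_GDERIV q_nonzero, of x] by (simp add: power2_eq_square mult_ac)

lemma lq_GDERIV: "GDERIV lq x :> inverse (q x) *\<^sub>R x"
proof -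
  have "DERIV (\<lambda>t. ln t / 2) (q x) :> inverse (q x) / 2"
    by (rule DERIV_cdivide[OF DERIV_ln[OF q_pos]])
  from GDERIV_DERIV_compose[OF q_GDERIV this] show ?thesis by (simp add: lq_def[abs_def])
qed

text \<open>Generators of an algebra closed under partial derivatives: those of \<open>1 / q\<close> and of \<open>lq\<close> are
  \<open>- 2 x\<^sub>i / q\<^sup>2\<close> and \<open>x\<^sub>i / q\<close>.\<close>

definition cigar_functions :: "(real^'n \<Rightarrow> real) set" where
  "cigar_functions = {\<lambda>x. inverse (q x), lq} \<union> range (\<lambda>i x. x $ i)"

lemma smooth_cigar_functions:
  assumes "algebra_hull cigar_functions f" shows "smooth f"
proof (rule smooth_algebra_hull_coords[of "{\<lambda>x. inverse (q x), lq}"])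
  show "algebra_hull ({\<lambda>x. inverse (q x), lq} \<union> range (\<lambda>i x. x $ i)) f"
    using assms by (simp only: cigar_functions_def)
  fix f :: "real^'n \<Rightarrow> real" and i x assume "f \<in> {\<lambda>x. inverse (q x), lq}"
  then consider "f = (\<lambda>x. inverse (q x))" | "f = lq" by blast
  then have "f differentiable (at x) \<and> algebra_hull cigar_functions (partial i f)"
  proof cases
    case 1
    have "partial i f = (\<lambda>x. - 2 * inverse (q x) * inverse (q x) * x $ i)"
      unfolding 1 by (rule ext, subst partial_eq_GDERIV[OF inverse_q_GDERIV]) simp
    moreover have "algebra_hull cigar_functions \<dots>"
      by (intro algebra_hull.mult algebra_hull.const) (auto simp: cigar_functions_def intro!: algebra_hull.base)
    ultimately show ?thesis using GDERIV_imp_differentiable[OF inverse_q_GDERIV] 1 by simp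
  next
    case 2
    have "partial i f = (\<lambda>x. inverse (q x) * x $ i)"
      unfolding 2 by (rule ext, subst partial_eq_GDERIV[OF lq_GDERIV]) simp
    moreover have "algebra_hull cigar_functions \<dots>"
      by (intro algebra_hull.mult algebra_hull.const) (auto simp: cigar_functions_def intro!: algebra_hull.base)
    ultimately show ?thesis using GDERIV_imp_differentiable[OF lq_GDERIV] 2 by simp
  qed
  then show "f differentiable (at x) \<and>
      algebra_hull ({\<lambda>x. inverse (q x), lq} \<union> range (\<lambda>i x. x $ i)) (partial i f)"
    by (simp only: cigar_functions_def)
qed

abbreviation \<delta> :: "'n \<Rightarrow> 'n \<Rightarrow> real" where "\<delta> i j \<equiv> (if i = j then 1 else 0)"

lemma cigar_nth: "cigar c x $ i $ j = c * \<delta> i j * inverse (q x)"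
  by (simp add: cigar_def mat_def divide_inverse)

lemma cigar_smooth: "smooth (\<lambda>x. cigar c x $ i $ j)"
  unfolding cigar_nth
  by (intro smooth_cigar_functions algebra_hull.mult algebra_hull.const algebra_hull.base)
     (simp add: cigar_functions_def)

lemma cigar_potential_smooth: "smooth (cigar_potential c)"
proof -
  have eq: "cigar_potential c = (\<lambda>x. c / 2 * (lq x * lq x) + (- (c + 2)) * lq x)"
    by (auto simp: cigar_potential_def power2_eq_square algebra_simps)
  show ?thesis unfolding eq
    by (intro smooth_cigar_functions algebra_hull.mult algebra_hull.add algebra_hull.const algebra_hull.base)
       (simp_all add: cigar_functions_def)
qed

lemma quad_form_scaleR_mat: "quad_form (a *\<^sub>R mat 1) v = a * (v \<bullet> v)"
  by (simp add: quad_form_def flip: scaleR_matrix_vector_assoc)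

lemma cigar_riemannian:
  assumes "c > 0" shows "riemannian_metric (cigar c)"
  unfolding riemannian_metric_def
proof (intro conjI allI impI)
  show "transpose (cigar c x) = cigar c x" for x
    by (auto simp: transpose_def vec_eq_iff cigar_nth)
  show "0 < quad_form (cigar c x) v" if "v \<noteq> 0" for x v
    using that assms q_pos[of x] by (simp add: cigar_def quad_form_scaleR_mat)
qed (rule cigar_smooth)

lemma matrix_inv_eqI:
  fixes A B :: "real^'n^'n"
  assumes "A ** B = mat 1" "B ** A = mat 1"
  shows "matrix_inv A = B"
  unfolding matrix_inv_def
proof (rule some_equality)
  fix C assume C: "A ** C = mat 1 \<and> C ** A = mat 1"
  have "C = C ** (A ** B)" using assms(1) by simp
  also have "\<dots> = B" using C by (simp add: matrix_mul_assoc)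
  finally show "C = B" .
qed (use assms in simp)

lemma matrix_inv_scaleR_mat:
  assumes "a \<noteq> 0" shows "matrix_inv (a *\<^sub>R mat 1 :: real^'n^'n) = inverse a *\<^sub>R mat 1"
  by (rule matrix_inv_eqI) (use assms in \<open>simp_all flip: scalar_matrix_assoc matrix_scalar_ac\<close>)

lemma cigar_matrix_inv:
  assumes "c > 0" shows "matrix_inv (cigar c x) = (q x / c) *\<^sub>R mat 1"
  using assms q_nonzero[of x] by (simp add: cigar_def matrix_inv_scaleR_mat)

lemma partial_inverse_q: "partial i (\<lambda>x. a * inverse (q x)) x = - 2 * a * x $ i * (inverse (q x))\<^sup>2"
  by (subst partial_eq_GDERIV[OF GDERIV_mult[OF GDERIV_const inverse_q_GDERIV]])
     (simp add: power2_eq_square)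

lemma cigar_christoffel:
  assumes "c > 0"
  shows "christoffel (cigar c) k i j x = - (\<delta> j k * x $ i + \<delta> i k * x $ j - \<delta> i j * x $ k) * inverse (q x)"
proof -
  have "(\<Sum>l\<in>UNIV. matrix_inv (cigar c x) $ k $ l * (partial i (\<lambda>y. cigar c y $ j $ l) x
          + partial j (\<lambda>y. cigar c y $ i $ l) x - partial l (\<lambda>y. cigar c y $ i $ j) x))
      = (\<Sum>l\<in>UNIV. (if l = k then q x / c * (- 2 * c * (inverse (q x))\<^sup>2)
            * (\<delta> j l * x $ i + \<delta> i l * x $ j - \<delta> i j * x $ l) else 0))"
    unfolding cigar_nth partial_inverse_q cigar_matrix_inv[OF assms]
    by (intro sum.cong refl) (auto simp: mat_def algebra_simps)
  also have "\<dots> = q x / c * (- 2 * c * (inverse (q x))\<^sup>2) * (\<delta> j k * x $ i + \<delta> i k * x $ j - \<delta> i j * x $ k)"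
    by (simp only: sum.delta finite_class.finite_UNIV UNIV_I if_True)
  also have "q x / c * (- 2 * c * (inverse (q x))\<^sup>2) = - 2 * inverse (q x)"
    using assms q_nonzero[of x] by (simp add: field_simps power2_eq_square)
  finally show ?thesis unfolding christoffel_def by simp
qed

lemma partial_christoffel:
  assumes "c > 0"
  shows "partial m (christoffel (cigar c) k i j) x =
    - (\<delta> j k * \<delta> i m + \<delta> i k * \<delta> j m - \<delta> i j * \<delta> k m) * inverse (q x)
    + 2 * x $ m * (\<delta> j k * x $ i + \<delta> i k * x $ j - \<delta> i j * x $ k) * (inverse (q x))\<^sup>2"
proof -
  have "GDERIV (\<lambda>x. - (\<delta> j k * x $ i + \<delta> i k * x $ j - \<delta> i j * x $ k)) x :>
      - ((\<delta> j k *\<^sub>R axis i 1 + x $ i *\<^sub>R 0) + (\<delta> i k *\<^sub>R axis j 1 + x $ j *\<^sub>R 0) - (\<delta> i j *\<^sub>R axis k 1 + x $ k *\<^sub>R 0))"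
    by (intro GDERIV_minus GDERIV_add GDERIV_diff GDERIV_mult GDERIV_const GDERIV_coord)
  note partial_eq_GDERIV[OF GDERIV_mult[OF this inverse_q_GDERIV], of m]
  moreover have "christoffel (cigar c) k i j =
      (\<lambda>x. - (\<delta> j k * x $ i + \<delta> i k * x $ j - \<delta> i j * x $ k) * inverse (q x))"
    by (rule ext) (rule cigar_christoffel[OF assms])
  moreover have "axis i' 1 $ m = \<delta> i' m" for i' by (simp add: axis_def)
  ultimately show ?thesis by (simp only: vector_add_component vector_minus_component
     vector_uminus_component vector_scaleR_component zero_index) (simp add: power2_eq_square algebra_simps)
qed

lemma sum_delta_left: "(\<Sum>i\<in>UNIV. \<delta> i k * f i) = f k" "(\<Sum>i\<in>UNIV. \<delta> k i * f i) = f k"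
  for f :: "'n::finite \<Rightarrow> real"
  by (simp_all add: if_distrib[of "\<lambda>y. y * _"] cong: if_cong)

lemma sum_square_nth: "(\<Sum>i\<in>UNIV. x $ i * x $ i) = x \<bullet> x"
  by (simp add: inner_vec_def)


lemma sum_distrib_simps: 
  "(\<Sum>i\<in>UNIV. a * f i) = a * (\<Sum>i\<in>UNIV. f i)" "(\<Sum>i\<in>UNIV. f i * a) = (\<Sum>i\<in>UNIV. f i) * a"
  for f :: "'n::finite \<Rightarrow> real"
  by (simp_all add: sum_distrib_left sum_distrib_right)

text \<open>The four sums in the definition of the Ricci tensor are evaluated separately; every summand is a
  combination of Kronecker deltas and coordinates.\<close>

lemma cigar_ricci:
  fixes x :: "real^'n"
  assumes "c > 0" and c: "c = real CARD('n) - 2"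
  shows "ricci (cigar c) x $ j $ k = (c / q x + (c + 2) / (q x)\<^sup>2) * \<delta> j k - c / (q x)\<^sup>2 * (x $ j * x $ k)"
proof -
  define p where "p = inverse (q x)"
  define T where "T k i j = \<delta> j k * x $ i + \<delta> i k * x $ j - \<delta> i j * x $ k" for i j k
  have d: "real CARD('n) = c + 2" using c by simp
  have A1: "(\<Sum>i\<in>UNIV. partial i (christoffel (cigar c) i j k) x)
      = c * \<delta> j k * p + 2 * (2 * x $ j * x $ k - \<delta> j k * (x \<bullet> x)) * p\<^sup>2"
  proof -
    have "partial i (christoffel (cigar c) i j k) x = 
       - (2 * (\<delta> i j * \<delta> j k) - \<delta> j k) * p + 2 * ((\<delta> i k * (x $ i * x $ j) + \<delta> i j * (x $ i * x $ k)) - \<delta> j k * (x $ i * x $ i)) * p\<^sup>2" for i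
      unfolding partial_christoffel[OF assms(1)] by (auto simp: p_def algebra_simps)
    then have "(\<Sum>i\<in>UNIV. partial i (christoffel (cigar c) i j k) x) = 
       - (2 * \<delta> j k - real CARD('n) * \<delta> j k) * p + 2 * ((x $ k * x $ j + x $ j * x $ k) - \<delta> j k * (x \<bullet> x)) * p\<^sup>2"
      by (simp add: sum.distrib sum_subtractf sum_negf sum_distrib_simps sum_delta_left sum_square_nth)
    then show ?thesis unfolding d by (simp add: algebra_simps)
  qed
  have A2: "(\<Sum>i\<in>UNIV. partial j (christoffel (cigar c) i i k) x)
      = - (c + 2) * \<delta> j k * p + 2 * (c + 2) * x $ j * x $ k * p\<^sup>2"
  proof -
    have "partial j (christoffel (cigar c) i i k) x = - \<delta> j k * p + 2 * x $ j * x $ k * p\<^sup>2" for i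
      unfolding partial_christoffel[OF assms(1)] by (auto simp: p_def algebra_simps)
    then have "(\<Sum>i\<in>UNIV. partial j (christoffel (cigar c) i i k) x)
        = real CARD('n) * (- \<delta> j k * p + 2 * x $ j * x $ k * p\<^sup>2)"
      by (simp only: sum_constant)
    then show ?thesis unfolding d by (simp add: algebra_simps)
  qed
  have A3: "(\<Sum>i\<in>UNIV. \<Sum>m\<in>UNIV. christoffel (cigar c) i i m x * christoffel (cigar c) m j k x)
      = (c + 2) * (2 * x $ j * x $ k - \<delta> j k * (x \<bullet> x)) * p\<^sup>2"
  proof -
    have "christoffel (cigar c) i i m x * christoffel (cigar c) m j k x =
        (\<delta> m k * (x $ m * x $ j) + \<delta> m j * (x $ m * x $ k) - \<delta> j k * (x $ m * x $ m)) * p\<^sup>2" for i m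
      unfolding cigar_christoffel[OF assms(1)] by (auto simp: p_def power2_eq_square algebra_simps)
    then have "(\<Sum>i\<in>UNIV. \<Sum>m\<in>UNIV. christoffel (cigar c) i i m x * christoffel (cigar c) m j k x)
        = real CARD('n) * ((x $ k * x $ j + x $ j * x $ k - \<delta> j k * (x \<bullet> x)) * p\<^sup>2)"
      by (simp only: sum_constant sum.distrib sum_subtractf sum_distrib_simps sum_delta_left sum_square_nth)
    then show ?thesis unfolding d by (simp add: algebra_simps)
  qed
  have A4: "(\<Sum>i\<in>UNIV. \<Sum>m\<in>UNIV. christoffel (cigar c) i j m x * christoffel (cigar c) m i k x)
      = ((c + 4) * x $ j * x $ k - 2 * \<delta> j k * (x \<bullet> x)) * p\<^sup>2"
  proof -
    have "(\<Sum>i\<in>UNIV. \<Sum>m\<in>UNIV. christoffel (cigar c) i j m x * christoffel (cigar c) m i k x)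
       = (\<Sum>i\<in>UNIV. \<Sum>m\<in>UNIV. (\<delta> m i * (x $ j * T m i k) + \<delta> j i * (x $ m * T m i k) - \<delta> m j * (x $ i * T m i k)) * p\<^sup>2)"
      unfolding cigar_christoffel[OF assms(1)]
      by (intro sum.cong refl) (auto simp: T_def p_def power2_eq_square algebra_simps)
    also have "\<dots> = ((\<Sum>i\<in>UNIV. x $ j * T i i k) + (\<Sum>m\<in>UNIV. x $ m * T m j k) - (\<Sum>i\<in>UNIV. x $ i * T j i k)) * p\<^sup>2"
    proof -
      have "(\<Sum>i\<in>UNIV. \<Sum>m\<in>UNIV. \<delta> j i * (x $ m * T m i k)) = (\<Sum>m\<in>UNIV. x $ m * T m j k)"
        by (subst sum.swap) (simp only: sum_delta_left)
      then show ?thesis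
        by (simp only: sum.distrib sum_subtractf sum_distrib_simps(2) sum_delta_left)
    qed
    also have "(\<Sum>i\<in>UNIV. x $ j * T i i k) = (c + 2) * x $ j * x $ k"
    proof -
      have "x $ j * T i i k = x $ j * x $ k" for i by (auto simp: T_def)
      then have "(\<Sum>i\<in>UNIV. x $ j * T i i k) = real CARD('n) * (x $ j * x $ k)"
        by (simp only: sum_constant)
      then show ?thesis unfolding d by simp
    qed
    also have "(\<Sum>m\<in>UNIV. x $ m * T m j k) = 2 * x $ j * x $ k - \<delta> j k * (x \<bullet> x)"
    proof -
      have "x $ m * T m j k = \<delta> m k * (x $ m * x $ j) + \<delta> m j * (x $ m * x $ k) - \<delta> j k * (x $ m * x $ m)" for m
        by (auto simp: T_def algebra_simps)
      then show ?thesis by (simp add: sum.distrib sum_subtractf sum_distrib_simps sum_delta_left sum_square_nth)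
    qed
    also have "(\<Sum>i\<in>UNIV. x $ i * T j i k) = \<delta> j k * (x \<bullet> x)"
    proof -
      have "x $ i * T j i k = \<delta> j k * (x $ i * x $ i) + \<delta> i j * (x $ i * x $ k) - \<delta> i k * (x $ i * x $ j)" for i
        by (auto simp: T_def algebra_simps)
      then show ?thesis by (simp add: sum.distrib sum_subtractf sum_distrib_simps sum_delta_left sum_square_nth)
    qed
    finally show ?thesis by (simp add: algebra_simps)
  qed
  have "ricci (cigar c) x $ j $ k = (\<Sum>i\<in>UNIV. partial i (christoffel (cigar c) i j k) x)
     - (\<Sum>i\<in>UNIV. partial j (christoffel (cigar c) i i k) x)
     + ((\<Sum>i\<in>UNIV. \<Sum>m\<in>UNIV. christoffel (cigar c) i i m x * christoffel (cigar c) m j k x)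
      - (\<Sum>i\<in>UNIV. \<Sum>m\<in>UNIV. christoffel (cigar c) i j m x * christoffel (cigar c) m i k x))"
    by (simp add: ricci_def riemann_def sum.distrib sum_subtractf)
  also have "\<dots> = (2 * (c + 1) * p - (c + 2) * ((x \<bullet> x) * p\<^sup>2)) * \<delta> j k - c * p\<^sup>2 * (x $ j * x $ k)"
    unfolding A1 A2 A3 A4 by (simp add: algebra_simps)
  also have "(x \<bullet> x) * p\<^sup>2 = p - p\<^sup>2"
    using q_nonzero[of x] by (simp add: p_def field_simps power2_eq_square) (simp add: q_def algebra_simps)
  also have "2 * (c + 1) * p - (c + 2) * (p - p\<^sup>2) = c / q x + (c + 2) / (q x)\<^sup>2"
    by (simp add: p_def divide_inverse power_inverse algebra_simps)
  also have "c * p\<^sup>2 = c / (q x)\<^sup>2" by (simp add: p_def divide_inverse power_inverse)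
  finally show ?thesis .
qed

lemma cigar_potential_GDERIV:
  "GDERIV (cigar_potential c) x :> ((c * lq x - (c + 2)) * inverse (q x)) *\<^sub>R x"
proof -
  have "((\<lambda>t. c / 2 * t\<^sup>2 - (c + 2) * t) has_real_derivative c * lq x - (c + 2)) (at (lq x))"
    by (auto intro!: derivative_eq_intros)
  from GDERIV_DERIV_compose[OF lq_GDERIV this] show ?thesis
    by (simp add: cigar_potential_def[abs_def])
qed

text \<open>The second derivatives and the Christoffel symbols contribute opposite multiples of the radial
  derivative of the potential to the coefficient of \<open>x\<^sub>i x\<^sub>j\<close>; only the second derivative of
  \<open>c lq\<^sup>2 / 2\<close> as a function of \<open>lq\<close> survives there.\<close>

lemma cigar_hessian:
  assumes "c > 0"
  shows "hessian (cigar c) (cigar_potential c) x $ i $ j =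
    (c * lq x - (c + 2)) / (q x)\<^sup>2 * \<delta> i j + c / (q x)\<^sup>2 * (x $ i * x $ j)"
proof -
  define p where "p = inverse (q x)"
  define a where "a = c * lq x - (c + 2)"
  have W1: "partial j (cigar_potential c) = (\<lambda>x. (c * lq x - (c + 2)) * inverse (q x) * x $ j)" for j
    by (rule ext, subst partial_eq_GDERIV[OF cigar_potential_GDERIV]) simp
  have "GDERIV (\<lambda>x. (c * lq x - (c + 2)) * inverse (q x) * x $ j) x :>
     ((c * lq x - (c + 2)) * inverse (q x)) *\<^sub>R axis j 1
     + x $ j *\<^sub>R ((c * lq x - (c + 2)) *\<^sub>R ((- 2 * inverse (q x) * inverse (q x)) *\<^sub>R x)
        + inverse (q x) *\<^sub>R ((c *\<^sub>R (inverse (q x) *\<^sub>R x) + lq x *\<^sub>R 0) - 0))"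
    by (intro GDERIV_mult GDERIV_diff GDERIV_const GDERIV_coord lq_GDERIV inverse_q_GDERIV)
  note W2 = partial_eq_GDERIV[OF this, of i]
  have pW: "partial i (partial j (cigar_potential c)) x = a * p * \<delta> i j + (c - 2 * a) * p\<^sup>2 * (x $ i * x $ j)"
    unfolding W1 W2 by (simp add: axis_def a_def p_def power2_eq_square algebra_simps)
  have "(\<Sum>k\<in>UNIV. christoffel (cigar c) k i j x * partial k (cigar_potential c) x)
     = (\<Sum>k\<in>UNIV. - (\<delta> k j * (x $ i * x $ k) + \<delta> k i * (x $ j * x $ k) - \<delta> i j * (x $ k * x $ k)) * (a * p\<^sup>2))"
    unfolding cigar_christoffel[OF assms] W1
    by (intro sum.cong refl) (auto simp: a_def p_def power2_eq_square algebra_simps)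
  also have "\<dots> = - (2 * x $ i * x $ j - \<delta> i j * (x \<bullet> x)) * (a * p\<^sup>2)"
    by (simp only: sum.distrib sum_subtractf sum_negf sum_distrib_simps sum_delta_left sum_square_nth) (simp add: algebra_simps)
  finally have "hessian (cigar c) (cigar_potential c) x $ i $ j =
      (a * (p - (x \<bullet> x) * p\<^sup>2)) * \<delta> i j + c * p\<^sup>2 * (x $ i * x $ j)"
    unfolding hessian_def using pW by (simp add: algebra_simps)
  also have "p - (x \<bullet> x) * p\<^sup>2 = p\<^sup>2"
    using q_nonzero[of x] by (simp add: p_def field_simps power2_eq_square) (simp add: q_def algebra_simps)
  finally show ?thesis by (simp add: a_def p_def divide_inverse power_inverse)
qed

lemma quad_form_rank_one:
  fixes A :: "real^'n^'n"
  assumes "\<And>i j. A $ i $ j = a * \<delta> i j + b * (x $ i * x $ j)"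
  shows "quad_form A v = a * (v \<bullet> v) + b * (x \<bullet> v)\<^sup>2"
proof -
  have "A *v v = a *\<^sub>R v + (b * (x \<bullet> v)) *\<^sub>R x"
  proof (unfold vec_eq_iff, intro allI)
    fix i
    have "(A *v v) $ i = (\<Sum>j\<in>UNIV. \<delta> i j * (a * v $ j) + (b * x $ i) * (x $ j * v $ j))"
      by (auto simp: matrix_vector_mult_def assms algebra_simps intro!: sum.cong)
    also have "\<dots> = a * v $ i + (b * x $ i) * (x \<bullet> v)"
      by (simp only: sum.distrib sum_distrib_simps sum_delta_left) (simp add: inner_vec_def)
    finally show "(A *v v) $ i = (a *\<^sub>R v + (b * (x \<bullet> v)) *\<^sub>R x) $ i" by simp
  qed
  then show ?thesis by (simp add: quad_form_def inner_add_right inner_commute power2_eq_square)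
qed

text \<open>The rank-one part is dominated by the scalar part because \<open>(x \<bullet> v)\<^sup>2 \<le> |x|\<^sup>2 |v|\<^sup>2 \<le> q(x) |v|\<^sup>2\<close>.\<close>

lemma cigar_ricci_nonneg:
  assumes "c > 0" "c = real CARD('n) - 2"
  shows "ricci_nonneg (cigar c :: 'n::finite tensor2)"
  unfolding ricci_nonneg_def
proof (intro allI)
  fix x v :: "real^'n"
  have "quad_form (ricci (cigar c) x) v = (c / q x + (c + 2) / (q x)\<^sup>2) * (v \<bullet> v) + (- (c / (q x)\<^sup>2)) * (x \<bullet> v)\<^sup>2"
    by (rule quad_form_rank_one) (simp add: cigar_ricci[OF assms])
  moreover have "(x \<bullet> v)\<^sup>2 \<le> q x * (v \<bullet> v)"
    using Cauchy_Schwarz_ineq[of x v] by (simp add: q_def algebra_simps inner_ge_zero add_increasing)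
  then have "c / (q x)\<^sup>2 * (x \<bullet> v)\<^sup>2 \<le> c / (q x)\<^sup>2 * (q x * (v \<bullet> v))"
    using assms(1) by (intro mult_left_mono) auto
  moreover have "c / (q x)\<^sup>2 * (q x * (v \<bullet> v)) = c / q x * (v \<bullet> v)"
    using q_nonzero[of x] by (simp add: power2_eq_square)
  moreover have "0 \<le> (c + 2) / (q x)\<^sup>2 * (v \<bullet> v)" using assms(1) by simp
  ultimately show "0 \<le> quad_form (ricci (cigar c) x) v" by (simp add: algebra_simps)
qed

text \<open>The rank-one parts of Ricci tensor and Hessian cancel, and so do the multiples \<open>(c + 2) / q\<^sup>2\<close> of
  the identity; the latter is what the logarithmic term of the potential is for. What is left exceeds the metric by \<open>c lq / q\<^sup>2\<close>.\<close>

lemma cigar_CD: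
  assumes "c > 0" "c = real CARD('n) - 2"
  shows "CD_infinity 1 (cigar c :: 'n::finite tensor2) (cigar_potential c)"
  unfolding CD_infinity_def
proof (intro allI)
  fix x v :: "real^'n"
  have "quad_form (ricci (cigar c) x + hessian (cigar c) (cigar_potential c) x) v
      = (c / q x + c * lq x / (q x)\<^sup>2) * (v \<bullet> v) + 0 * (x \<bullet> v)\<^sup>2"
    by (rule quad_form_rank_one) (simp add: cigar_ricci[OF assms] cigar_hessian[OF assms(1)] add_divide_distrib diff_divide_distrib algebra_simps)
  moreover have "quad_form (cigar c x) v = c / q x * (v \<bullet> v)"
    by (simp add: cigar_def quad_form_scaleR_mat)
  moreover have "0 \<le> c * lq x / (q x)\<^sup>2 * (v \<bullet> v)"
    using assms(1) lq_nonneg[of x] by simp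
  ultimately show "1 * quad_form (cigar c x) v \<le> quad_form (ricci (cigar c) x + hessian (cigar c) (cigar_potential c) x) v"
    by (simp add: algebra_simps)
qed

section \<open>Lengths of paths and the Riemannian distance\<close>

lemma quad_form_scaleR: "quad_form A (r *\<^sub>R v) = r\<^sup>2 * quad_form A v"
  by (simp add: quad_form_def matrix_vector_mult_scaleR power2_eq_square)

lemma valid_pathE:
  assumes "valid_path \<gamma>"
  obtains S where "finite S"
    "\<And>t. t \<in> {0..1} - S \<Longrightarrow> (\<gamma> has_vector_derivative vector_derivative \<gamma> (at t)) (at t)"
  using assms unfolding valid_path_def piecewise_C1_differentiable_on_def C1_differentiable_on_eq
  by (auto simp: vector_derivative_works)

lemma path_has_length_reversepath:
  assumes "valid_path \<gamma>" "path_has_length g \<gamma> L"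
  shows "path_has_length g (reversepath \<gamma>) L"
proof -
  obtain S where S: "finite S"
    "\<And>t. t \<in> {0..1} - S \<Longrightarrow> (\<gamma> has_vector_derivative vector_derivative \<gamma> (at t)) (at t)"
    using assms(1) by (rule valid_pathE) blast
  let ?s = "\<lambda>t. sqrt (quad_form (g (\<gamma> t)) (vector_derivative \<gamma> (at t)))"
  have "(?s has_integral L) (cbox 0 1)" using assms(2) by (simp add: path_has_length_def)
  from has_integral_affinity[OF this, of "-1" 1]
  have "((\<lambda>t. ?s (1 - t)) has_integral L) {0..1}"
    by (simp add: image_affinity_atLeastAtMost)
  then show ?thesis unfolding path_has_length_def
  proof (rule has_integral_spike_finite[where S="(\<lambda>t. 1 - t) ` S", rotated 2])
    show "finite ((\<lambda>t. 1 - t) ` S)" using S(1) by simp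
    fix t assume t: "t \<in> {0..1} - (\<lambda>t. 1 - t) ` S"
    then have "1 - t \<in> {0..1} - S" by force
    then have D: "(\<gamma> has_vector_derivative vector_derivative \<gamma> (at (1 - t))) (at (1 - t))" by (rule S(2))
    have "((\<lambda>t. 1 - t) has_vector_derivative - 1) (at t)"
      by (auto intro!: derivative_eq_intros)
    from vector_diff_chain_at[OF this D]
    have "vector_derivative (reversepath \<gamma>) (at t) = - 1 *\<^sub>R vector_derivative \<gamma> (at (1 - t))"
      unfolding reversepath_def o_def by (rule vector_derivative_at)
    then show "sqrt (quad_form (g (reversepath \<gamma> t)) (vector_derivative (reversepath \<gamma>) (at t))) = ?s (1 - t)"
      by (simp only: quad_form_scaleR) (simp add: reversepath_def)
  qed
qed

lemma path_has_length_join: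
  assumes v1: "valid_path \<gamma>1" and v2: "valid_path \<gamma>2"
    and L1: "path_has_length g \<gamma>1 L1" and L2: "path_has_length g \<gamma>2 L2"
  shows "path_has_length g (\<gamma>1 +++ \<gamma>2) (L1 + L2)"
proof -
  let ?s = "\<lambda>\<gamma> t. sqrt (quad_form (g (\<gamma> t)) (vector_derivative \<gamma> (at t)))"
  obtain S1 where S1: "finite S1"
    "\<And>t. t \<in> {0..1} - S1 \<Longrightarrow> (\<gamma>1 has_vector_derivative vector_derivative \<gamma>1 (at t)) (at t)"
    using v1 by (rule valid_pathE) blast
  obtain S2 where S2: "finite S2"
    "\<And>t. t \<in> {0..1} - S2 \<Longrightarrow> (\<gamma>2 has_vector_derivative vector_derivative \<gamma>2 (at t)) (at t)"
    using v2 by (rule valid_pathE) blast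
  have i1: "(?s \<gamma>1 has_integral L1) (cbox 0 1)" and i2: "(?s \<gamma>2 has_integral L2) (cbox 0 1)"
    using L1 L2 by (simp_all add: path_has_length_def)
  have j1: "((\<lambda>t. 2 * ?s \<gamma>1 (2 * t)) has_integral L1) {0..1/2}"
    using has_integral_mult_right[OF has_integral_affinity[OF i1, of 2 0], of 2]
    by (simp add: image_affinity_atLeastAtMost)
  have j2: "((\<lambda>t. 2 * ?s \<gamma>2 (2 * t - 1)) has_integral L2) {1/2..1}"
    using has_integral_mult_right[OF has_integral_affinity[OF i2, of 2 "-1"], of 2]
    by (simp add: image_affinity_atLeastAtMost[of "1/2" "1/2" 0 1, simplified])
  have k1: "(?s (\<gamma>1 +++ \<gamma>2) has_integral L1) {0..1/2}"
  proof (rule has_integral_spike_finite[OF _ _ j1, where S="insert (1/2) ((\<lambda>t. t / 2) ` S1)"])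
    show "finite (insert (1/2) ((\<lambda>t. t / 2) ` S1))" using S1(1) by simp
    fix t :: real assume t: "t \<in> {0..1/2} - insert (1/2) ((\<lambda>t. t / 2) ` S1)"
    then have "2 * t \<in> {0..1} - S1" using image_eqI[of t "\<lambda>t. t / 2" "2 * t" S1] by auto
    then have D: "(\<gamma>1 has_vector_derivative vector_derivative \<gamma>1 (at (2 * t))) (at (2 * t))" by (rule S1(2))
    have "((\<lambda>t. 2 * t) has_vector_derivative 2) (at t)"
      by (auto intro!: derivative_eq_intros simp: has_real_derivative_iff_has_vector_derivative[symmetric])
    from vector_diff_chain_at[OF this D]
    have "((\<lambda>t. \<gamma>1 (2 * t)) has_vector_derivative 2 *\<^sub>R vector_derivative \<gamma>1 (at (2 * t))) (at t)"
      by (simp add: o_def)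
    then have "((\<gamma>1 +++ \<gamma>2) has_vector_derivative 2 *\<^sub>R vector_derivative \<gamma>1 (at (2 * t))) (at t)"
      by (rule has_vector_derivative_transform_within_open[where S="{..<1/2}"])
         (use t in \<open>auto simp: joinpaths_def\<close>)
    then have "vector_derivative (\<gamma>1 +++ \<gamma>2) (at t) = 2 *\<^sub>R vector_derivative \<gamma>1 (at (2 * t))"
      by (rule vector_derivative_at)
    then show "?s (\<gamma>1 +++ \<gamma>2) t = 2 * ?s \<gamma>1 (2 * t)"
      using t by (simp add: quad_form_scaleR real_sqrt_mult) (simp add: joinpaths_def)
  qed
  have k2: "(?s (\<gamma>1 +++ \<gamma>2) has_integral L2) {1/2..1}"
  proof (rule has_integral_spike_finite[OF _ _ j2, where S="insert (1/2) ((\<lambda>t. (t + 1) / 2) ` S2)"])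
    show "finite (insert (1/2) ((\<lambda>t. (t + 1) / 2) ` S2))" using S2(1) by simp
    fix t :: real assume t: "t \<in> {1/2..1} - insert (1/2) ((\<lambda>t. (t + 1) / 2) ` S2)"
    then have "2 * t - 1 \<in> {0..1} - S2" using image_eqI[of t "\<lambda>t. (t + 1) / 2" "2 * t - 1" S2] by auto
    then have D: "(\<gamma>2 has_vector_derivative vector_derivative \<gamma>2 (at (2 * t - 1))) (at (2 * t - 1))" by (rule S2(2))
    have "((\<lambda>t. 2 * t - 1) has_vector_derivative 2) (at t)"
      by (auto intro!: derivative_eq_intros simp: has_real_derivative_iff_has_vector_derivative[symmetric])
    from vector_diff_chain_at[OF this D]
    have "((\<lambda>t. \<gamma>2 (2 * t - 1)) has_vector_derivative 2 *\<^sub>R vector_derivative \<gamma>2 (at (2 * t - 1))) (at t)"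
      by (simp add: o_def)
    then have "((\<gamma>1 +++ \<gamma>2) has_vector_derivative 2 *\<^sub>R vector_derivative \<gamma>2 (at (2 * t - 1))) (at t)"
      by (rule has_vector_derivative_transform_within_open[where S="{1/2<..}"])
         (use t in \<open>auto simp: joinpaths_def\<close>)
    then have "vector_derivative (\<gamma>1 +++ \<gamma>2) (at t) = 2 *\<^sub>R vector_derivative \<gamma>2 (at (2 * t - 1))"
      by (rule vector_derivative_at)
    then show "?s (\<gamma>1 +++ \<gamma>2) t = 2 * ?s \<gamma>2 (2 * t - 1)"
      using t by (simp add: quad_form_scaleR real_sqrt_mult) (auto simp: joinpaths_def)
  qed
  show ?thesis unfolding path_has_length_def
    using has_integral_combine[OF _ _ k1 k2] by simp
qed

definition path_lengths :: "'n::finite tensor2 \<Rightarrow> real^'n \<Rightarrow> real^'n \<Rightarrow> real set" where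
  "path_lengths g x y = {L. \<exists>\<gamma>. valid_path \<gamma> \<and> pathstart \<gamma> = x \<and> pathfinish \<gamma> = y \<and> path_has_length g \<gamma> L}"

text \<open>Together with the next lemma this yields symmetry and the triangle inequality of the distance.\<close>

lemma path_lengths_commute: "path_lengths g x y = path_lengths g y x"
proof -
  have "path_lengths g x y \<subseteq> path_lengths g y x" for x y
  proof
    fix L assume "L \<in> path_lengths g x y"
    then obtain \<gamma> where "valid_path \<gamma>" "pathstart \<gamma> = x" "pathfinish \<gamma> = y" "path_has_length g \<gamma> L"
      by (auto simp: path_lengths_def)
    then show "L \<in> path_lengths g y x"
      unfolding path_lengths_def using path_has_length_reversepath[of \<gamma> g L]
      by (auto intro!: exI[of _ "reversepath \<gamma>"])
  qed
  then show ?thesis by blast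
qed

lemma path_lengths_add:
  assumes "L1 \<in> path_lengths g x y" "L2 \<in> path_lengths g y z"
  shows "L1 + L2 \<in> path_lengths g x z"
proof -
  obtain \<gamma>1 \<gamma>2 where *: "valid_path \<gamma>1" "pathstart \<gamma>1 = x" "pathfinish \<gamma>1 = y" "path_has_length g \<gamma>1 L1"
     "valid_path \<gamma>2" "pathstart \<gamma>2 = y" "pathfinish \<gamma>2 = z" "path_has_length g \<gamma>2 L2"
    using assms unfolding path_lengths_def by blast
  have "valid_path (\<gamma>1 +++ \<gamma>2)" using * by (intro valid_path_join) auto
  then show ?thesis unfolding path_lengths_def
    using * path_has_length_join[OF *(1,5,4,8)] by (auto intro!: exI[of _ "\<gamma>1 +++ \<gamma>2"])
qed

section \<open>The cigar is complete\<close>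

lemma cigar_speed:
  assumes "c > 0"
  shows "sqrt (quad_form (cigar c x) v) = sqrt c * (norm v / sqrt (q x))"
  using assms q_pos[of x]
  by (simp add: cigar_def quad_form_scaleR_mat real_sqrt_mult real_sqrt_divide norm_eq_sqrt_inner)

lemma cigar_path_lengths_nonneg:
  fixes x y :: "real^'n"
  assumes "c > 0" "L \<in> path_lengths (cigar c) x y" shows "0 \<le> L"
proof -
  obtain \<gamma> :: "real \<Rightarrow> real^'n" where "path_has_length (cigar c) \<gamma> L" using assms(2) unfolding path_lengths_def by blast
  then show ?thesis unfolding path_has_length_def cigar_speed[OF assms(1)]
    by (rule has_integral_nonneg)
       (use assms(1) in \<open>intro mult_nonneg_nonneg divide_nonneg_nonneg; simp add: less_imp_le[OF q_pos]\<close>)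
qed

lemma cigar_line_length:
  assumes "c > 0"
  obtains L where "L \<in> path_lengths (cigar c) x y" "L \<le> sqrt c * norm (y - x)"
proof -
  let ?s = "\<lambda>t. sqrt c * (norm (y - x) / sqrt (q (linepath x y t)))"
  have cont: "continuous_on {0..1} ?s"
    unfolding q_def linepath_def
    by (intro continuous_intros) (use q_nonzero in \<open>auto simp: q_def\<close>)
  then obtain L where L: "(?s has_integral L) {0..1}"
    using integrable_continuous_real[OF cont] by blast
  show ?thesis
  proof
    have "path_has_length (cigar c) (linepath x y) L"
      unfolding path_has_length_def cigar_speed[OF assms] using L by simp
    then show "L \<in> path_lengths (cigar c) x y"
      unfolding path_lengths_def by (auto intro!: exI[of _ "linepath x y"])
    have "((\<lambda>t::real. sqrt c * norm (y - x)) has_integral (sqrt c * norm (y - x))) {0..1}"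
      using has_integral_const_real[of "sqrt c * norm (y - x)" 0 1] by simp
    from L this show "L \<le> sqrt c * norm (y - x)"
    proof (rule has_integral_le)
      fix t :: real
      have "norm (y - x) / sqrt (q (linepath x y t)) \<le> norm (y - x) / 1"
        by (intro divide_left_mono) (use q_ge_1[of "linepath x y t"] in auto)
      then show "?s t \<le> sqrt c * norm (y - x)" using assms mult_left_mono[of _ _ "sqrt c"] by fastforce
    qed
  qed
qed

text \<open>Integrate the derivative of \<open>ln (q(x) + |\<gamma> - x|\<^sup>2)\<close> along the path \<open>\<gamma>\<close>. This function has bounded
  gradient for the cigar metric, and unlike \<open>|\<gamma> - x|\<close> itself it is smooth.\<close>

lemma cigar_path_lengths_lower_bound:
  assumes c: "c > 0" and L: "L \<in> path_lengths (cigar c) x y"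
  shows "sqrt c / 4 * ln (1 + (norm (y - x))\<^sup>2 / q x) \<le> L"
proof -
  obtain \<gamma> where \<gamma>: "valid_path \<gamma>" "\<gamma> 0 = x" "\<gamma> 1 = y" and len: "path_has_length (cigar c) \<gamma> L"
    using L by (auto simp: path_lengths_def pathstart_def pathfinish_def)
  obtain S where S: "finite S"
    "\<And>t. t \<in> {0..1} - S \<Longrightarrow> (\<gamma> has_vector_derivative vector_derivative \<gamma> (at t)) (at t)"
    using \<gamma>(1) by (rule valid_pathE) blast
  define P where "P z = q x + (z - x) \<bullet> (z - x)" for z
  have Ppos: "P z > 0" for z using q_pos[of x] by (simp add: P_def add_pos_nonneg)
  define s where "s t = sqrt c * (norm (vector_derivative \<gamma> (at t)) / sqrt (q (\<gamma> t)))" for t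
  define dP where "dP t = 2 * (vector_derivative \<gamma> (at t) \<bullet> (\<gamma> t - x)) / P (\<gamma> t)" for t
  have int_s: "(s has_integral L) {0..1}"
    using len unfolding path_has_length_def cigar_speed[OF c] s_def .
  have "(dP has_integral (ln (P (\<gamma> 1)) - ln (P (\<gamma> 0)))) {0..1}"
  proof (rule fundamental_theorem_of_calculus_interior_strong[OF S(1)])
    show "continuous_on {0..1} (\<lambda>t. ln (P (\<gamma> t)))"
      unfolding P_def by (intro continuous_intros valid_path_imp_path[OF \<gamma>(1), unfolded path_def]) (use Ppos in \<open>auto simp: P_def less_imp_neq[symmetric]\<close>)
    fix t assume t: "t \<in> {0<..<1} - S"
    then have "(\<gamma> has_derivative (\<lambda>h. h *\<^sub>R vector_derivative \<gamma> (at t))) (at t)"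
      using S(2)[of t] by (simp add: has_vector_derivative_def)
    then have "((\<lambda>t. P (\<gamma> t)) has_derivative (\<lambda>h. (h *\<^sub>R vector_derivative \<gamma> (at t)) \<bullet> (\<gamma> t - x)
        + (\<gamma> t - x) \<bullet> (h *\<^sub>R vector_derivative \<gamma> (at t)))) (at t)"
      unfolding P_def by (auto intro!: derivative_eq_intros simp: inner_commute)
    then have "((\<lambda>t. P (\<gamma> t)) has_real_derivative 2 * (vector_derivative \<gamma> (at t) \<bullet> (\<gamma> t - x))) (at t)"
      unfolding has_field_derivative_def by (rule has_derivative_eq_rhs) (auto simp: inner_commute)
    from DERIV_chain2[OF DERIV_ln[OF Ppos] this]
    show "((\<lambda>t. ln (P (\<gamma> t))) has_vector_derivative dP t) (at t)"
      by (simp add: has_real_derivative_iff_has_vector_derivative[symmetric] dP_def divide_inverse mult_ac)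
  qed simp
  moreover have "((\<lambda>t. 4 / sqrt c * s t) has_integral (4 / sqrt c * L)) {0..1}"
    by (rule has_integral_mult_right[OF int_s])
  ultimately have "ln (P (\<gamma> 1)) - ln (P (\<gamma> 0)) \<le> 4 / sqrt c * L"
  proof (rule has_integral_le)
    fix t :: real
    let ?v = "vector_derivative \<gamma> (at t)" and ?z = "\<gamma> t - x"
    \<comment> \<open>Equivalent to \<open>0 \<le> 1 + |\<gamma> - 2 x|\<^sup>2\<close>. Together with \<open>|\<gamma> - x|\<^sup>2 \<le> P\<close> it bounds \<open>|\<gamma> - x| \<surd>q\<close> by \<open>2 P\<close>.\<close>
    have "q (\<gamma> t) \<le> 2 * P (\<gamma> t)"
    proof -
      have "0 \<le> (\<gamma> t - 2 *\<^sub>R x) \<bullet> (\<gamma> t - 2 *\<^sub>R x)" by (rule inner_ge_zero)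
      also have "\<dots> = \<gamma> t \<bullet> \<gamma> t - 4 * (x \<bullet> \<gamma> t) + 4 * (x \<bullet> x)"
        by (simp add: inner_diff_left inner_diff_right inner_commute)
      finally show ?thesis
        by (simp add: q_def P_def inner_diff_left inner_diff_right inner_commute)
    qed
    moreover have "?z \<bullet> ?z \<le> P (\<gamma> t)" using q_pos[of x] by (simp add: P_def)
    ultimately have "(?z \<bullet> ?z) * q (\<gamma> t) \<le> P (\<gamma> t) * (2 * P (\<gamma> t))"
      by (intro mult_mono) (auto simp: less_imp_le[OF Ppos] less_imp_le[OF q_pos])
    also have "\<dots> \<le> (2 * P (\<gamma> t))\<^sup>2" by (simp add: power2_eq_square)
    finally have "(norm ?z * sqrt (q (\<gamma> t)))\<^sup>2 \<le> (2 * P (\<gamma> t))\<^sup>2"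
      using q_pos[of "\<gamma> t"] by (simp add: power_mult_distrib power2_norm_eq_inner)
    then have *: "norm ?z * sqrt (q (\<gamma> t)) \<le> 2 * P (\<gamma> t)"
      by (rule power2_le_imp_le) (simp add: less_imp_le[OF Ppos])
    have "?v \<bullet> ?z \<le> norm ?v * norm ?z" by (rule norm_cauchy_schwarz)
    also have "\<dots> = norm ?v * (norm ?z * sqrt (q (\<gamma> t))) / sqrt (q (\<gamma> t))"
      using q_pos[of "\<gamma> t"] by simp
    also have "\<dots> \<le> norm ?v * (2 * P (\<gamma> t)) / sqrt (q (\<gamma> t))"
      using * q_pos[of "\<gamma> t"] by (intro divide_right_mono mult_left_mono) auto
    finally have "dP t \<le> 2 * (norm ?v * (2 * P (\<gamma> t)) / sqrt (q (\<gamma> t))) / P (\<gamma> t)"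
      unfolding dP_def using Ppos[of "\<gamma> t"] by (intro divide_right_mono) auto
    also have "\<dots> = 4 / sqrt c * s t"
      using Ppos[of "\<gamma> t"] c by (simp add: s_def)
    finally show "dP t \<le> 4 / sqrt c * s t" .
  qed
  moreover have "ln (P (\<gamma> 1)) - ln (P (\<gamma> 0)) = ln (1 + (norm (y - x))\<^sup>2 / q x)"
  proof -
    have "ln (P y) - ln (P x) = ln (P y / P x)" using ln_div[of "P y" "P x"] Ppos[of x] Ppos[of y] by simp
    also have "P y / P x = 1 + (norm (y - x))\<^sup>2 / q x"
      using q_nonzero[of x] by (simp add: P_def power2_norm_eq_inner add_divide_distrib)
    finally show ?thesis using \<gamma> by simp
  qed
  ultimately show ?thesis using c by (simp add: field_simps)
qed

lemma cigar_dist_properties: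
  assumes c: "c > 0"
  shows cigar_dist_le: "riem_dist (cigar c) x y \<le> sqrt c * norm (y - x)"
    and cigar_dist_ge: "sqrt c / 4 * ln (1 + (norm (y - x))\<^sup>2 / q x) \<le> riem_dist (cigar c) x y"
    and cigar_dist_commute: "riem_dist (cigar c) x y = riem_dist (cigar c) y x"
    and cigar_dist_triangle: "riem_dist (cigar c) x z \<le> riem_dist (cigar c) x y + riem_dist (cigar c) y z"
proof -
  have d: "riem_dist (cigar c) x y = Inf (path_lengths (cigar c) x y)" for x y :: "real^'a"
    by (simp add: riem_dist_def path_lengths_def)
  have ne: "path_lengths (cigar c) x y \<noteq> {}" for x y :: "real^'a"
    using cigar_line_length[OF c, of x y] by blast
  have bd: "bdd_below (path_lengths (cigar c) x y)" for x y :: "real^'a"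
    using cigar_path_lengths_nonneg[OF c] by (intro bdd_belowI[of _ 0]) blast
  show "riem_dist (cigar c) x y \<le> sqrt c * norm (y - x)"
  proof -
    obtain L where L: "L \<in> path_lengths (cigar c) x y" "L \<le> sqrt c * norm (y - x)"
      by (rule cigar_line_length[OF c])
    then show ?thesis unfolding d using cInf_lower[OF L(1) bd] by linarith
  qed
  show "sqrt c / 4 * ln (1 + (norm (y - x))\<^sup>2 / q x) \<le> riem_dist (cigar c) x y"
    unfolding d by (intro cInf_greatest ne cigar_path_lengths_lower_bound c)
  show "riem_dist (cigar c) x y = riem_dist (cigar c) y x"
    unfolding d by (subst path_lengths_commute) simp
  have "Inf (path_lengths (cigar c) x z) - L1 \<le> Inf (path_lengths (cigar c) y z)"
    if "L1 \<in> path_lengths (cigar c) x y" for L1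
  proof (rule cInf_greatest[OF ne])
    fix L2 assume "L2 \<in> path_lengths (cigar c) y z"
    from cInf_lower[OF path_lengths_add[OF that this] bd]
    show "Inf (path_lengths (cigar c) x z) - L1 \<le> L2" by simp
  qed
  then have "Inf (path_lengths (cigar c) x z) - Inf (path_lengths (cigar c) y z) \<le> Inf (path_lengths (cigar c) x y)"
    by (intro cInf_greatest[OF ne]) force
  then show "riem_dist (cigar c) x z \<le> riem_dist (cigar c) x y + riem_dist (cigar c) y z"
    unfolding d by simp
qed

text \<open>A Cauchy sequence of the cigar distance is bounded by the logarithmic lower bound. On bounded sets
  that bound controls the Euclidean distance, so the sequence converges in \<open>\<real>\<^sup>d\<close>. The upper bound by
  a multiple of the Euclidean distance transfers the convergence back.\<close>

lemma cigar_complete: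
  assumes c: "c > 0"
  shows "complete_metric (cigar c :: 'n::finite tensor2)"
proof -
  let ?d = "riem_dist (cigar c :: 'n tensor2)"
  note le = cigar_dist_le[OF c] and ge = cigar_dist_ge[OF c]
  have close: "(norm (y - x))\<^sup>2 / q x < r" if "?d x y < sqrt c / 4 * ln (1 + r)" "r > 0" for x y r
  proof -
    have "sqrt c / 4 * ln (1 + (norm (y - x))\<^sup>2 / q x) < sqrt c / 4 * ln (1 + r)"
      using ge[of y x] that(1) by linarith
    then have "ln (1 + (norm (y - x))\<^sup>2 / q x) < ln (1 + r)"
      using c by (simp add: mult_less_cancel_left_pos)
    moreover have "0 \<le> (norm (y - x))\<^sup>2 / q x" using q_pos[of x] by simp
    ultimately show ?thesis using that(2) by (simp add: ln_less_cancel_iff add_pos_nonneg)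
  qed
  interpret Metric_space UNIV ?d
  proof
    show nn: "0 \<le> ?d x y" for x y
    proof -
      have "0 \<le> sqrt c / 4 * ln (1 + (norm (y - x))\<^sup>2 / q x)"
        using c q_pos[of x] by (intro mult_nonneg_nonneg ln_ge_zero) auto
      then show ?thesis using ge[of y x] by linarith
    qed
    show "?d x y = ?d y x" for x y by (rule cigar_dist_commute[OF c])
    show "?d x z \<le> ?d x y + ?d y z" for x y z by (rule cigar_dist_triangle[OF c])
    show "?d x y = 0 \<longleftrightarrow> x = y" for x y
    proof
      assume 0: "?d x y = 0"
      show "x = y"
      proof (rule ccontr)
        assume "x \<noteq> y"
        then have "0 < (norm (y - x))\<^sup>2 / q x" using q_pos[of x] by simp
        then have "0 < sqrt c / 4 * ln (1 + (norm (y - x))\<^sup>2 / q x)" using c by simp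
        then show False using ge[of y x] 0 by linarith
      qed
    qed (use le[of x x] nn[of x x] in simp)
  qed
  show ?thesis unfolding complete_metric_def mcomplete_def
  proof (intro allI impI)
    fix \<sigma> :: "nat \<Rightarrow> real^'n" assume "MCauchy \<sigma>"
    then have cau: "\<exists>N. \<forall>n n'. N \<le> n \<longrightarrow> N \<le> n' \<longrightarrow> ?d (\<sigma> n) (\<sigma> n') < e" if "e > 0" for e
      using that by (auto simp: MCauchy_def)
    have "sqrt c / 4 * ln (1 + 1) > 0" using c by simp
    \<comment> \<open>The radius is chosen so that \<open>close\<close> gives \<open>|\<sigma>\<^sub>n - \<sigma>\<^sub>N|\<^sup>2 < q(\<sigma>\<^sub>N)\<close> for the tail.\<close>
    from cau[OF this] obtain N where N: "\<And>n. N \<le> n \<Longrightarrow> ?d (\<sigma> N) (\<sigma> n) < sqrt c / 4 * ln (1 + 1)" by blast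
    define B where "B = 4 * q (\<sigma> N)"
    have Bpos: "B > 0" using q_pos by (simp add: B_def)
    have qB: "q (\<sigma> n) \<le> B" if "N \<le> n" for n
    proof -
      let ?z = "\<sigma> n - \<sigma> N"
      have "(norm ?z)\<^sup>2 \<le> q (\<sigma> N)"
        using close[OF N[OF that]] q_pos[of "\<sigma> N"] by (simp add: divide_less_eq)
      then have "?z \<bullet> ?z \<le> q (\<sigma> N)" by (simp add: power2_norm_eq_inner)
      moreover have "\<sigma> n \<bullet> \<sigma> n = ?z \<bullet> ?z + 2 * (?z \<bullet> \<sigma> N) + \<sigma> N \<bullet> \<sigma> N"
        by (simp add: inner_diff_left inner_diff_right inner_commute)
      moreover have "0 \<le> u \<bullet> u - 2 * (u \<bullet> w) + w \<bullet> w" for u w :: "real^'n"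
        using inner_ge_zero[of "u - w"] by (simp add: inner_diff_left inner_diff_right inner_commute)
      note this[of ?z "\<sigma> N"]
      moreover have "1 + n \<le> 4 * (1 + s)"
        if "z \<le> 1 + s" "n = z + 2 * b + s" "0 \<le> z - 2 * b + s" for z b s n :: real
        using that by argo
      ultimately show ?thesis unfolding B_def q_def by blast
    qed
    have "Cauchy \<sigma>"
    proof (rule metric_CauchyI)
      fix e :: real assume e: "e > 0"
      have "sqrt c / 4 * ln (1 + e\<^sup>2 / B) > 0" using c e Bpos by (intro mult_pos_pos ln_gt_zero) simp_all
      from cau[OF this] obtain N' where
        N': "\<And>n n'. N' \<le> n \<Longrightarrow> N' \<le> n' \<Longrightarrow> ?d (\<sigma> n) (\<sigma> n') < sqrt c / 4 * ln (1 + e\<^sup>2 / B)" by blast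
      have "dist (\<sigma> m) (\<sigma> n) < e" if "max N N' \<le> m" "max N N' \<le> n" for m n
      proof -
        have "(norm (\<sigma> n - \<sigma> m))\<^sup>2 / q (\<sigma> m) < e\<^sup>2 / B"
          using close[OF N'[of m n]] that e Bpos by simp
        then have "(norm (\<sigma> n - \<sigma> m))\<^sup>2 < e\<^sup>2 / B * q (\<sigma> m)"
          by (rule pos_divide_less_eq[OF q_pos, THEN iffD1])
        also have "\<dots> \<le> e\<^sup>2 / B * B"
          using qB[of m] that Bpos by (intro mult_left_mono) auto
        finally have "(norm (\<sigma> n - \<sigma> m))\<^sup>2 < e\<^sup>2" using Bpos by simp
        then show ?thesis using e by (simp add: dist_norm norm_minus_commute power2_less_imp_less)
      qed
      then show "\<exists>M. \<forall>m\<ge>M. \<forall>n\<ge>M. dist (\<sigma> m) (\<sigma> n) < e" by blast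
    qed
    then obtain l where l: "\<sigma> \<longlonglongrightarrow> l" using Cauchy_convergent convergent_def by blast
    have "limitin mtopology \<sigma> l sequentially"
      unfolding limit_metric_sequentially
    proof (intro conjI allI impI)
      fix e :: real assume e: "e > 0"
      then have "e / sqrt c > 0" using c by simp
      from metric_LIMSEQ_D[OF l this] obtain N where N: "\<And>n. n \<ge> N \<Longrightarrow> dist (\<sigma> n) l < e / sqrt c" by blast
      have "?d (\<sigma> n) l < e" if "n \<ge> N" for n
      proof -
        have "?d (\<sigma> n) l \<le> sqrt c * dist (\<sigma> n) l" using le[of "\<sigma> n" l] by (simp add: dist_norm norm_minus_commute)
        also have "\<dots> < e" using N[OF that] c by (simp add: pos_less_divide_eq mult.commute)
        finally show ?thesis .
      qed
      then show "\<exists>N. \<forall>n\<ge>N. \<sigma> n \<in> UNIV \<and> ?d (\<sigma> n) l < e" by blast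
    qed simp
    then show "\<exists>x. limitin mtopology \<sigma> x sequentially" by blast
  qed
qed

section \<open>Integrability of the weights\<close>

lemma nn_integral_cauchy_density_finite: "(\<integral>\<^sup>+t. ennreal (1 / (1 + t\<^sup>2)) \<partial>lborel) < \<infinity>"
proof -
  let ?f = "\<lambda>t::real. ennreal (1 / (1 + t\<^sup>2))"
  have half: "(\<integral>\<^sup>+t. ?f t * indicator {0..} t \<partial>lborel) = ennreal (pi / 2 - arctan 0)"
  proof (rule nn_integral_FTC_atLeast)
    show "DERIV arctan t :> 1 / (1 + t\<^sup>2)" for t :: real
      using DERIV_arctan[of t] by (simp add: inverse_eq_divide)
  qed (auto simp: tendsto_arctan_at_top)
  have neg: "(\<integral>\<^sup>+t. ?f t * indicator {..<0} t \<partial>lborel) \<le> (\<integral>\<^sup>+t. ?f t * indicator {0..} t \<partial>lborel)"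
  proof -
    have "(\<integral>\<^sup>+t. ?f t * indicator {..<0} t \<partial>lborel) = (\<integral>\<^sup>+t. ?f (0 + (-1) * t) * indicator {..<0} (0 + (-1) * t) \<partial>lborel)"
      by (subst nn_integral_real_affine[where c="-1" and t=0]) auto
    also have "\<dots> \<le> (\<integral>\<^sup>+t. ?f t * indicator {0..} t \<partial>lborel)"
      by (intro nn_integral_mono) (auto simp: indicator_def)
    finally show ?thesis .
  qed
  have "(\<integral>\<^sup>+t. ?f t \<partial>lborel) = (\<integral>\<^sup>+t. ?f t * indicator {0..} t + ?f t * indicator {..<0} t \<partial>lborel)"
    by (intro nn_integral_cong) (auto simp: indicator_def)
  also have "\<dots> = (\<integral>\<^sup>+t. ?f t * indicator {0..} t \<partial>lborel) + (\<integral>\<^sup>+t. ?f t * indicator {..<0} t \<partial>lborel)"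
    by (intro nn_integral_add) auto
  also have "\<dots> < \<infinity>"
    using neg unfolding half by (simp add: ennreal_add_eq_top less_top order.strict_trans1)
  finally show ?thesis .
qed

text \<open>Since \<open>q \<ge> 1 + x\<^sub>i\<^sup>2\<close> for each of the \<open>d\<close> coordinates, \<open>q\<^sup>-\<^sup>d\<close> is dominated by a product of
  one-dimensional Cauchy densities.\<close>

lemma integrable_inverse_q_power: "integrable lborel (\<lambda>x::real^'n. inverse (q x) ^ CARD('n))"
proof (rule integrableI_nonneg)
  have cq: "continuous_on UNIV (q :: real^'n \<Rightarrow> real)"
    unfolding q_def by (intro continuous_intros)
  show "(\<lambda>x::real^'n. inverse (q x) ^ CARD('n)) \<in> borel_measurable lborel"
    using cq q_nonzero by (auto intro!: borel_measurable_continuous_onI continuous_intros)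
  show "AE x::real^'n in lborel. 0 \<le> inverse (q x) ^ CARD('n)"
    by (simp add: less_imp_le[OF q_pos])
  have "(\<integral>\<^sup>+x. ennreal (inverse (q (x :: real^'n)) ^ CARD('n)) \<partial>lborel)
      \<le> (\<integral>\<^sup>+x. (\<Prod>b\<in>Basis. ennreal (1 / (1 + ((x :: real^'n) \<bullet> b)\<^sup>2))) \<partial>lborel)"
  proof (rule nn_integral_mono)
    fix x :: "real^'n"
    have "inverse (q x) \<le> 1 / (1 + (x \<bullet> b)\<^sup>2)" if "b \<in> Basis" for b
    proof -
      have "(x \<bullet> b)\<^sup>2 \<le> x \<bullet> x"
        using Cauchy_Schwarz_ineq[of x b] inner_Basis[OF that that] by simp
      then show ?thesis by (simp add: q_def inverse_eq_divide frac_le add_pos_nonneg)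
    qed
    then have "(\<Prod>b\<in>(Basis::(real^'n) set). inverse (q x)) \<le> (\<Prod>b\<in>Basis. 1 / (1 + (x \<bullet> b)\<^sup>2))"
      by (intro prod_mono) (auto simp: less_imp_le[OF q_pos])
    then have "ennreal (inverse (q x) ^ CARD('n)) \<le> ennreal (\<Prod>b\<in>Basis. 1 / (1 + (x \<bullet> b)\<^sup>2))"
      by (intro ennreal_leI) simp
    then show "ennreal (inverse (q x) ^ CARD('n)) \<le> (\<Prod>b\<in>Basis. ennreal (1 / (1 + (x \<bullet> b)\<^sup>2)))"
      by (simp add: prod_ennreal)
  qed
  also have "\<dots> = (\<Prod>b\<in>(Basis::(real^'n) set). (\<integral>\<^sup>+t. ennreal (1 / (1 + t\<^sup>2)) \<partial>lborel))"
    by (rule nn_integral_lborel_prod) auto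
  also have "\<dots> < \<infinity>"
    using nn_integral_cauchy_density_finite by (simp add: power_less_top_ennreal)
  finally show "(\<integral>\<^sup>+x. ennreal (inverse (q (x :: real^'n)) ^ CARD('n)) \<partial>lborel) < \<infinity>" .
qed

text \<open>Boundedness of \<open>q\<^sup>k exp (- U)\<close> for all \<open>k\<close> suffices: borrow \<open>d\<close> further powers of \<open>q\<close> to get an
  integrable majorant.\<close>

lemma integrable_moments:
  fixes U :: "real^'n \<Rightarrow> real"
  assumes U: "continuous_on UNIV U" and bd: "\<And>k. \<exists>C. \<forall>x. q x ^ k * exp (- U x) \<le> C"
  shows "integrable lborel (\<lambda>x. (1 + x \<bullet> x) ^ k * exp (- U x))"
proof -
  obtain C where C: "\<And>x. q x ^ (k + CARD('n)) * exp (- U x) \<le> C" using bd by blast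
  have "integrable lborel (\<lambda>x::real^'n. C * inverse (q x) ^ CARD('n))"
    by (intro integrable_mult_right integrable_inverse_q_power)
  then show ?thesis
  proof (rule Bochner_Integration.integrable_bound)
    show "(\<lambda>x. (1 + x \<bullet> x) ^ k * exp (- U x)) \<in> borel_measurable lborel"
      using U by (auto intro!: borel_measurable_continuous_onI continuous_intros)
    have "q x ^ k * exp (- U x) \<le> C * inverse (q x) ^ CARD('n)" for x
    proof -
      have "q x ^ k * exp (- U x) = (q x ^ (k + CARD('n)) * exp (- U x)) * inverse (q x) ^ CARD('n)"
        using q_nonzero[of x] by (simp add: power_add power_inverse)
      also have "\<dots> \<le> C * inverse (q x) ^ CARD('n)"
        using C q_pos[of x] by (intro mult_right_mono) auto
      finally show ?thesis .
    qed
    then show "AE x in lborel. norm ((1 + x \<bullet> x) ^ k * exp (- U x)) \<le> norm (C * inverse (q x) ^ CARD('n))"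
      by (intro always_eventually allI) (smt (verit) q_def real_norm_def abs_of_nonneg exp_ge_zero inner_ge_zero mult_nonneg_nonneg zero_le_power)
  qed
qed

lemma continuous_q: "continuous_on S q"
  unfolding q_def by (intro continuous_intros)

lemma continuous_lq: "continuous_on S lq"
  unfolding lq_def by (intro continuous_intros continuous_q) (auto simp: q_nonzero)

lemma tempered_q: "tempered q"
  unfolding q_def[abs_def] by (intro tempered_intros)

lemma tempered_bounded: "continuous_on UNIV F \<Longrightarrow> (\<And>x. \<bar>F x\<bar> \<le> C) \<Longrightarrow> tempered F"
  by (rule temperedI[where k=0]) auto

lemma tempered_inverse_q: "tempered (\<lambda>x. inverse (q x))"
proof (rule tempered_bounded[where C=1])
  show "continuous_on UNIV (\<lambda>x::real^'a. inverse (q x))"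
    by (intro continuous_intros continuous_q) (simp add: q_nonzero)
  show "\<bar>inverse (q x)\<bar> \<le> 1" for x :: "real^'a"
    using q_ge_1[of x] by (simp add: inverse_le_1_iff)
qed

lemma exp_lq: "exp (2 * lq x) = q x"
  using q_pos[of x] by (simp add: lq_def)

lemma tempered_lq: "tempered lq"
proof (rule temperedI[where C=1 and k=1])
  fix x :: "real^'a"
  have "lq x \<le> q x" using exp_ge_add_one_self[of "2 * lq x"] lq_nonneg[of x] unfolding exp_lq by linarith
  then show "\<bar>lq x\<bar> \<le> 1 * (1 + x \<bullet> x) ^ 1" using lq_nonneg[of x] by (simp add: q_def)
qed (rule continuous_lq)

lemma tempered_exp_lq: "tempered (\<lambda>x. exp (- lq x))"
  by (rule tempered_bounded[where C=1]) (auto intro!: continuous_intros continuous_lq simp: lq_nonneg)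

definition cigar_exponent :: "real \<Rightarrow> real^'n \<Rightarrow> real" where
  "cigar_exponent c x = c / 2 * (lq x)\<^sup>2"

text \<open>With \<open>q = exp (2 lq)\<close>, the products \<open>q\<^sup>k exp (- c lq\<^sup>2 / 2)\<close> are exponentials of quadratic
  polynomials in \<open>lq\<close> with negative leading coefficient.\<close>

lemma cigar_weight:
  assumes c: "c > 0" and "K > 0"
  shows "rapid_weight (cigar_exponent c) (\<lambda>x::real^'n. (c * lq x * inverse (q x)) *\<^sub>R x) K"
proof
  have eq: "cigar_exponent c = (\<lambda>x::real^'n. c / 2 * (lq x)\<^sup>2)" by (rule ext) (rule cigar_exponent_def)
  show "GDERIV (cigar_exponent c) x :> (c * lq x * inverse (q x)) *\<^sub>R x" for x :: "real^'n"
  proof -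
    have "((\<lambda>t. c / 2 * t\<^sup>2) has_real_derivative c * lq x) (at (lq x))"
      by (auto intro!: derivative_eq_intros)
    from GDERIV_DERIV_compose[OF lq_GDERIV this] show ?thesis by (simp add: eq)
  qed
  show "tempered (\<lambda>x. ((c * lq x * inverse (q x)) *\<^sub>R x) $ i)" for i :: 'n
    unfolding vector_scaleR_component real_scaleR_def
    by (intro tempered_mult tempered_const tempered_lq tempered_inverse_q tempered_coord)
  show "integrable lborel (\<lambda>x::real^'n. (1 + x \<bullet> x) ^ k * exp (- cigar_exponent c x))" for k
    unfolding cigar_exponent_def
  proof (rule integrable_moments)
    show "continuous_on UNIV (\<lambda>x::real^'n. c / 2 * (lq x)\<^sup>2)"
      by (intro continuous_intros continuous_lq)
    fix k
    have "q x ^ k * exp (- (c / 2 * (lq x)\<^sup>2)) \<le> exp (2 * real k ^ 2 / c)" for x :: "real^'n"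
    proof -
      have "0 \<le> c / 2 * (lq x - 2 * real k / c)\<^sup>2" using c by simp
      also have "\<dots> = c / 2 * (lq x)\<^sup>2 - real k * (2 * lq x) + 2 * real k ^ 2 / c"
        using c by (simp add: field_simps power2_eq_square)
      finally have "real k * (2 * lq x) - c / 2 * (lq x)\<^sup>2 \<le> 2 * real k ^ 2 / c" by linarith
      moreover have "q x ^ k * exp (- (c / 2 * (lq x)\<^sup>2)) = exp (real k * (2 * lq x) - c / 2 * (lq x)\<^sup>2)"
        unfolding exp_lq[symmetric] exp_of_nat_mult[symmetric] by (simp add: exp_add[symmetric])
      ultimately show ?thesis by simp
    qed
    then show "\<exists>C. \<forall>x::real^'n. q x ^ k * exp (- (c / 2 * (lq x)\<^sup>2)) \<le> C" by blast
  qed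
qed (use assms in simp)

context rapid_weight begin

lemma divergence_theorem:
  assumes X: "\<And>i. tempered (\<lambda>x. X x $ i)" and D: "\<And>i x. GDERIV (\<lambda>x. X x $ i) x :> D i x"
    and tD: "\<And>i. tempered (\<lambda>x. D i x $ i)"
  shows "G (\<lambda>x. \<Sum>i\<in>UNIV. D i x $ i) = G (\<lambda>x. X x \<bullet> V x)"
proof -
  have "G (\<lambda>x. \<Sum>i\<in>UNIV. D i x $ i) = (\<Sum>i\<in>UNIV. G (\<lambda>x. X x $ i * V x $ i))"
    using integration_by_parts[OF X D tD] by (simp add: G_sum tD)
  also have "\<dots> = G (\<lambda>x. \<Sum>i\<in>UNIV. X x $ i * V x $ i)"
    by (intro G_sum[symmetric] tempered_mult X V)
  finally show ?thesis by (simp add: inner_vec_def)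
qed

text \<open>Both sides are quadratic forms in \<open>a\<close>, so it is enough to compare them on the unit sphere, which is
  compact. This turns a strict inequality for each \<open>a\<close> into a uniform one.\<close>

lemma quadratic_forms_comparable:
  assumes F: "tempered F" and H: "tempered H"
    and pos: "\<And>a. a \<noteq> 0 \<Longrightarrow> G (\<lambda>x. (a \<bullet> x)\<^sup>2 * F x) > 0"
  obtains \<epsilon> where "\<epsilon> > 0" "\<And>a. \<epsilon> * G (\<lambda>x. (a \<bullet> x)\<^sup>2 * H x) \<le> G (\<lambda>x. (a \<bullet> x)\<^sup>2 * F x)"
proof -
  define Q where "Q F a = G (\<lambda>x. (a \<bullet> x)\<^sup>2 * F x)" for F :: "real^'n \<Rightarrow> real" and a
  have expand: "Q F a = (\<Sum>i\<in>UNIV. \<Sum>j\<in>UNIV. a $ i * a $ j * G (\<lambda>x. x $ i * x $ j * F x))" if "tempered F" for F a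
  proof -
    have "(a \<bullet> x)\<^sup>2 * F x = (\<Sum>i\<in>UNIV. \<Sum>j\<in>UNIV. (a $ i * a $ j) * (x $ i * x $ j * F x))" for x
    proof -
      have "(a \<bullet> x)\<^sup>2 * F x = (\<Sum>i\<in>UNIV. \<Sum>j\<in>UNIV. (a $ i * x $ i) * (a $ j * x $ j)) * F x"
        by (simp add: power2_eq_square inner_vec_def sum_product)
      then show ?thesis by (simp only: sum_distrib_right) (simp add: mult_ac)
    qed
    then have "Q F a = G (\<lambda>x. \<Sum>i\<in>UNIV. \<Sum>j\<in>UNIV. (a $ i * a $ j) * (x $ i * x $ j * F x))"
      unfolding Q_def by simp
    also have "\<dots> = (\<Sum>i\<in>UNIV. \<Sum>j\<in>UNIV. G (\<lambda>x. (a $ i * a $ j) * (x $ i * x $ j * F x)))"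
      using that by (simp add: G_sum tempered_sum tempered_mult tempered_const tempered_coord)
    finally show ?thesis by (simp only: G_cmult)
  qed
  have cont: "continuous_on S (Q F)" if "tempered F" for F S
    unfolding expand[OF that, abs_def] by (intro continuous_intros continuous_on_nth)
  have hom: "Q F (r *\<^sub>R a) = r\<^sup>2 * Q F a" for F r a
    unfolding Q_def G_cmult[symmetric] by (simp add: power_mult_distrib mult.assoc)
  let ?S = "sphere (0::real^'n) 1"
  have ne: "?S \<noteq> {}" using vector_choose_size[of 1] by (auto simp: sphere_def)
  obtain a0 where a0: "a0 \<in> ?S" "\<And>a. a \<in> ?S \<Longrightarrow> Q F a0 \<le> Q F a"
    using continuous_attains_inf[OF compact_sphere ne cont[OF F]] by blast
  obtain a1 where a1: "a1 \<in> ?S" "\<And>a. a \<in> ?S \<Longrightarrow> Q H a \<le> Q H a1"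
    using continuous_attains_sup[OF compact_sphere ne cont[OF H]] by blast
  define B where "B = \<bar>Q H a1\<bar> + 1"
  have B: "B > 0" by (simp add: B_def)
  have d: "Q F a0 > 0" using pos[of a0] a0(1) unfolding Q_def by fastforce
  define \<epsilon> where "\<epsilon> = Q F a0 / B"
  have "\<epsilon> * Q H a \<le> Q F a" for a
  proof (cases "a = 0")
    case True
    then show ?thesis by (simp add: Q_def G_def)
  next
    case False
    define u where "u = inverse (norm a) *\<^sub>R a"
    have u: "u \<in> ?S" "a = norm a *\<^sub>R u" using False by (auto simp: u_def)
    have "\<epsilon> * Q H u \<le> \<epsilon> * B"
      using a1(2)[OF u(1)] d B by (intro mult_left_mono) (auto simp: B_def \<epsilon>_def)
    also have "\<dots> = Q F a0" using B by (simp add: \<epsilon>_def)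
    also have "\<dots> \<le> Q F u" by (rule a0(2)[OF u(1)])
    finally have "(norm a)\<^sup>2 * (\<epsilon> * Q H u) \<le> (norm a)\<^sup>2 * Q F u" by (rule mult_left_mono) simp
    then show ?thesis by (subst (1 2) u(2)) (simp add: hom mult_ac)
  qed
  moreover have "\<epsilon> > 0" using d B by (simp add: \<epsilon>_def)
  ultimately show ?thesis using that unfolding Q_def by blast
qed

end

lemma q_even [simp]: "q (- x) = q x" by (simp add: q_def)
lemma lq_even [simp]: "lq (- x) = lq x" by (simp add: lq_def)

section \<open>The spectrum of the cigar\<close>

lemma det_scaleR_mat: "det (a *\<^sub>R mat 1 :: real^'n^'n) = a ^ CARD('n)"
  by (subst det_diagonal) (auto simp: mat_def)

lemma exp_minus_lq: "(exp (- lq x))\<^sup>2 = inverse (q x)"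
  unfolding exp_lq[symmetric] by (simp add: exp_minus exp_double power_inverse)

text \<open>The logarithmic part of the potential cancels the Riemannian volume density up to a constant factor.\<close>

lemma cigar_weighted_measure:
  assumes c: "c > 0" "c = real CARD('n) - 2"
  shows "weighted_measure (cigar c) (cigar_potential c)
    = rapid_weight.M (cigar_exponent c :: real^'n \<Rightarrow> real) (sqrt c ^ CARD('n))"
proof -
  interpret rapid_weight "cigar_exponent c" "\<lambda>x::real^'n. (c * lq x * inverse (q x)) *\<^sub>R x" "sqrt c ^ CARD('n)"
    by (rule cigar_weight) (use c in auto)
  have "exp (- cigar_potential c x) * sqrt (det (cigar c x)) = rho x" for x :: "real^'n"
  proof -
    have "sqrt (q x) = exp (lq x)"
      unfolding exp_lq[symmetric] by (simp add: exp_double)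
    then have "sqrt (det (cigar c x)) = sqrt c ^ CARD('n) * inverse (exp (lq x)) ^ CARD('n)"
      by (simp add: cigar_def det_scaleR_mat real_sqrt_power real_sqrt_mult real_sqrt_inverse divide_inverse power_mult_distrib)
    also have "inverse (exp (lq x)) ^ CARD('n) = exp (- (c + 2) * lq x)"
      using c(2) by (simp add: exp_minus[symmetric] exp_of_nat_mult[symmetric])
    finally have "exp (- cigar_potential c x) * sqrt (det (cigar c x))
      = sqrt c ^ CARD('n) * (exp (- cigar_potential c x) * exp (- (c + 2) * lq x))"
      by simp
    also have "exp (- cigar_potential c x) * exp (- (c + 2) * lq x) = exp (- cigar_exponent c x)"
      unfolding exp_add[symmetric] by (rule arg_cong[where f=exp]) (simp add: cigar_potential_def cigar_exponent_def algebra_simps)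
    finally show ?thesis by (simp add: rho_def)
  qed
  then show ?thesis by (simp add: weighted_measure_def M_def)
qed

text \<open>The derivative is \<open>1 + (1 - 2 t) exp (- 2 t)\<close>, which is nonnegative since \<open>exp (2 t) \<ge> 2 t - 1\<close>.\<close>

lemma mono_plus_exp_decay: 
  fixes x y :: real
  assumes "x \<le> y" shows "x + x * exp (- (2 * x)) \<le> y + y * exp (- (2 * y))"
proof (rule DERIV_nonneg_imp_nondecreasing[OF assms])
  fix t :: real
  have "((\<lambda>t. t + t * exp (- (2 * t))) has_real_derivative 1 + (1 - 2 * t) * exp (- (2 * t))) (at t)"
    by (auto intro!: derivative_eq_intros simp: algebra_simps)
  moreover have "0 \<le> 1 + (1 - 2 * t) * exp (- (2 * t))"
  proof -
    have "2 * t - 1 \<le> exp (2 * t)" using exp_ge_add_one_self[of "2 * t"] by linarith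
    then have "(2 * t - 1) * exp (- (2 * t)) \<le> exp (2 * t) * exp (- (2 * t))" by (rule mult_right_mono) simp
    then show ?thesis by (simp add: exp_minus_inverse algebra_simps)
  qed
  ultimately show "\<exists>y. ((\<lambda>t. t + t * exp (- (2 * t))) has_real_derivative y) (at t) \<and> 0 \<le> y" by blast
qed

locale cigar_space =
  fixes c :: real and dummy :: "'n::finite itself"
  assumes c_eq: "c = real CARD('n) - 2" and c_ge_2: "c \<ge> 2"
begin

lemma c_pos: "c > 0"
  using c_ge_2 by simp

abbreviation p :: "real^'n \<Rightarrow> real" where "p x \<equiv> inverse (q x)"

abbreviation drift :: "real^'n \<Rightarrow> real^'n" where "drift x \<equiv> (c * lq x * p x) *\<^sub>R x"

sublocale rapid_weight "cigar_exponent c" drift "sqrt c ^ CARD('n)"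
  by (rule cigar_weight) (use c_pos in auto)

lemmas tempered_cigar = tempered_intros tempered_q tempered_inverse_q tempered_lq tempered_exp_lq

lemma inner_self_div_q: "(x \<bullet> x) * p x = 1 - p x"
  using q_nonzero[of x] by (simp add: field_simps) (simp add: q_def)

subsection \<open>The radial function\<close>

text \<open>The radial trial function is \<open>lq\<close>, centred so that it is orthogonal to the constants.\<close>

definition mean_lq :: real where "mean_lq = G lq / G (\<lambda>_. 1)"

definition radial :: "real^'n \<Rightarrow> real" where "radial x = lq x - mean_lq"

lemma tempered_radial: "tempered radial"
  unfolding radial_def[abs_def] by (intro tempered_cigar)

lemma G_radial: "G radial = 0"
proof -
  have "G radial = G lq - G (\<lambda>x. mean_lq * 1)"
    unfolding radial_def[abs_def] by (subst G_diff) (auto intro!: tempered_cigar)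
  also have "\<dots> = 0" unfolding G_cmult using G_one_pos by (simp add: mean_lq_def)
  finally show ?thesis .
qed

lemma mean_lq_pos: "mean_lq > 0"
proof -
  have "G lq > 0"
    by (rule G_pos[OF tempered_lq lq_nonneg, of "axis undefined 1"]) (simp add: lq_def q_def inner_axis_axis)
  then show ?thesis using G_one_pos by (simp add: mean_lq_def)
qed

lemma radial_GDERIV: "GDERIV radial x :> p x *\<^sub>R x"
  using GDERIV_diff[OF lq_GDERIV GDERIV_const[of mean_lq]] by (simp add: radial_def[abs_def])

lemma radial_norm_pos: "G (\<lambda>x. (radial x)\<^sup>2) > 0"
  by (rule G_pos[OF tempered_power[OF tempered_radial], where ?x0.0=0])
     (use mean_lq_pos in \<open>auto simp: radial_def lq_def q_def\<close>)

text \<open>The divergence theorem for the vector field \<open>radial(x) x\<close>. The term \<open>d radial\<close> of its divergence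
  integrates to zero by the choice of the mean.\<close>

lemma radial_energy:
  "G (\<lambda>x. q x / c * ((p x *\<^sub>R x) \<bullet> (p x *\<^sub>R x))) = G (\<lambda>x. radial x * (lq x * (1 - p x)))"
proof -
  have div: "(\<Sum>i\<in>UNIV. (x $ i *\<^sub>R (p x *\<^sub>R x) + radial x *\<^sub>R axis i 1) $ i) = 1 - p x + (c + 2) * radial x" for x :: "real^'n"
  proof -
    have "(\<Sum>i\<in>UNIV. (x $ i *\<^sub>R (p x *\<^sub>R x) + radial x *\<^sub>R axis i 1) $ i) = (\<Sum>i\<in>UNIV. p x * (x $ i * x $ i) + radial x)"
      by (intro sum.cong) (auto simp: axis_def)
    also have "\<dots> = p x * (x \<bullet> x) + real CARD('n) * radial x"
      by (simp add: sum.distrib sum_distrib_simps sum_square_nth)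
    finally show ?thesis using inner_self_div_q[of x] c_eq by (simp add: mult.commute)
  qed
  have "G (\<lambda>x. \<Sum>i\<in>UNIV. (x $ i *\<^sub>R (p x *\<^sub>R x) + radial x *\<^sub>R axis i 1) $ i) = G (\<lambda>x. (radial x *\<^sub>R x) \<bullet> drift x)"
  proof (rule divergence_theorem)
    fix i x
    have "GDERIV (\<lambda>x. x $ i * radial x) x :> x $ i *\<^sub>R (p x *\<^sub>R x) + radial x *\<^sub>R axis i 1"
      by (intro GDERIV_mult GDERIV_coord radial_GDERIV)
    then show "GDERIV (\<lambda>x. (radial x *\<^sub>R x) $ i) x :> x $ i *\<^sub>R (p x *\<^sub>R x) + radial x *\<^sub>R axis i 1"
      by (simp add: mult.commute)
  qed (simp_all, (intro tempered_cigar tempered_radial)+)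
  then have "G (\<lambda>x. 1 - p x + (c + 2) * radial x) = G (\<lambda>x. c * (radial x * (lq x * (1 - p x))))"
    unfolding div inner_self_div_q[symmetric] by (simp add: mult_ac)
  moreover have "G (\<lambda>x. 1 - p x + (c + 2) * radial x) = G (\<lambda>x. 1 - p x) + (c + 2) * G radial"
    by (subst G_add) (auto intro!: tempered_cigar tempered_radial simp: G_cmult)
  ultimately have "G (\<lambda>x. 1 - p x) = c * G (\<lambda>x. radial x * (lq x * (1 - p x)))"
    using G_radial by (simp add: G_cmult)
  moreover have "q x / c * ((p x *\<^sub>R x) \<bullet> (p x *\<^sub>R x)) = (1 / c) * (1 - p x)" for x :: "real^'n"
    unfolding inner_self_div_q[symmetric] using q_nonzero[of x] by simp
  ultimately show ?thesis using c_pos by (simp only: G_cmult) simp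
qed

text \<open>Twice the squared norm minus the energy is the integral of \<open>radial (k(lq) - k(mean_lq))\<close> with the increasing
  function \<open>k(y) = y + y exp (- 2 y)\<close>, whence the integrand is nonnegative. It is positive at the
  origin, where \<open>lq\<close> is below its mean.\<close>

lemma radial_gap:
  "G (\<lambda>x. q x / c * ((p x *\<^sub>R x) \<bullet> (p x *\<^sub>R x))) < 2 * G (\<lambda>x. (radial x)\<^sup>2)"
proof -
  define k where "k y = y + y * exp (- (2 * y))" for y :: real
  have kl: "k (lq x) = lq x + lq x * p x" for x :: "real^'n"
    by (simp add: k_def exp_minus exp_lq)
  have "0 < G (\<lambda>x. radial x * (k (lq x) - k mean_lq))"
  proof (rule G_pos[of _ 0])
    show "tempered (\<lambda>x. radial x * (k (lq x) - k mean_lq))" unfolding kl by (intro tempered_cigar tempered_radial)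
    show "0 \<le> radial x * (k (lq x) - k mean_lq)" for x
      using mono_plus_exp_decay[of "lq x" mean_lq] mono_plus_exp_decay[of mean_lq "lq x"]
      by (cases "lq x \<le> mean_lq") (auto simp: radial_def k_def mult_nonneg_nonneg mult_nonpos_nonpos)
    have "k mean_lq > 0" using mean_lq_pos by (simp add: k_def add_pos_pos)
    moreover have "radial 0 = - mean_lq" "k (lq (0 :: real^'n)) = 0" by (simp_all add: radial_def k_def lq_def q_def)
    ultimately show "0 < radial 0 * (k (lq (0 :: real^'n)) - k mean_lq)" using mean_lq_pos by simp
  qed
  also have "G (\<lambda>x. radial x * (k (lq x) - k mean_lq)) = G (\<lambda>x. 2 * (radial x)\<^sup>2 - radial x * (lq x * (1 - p x)) + (2 * mean_lq - k mean_lq) * radial x)"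
    by (rule arg_cong[where f=G]) (auto simp: kl radial_def fun_eq_iff power2_eq_square algebra_simps)
  also have "\<dots> = 2 * G (\<lambda>x. (radial x)\<^sup>2) - G (\<lambda>x. radial x * (lq x * (1 - p x))) + (2 * mean_lq - k mean_lq) * G radial"
    by (subst G_add, (intro tempered_cigar tempered_radial)+, subst G_diff, (intro tempered_cigar tempered_radial)+) (simp add: G_cmult)
  finally show ?thesis using radial_energy G_radial by simp
qed

subsection \<open>The angular functions\<close>

text \<open>The odd trial functions are \<open>(a \<bullet> x) / \<surd>q\<close>, which at infinity become the linear functions
  on the cross-section of the cylindrical end; \<open>angular_square a\<close> is the square of such a function.\<close>

definition angular_factor :: "real^'n \<Rightarrow> real" where "angular_factor x = exp (- lq x)"

definition angular_factor_grad :: "real^'n \<Rightarrow> real^'n" where "angular_factor_grad x = (- angular_factor x * p x) *\<^sub>R x"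

definition angular_square :: "real^'n \<Rightarrow> real^'n \<Rightarrow> real" where "angular_square a x = (a \<bullet> x)\<^sup>2 * p x"

text \<open>The weighted Laplacian multiplies the odd trial functions by a function \<open>\<kappa>\<close>, and this is
  \<open>(2 - \<kappa>) / q\<close>.\<close>

definition gap_density :: "real^'n \<Rightarrow> real" where "gap_density x = ((c - 1) - p x - c * lq x * p x) * p x / c"

abbreviation angular_energy :: "real^'n \<Rightarrow> real" where
  "angular_energy a \<equiv> G (\<lambda>x. q x / c * ((angular_factor x *\<^sub>R a + (a \<bullet> x) *\<^sub>R angular_factor_grad x) \<bullet> (angular_factor x *\<^sub>R a + (a \<bullet> x) *\<^sub>R angular_factor_grad x)))"

lemma angular_factor_square: "angular_factor x * angular_factor x = p x"
  using exp_minus_lq[of x] by (simp add: angular_factor_def power2_eq_square)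

lemma tempered_angular_factor: "tempered angular_factor"
  unfolding angular_factor_def[abs_def] by (rule tempered_exp_lq)

lemma angular_factor_GDERIV: "GDERIV angular_factor x :> angular_factor_grad x"
  using GDERIV_DERIV_compose[OF GDERIV_minus[OF lq_GDERIV] DERIV_exp, of x] by (simp add: angular_factor_def[abs_def] angular_factor_grad_def)

lemma tempered_angular_factor_grad: "tempered (\<lambda>x. angular_factor_grad x $ i)"
  unfolding angular_factor_grad_def by simp (intro tempered_cigar tempered_angular_factor)

lemma tempered_angular_square: "tempered (angular_square a)"
  unfolding angular_square_def[abs_def] by (intro tempered_cigar)

lemma angular_square_eq: "((a \<bullet> x) * angular_factor x)\<^sup>2 = angular_square a x"
  using angular_factor_square[of x] by (simp add: angular_square_def power_mult_distrib power2_eq_square)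

lemma tempered_gap_density: "tempered gap_density"
  unfolding gap_density_def[abs_def] divide_inverse by (intro tempered_cigar)

lemma gap_density_mult: "(a \<bullet> x)\<^sup>2 * gap_density x = (1 / c) * (((c - 1) - p x - c * lq x * p x) * angular_square a x)"
  by (simp add: gap_density_def angular_square_def)

lemma angular_energy_density:
  "q x / c * ((angular_factor x *\<^sub>R a + (a \<bullet> x) *\<^sub>R angular_factor_grad x) \<bullet> (angular_factor x *\<^sub>R a + (a \<bullet> x) *\<^sub>R angular_factor_grad x))
    = (1 / c) * (a \<bullet> a - angular_square a x - angular_square a x * p x)"
proof -
  have "(angular_factor x *\<^sub>R a + (a \<bullet> x) *\<^sub>R angular_factor_grad x) \<bullet> (angular_factor x *\<^sub>R a + (a \<bullet> x) *\<^sub>R angular_factor_grad x)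
     = (angular_factor x * angular_factor x) * (a \<bullet> a - 2 * angular_square a x + angular_square a x * ((x \<bullet> x) * p x))"
    by (simp add: angular_factor_grad_def angular_square_def inner_add_left inner_add_right inner_diff_left inner_diff_right inner_commute power2_eq_square algebra_simps)
  also have "\<dots> = p x * (a \<bullet> a - angular_square a x - angular_square a x * p x)"
    unfolding inner_self_div_q angular_factor_square by (simp add: algebra_simps)
  finally show ?thesis using q_nonzero[of x] by simp
qed

text \<open>The divergence theorem for the field \<open>(a \<bullet> x) a - angular_square(x) x\<close>, which is \<open>q f \<nabla>f\<close> for the odd trial
  function \<open>f\<close>.\<close>

lemma angular_gap: "angular_energy a = 2 * G (angular_square a) - G (\<lambda>x. (a \<bullet> x)\<^sup>2 * gap_density x)"
proof -
  define D where "D i x = (a $ i *\<^sub>R a) - (angular_square a x *\<^sub>R axis i 1 + x $ i *\<^sub>R ((a \<bullet> x)\<^sup>2 *\<^sub>R ((- 2 * p x * p x) *\<^sub>R x) + p x *\<^sub>R (2 * (a \<bullet> x)) *\<^sub>R a))" for i x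
  have Ds: "GDERIV (angular_square a) x :> (a \<bullet> x)\<^sup>2 *\<^sub>R ((- 2 * p x * p x) *\<^sub>R x) + p x *\<^sub>R (2 * (a \<bullet> x)) *\<^sub>R a" for x
  proof -
    have lin: "GDERIV (\<lambda>x. a \<bullet> x) x :> a"
      unfolding gderiv_def by (auto simp: inner_commute intro!: derivative_eq_intros)
    have "((\<lambda>t. t\<^sup>2) has_real_derivative 2 * (a \<bullet> x)) (at (a \<bullet> x))"
      by (auto intro!: derivative_eq_intros)
    from GDERIV_mult[OF GDERIV_DERIV_compose[OF lin this] inverse_q_GDERIV]
    show ?thesis by (simp add: angular_square_def[abs_def])
  qed
  have div: "(\<Sum>i\<in>UNIV. D i x $ i) = a \<bullet> a - (c + 2) * angular_square a x - 2 * angular_square a x * p x" for x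
  proof -
    have "(\<Sum>i\<in>UNIV. D i x $ i) = (\<Sum>i\<in>UNIV. a $ i * a $ i - angular_square a x + 2 * ((a \<bullet> x)\<^sup>2 * p x * p x) * (x $ i * x $ i) - (2 * p x * (a \<bullet> x)) * (a $ i * x $ i))"
      by (intro sum.cong) (auto simp: D_def axis_def algebra_simps)
    also have "\<dots> = a \<bullet> a - real CARD('n) * angular_square a x + 2 * ((a \<bullet> x)\<^sup>2 * p x * p x) * (x \<bullet> x) - (2 * p x * (a \<bullet> x)) * (a \<bullet> x)"
      by (simp only: sum.distrib sum_subtractf sum_distrib_simps sum_square_nth sum_constant) (simp add: inner_vec_def)
    also have "\<dots> = a \<bullet> a - real CARD('n) * angular_square a x + 2 * angular_square a x * ((x \<bullet> x) * p x) - 2 * angular_square a x"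
      by (simp add: angular_square_def power2_eq_square algebra_simps)
    also have "\<dots> = a \<bullet> a - (c + 2) * angular_square a x - 2 * angular_square a x * p x"
      unfolding inner_self_div_q using c_eq by (simp add: algebra_simps)
    finally show ?thesis .
  qed
  have XV: "((a \<bullet> x) *\<^sub>R a - angular_square a x *\<^sub>R x) \<bullet> drift x = c * lq x * p x * angular_square a x" for x
  proof -
    have "((a \<bullet> x) *\<^sub>R a - angular_square a x *\<^sub>R x) \<bullet> drift x = c * lq x * (angular_square a x - angular_square a x * ((x \<bullet> x) * p x))"
      by (simp add: angular_square_def inner_diff_left power2_eq_square algebra_simps)
    then show ?thesis unfolding inner_self_div_q by (simp add: algebra_simps)
  qed
  have "G (\<lambda>x. \<Sum>i\<in>UNIV. D i x $ i) = G (\<lambda>x. ((a \<bullet> x) *\<^sub>R a - angular_square a x *\<^sub>R x) \<bullet> drift x)"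
  proof (rule divergence_theorem)
    fix i x
    show "tempered (\<lambda>x. ((a \<bullet> x) *\<^sub>R a - angular_square a x *\<^sub>R x) $ i)"
      by simp (intro tempered_cigar tempered_angular_square)
    show "tempered (\<lambda>x. D i x $ i)"
      unfolding D_def by simp (intro tempered_cigar tempered_angular_square)
    have lin: "GDERIV (\<lambda>x. a $ i * (a \<bullet> x)) x :> a $ i *\<^sub>R a"
      unfolding gderiv_def by (auto simp: inner_commute mult_ac intro!: derivative_eq_intros)
    have "GDERIV (\<lambda>x. x $ i * angular_square a x) x :> x $ i *\<^sub>R ((a \<bullet> x)\<^sup>2 *\<^sub>R ((- 2 * p x * p x) *\<^sub>R x) + p x *\<^sub>R (2 * (a \<bullet> x)) *\<^sub>R a) + angular_square a x *\<^sub>R axis i 1"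
      by (intro GDERIV_mult GDERIV_coord Ds)
    from GDERIV_diff[OF lin this]
    show "GDERIV (\<lambda>x. ((a \<bullet> x) *\<^sub>R a - angular_square a x *\<^sub>R x) $ i) x :> D i x"
      by (simp add: D_def mult.commute add.commute)
  qed
  then have eq: "G (\<lambda>x. a \<bullet> a - (c + 2) * angular_square a x - 2 * angular_square a x * p x) = G (\<lambda>x. c * lq x * p x * angular_square a x)"
    unfolding div XV .
  have "G (\<lambda>x. a \<bullet> a - angular_square a x - angular_square a x * p x)
     = G (\<lambda>x. (a \<bullet> a - (c + 2) * angular_square a x - 2 * angular_square a x * p x) + ((c + 1) * angular_square a x + angular_square a x * p x))"
    by (rule arg_cong[where f=G]) (auto simp: fun_eq_iff algebra_simps)
  also have "\<dots> = G (\<lambda>x. c * lq x * p x * angular_square a x) + G (\<lambda>x. (c + 1) * angular_square a x + angular_square a x * p x)"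
    by (subst G_add) (auto intro!: tempered_cigar tempered_angular_square simp: eq)
  also have "\<dots> = G (\<lambda>x. c * lq x * p x * angular_square a x + ((c + 1) * angular_square a x + angular_square a x * p x))"
    by (subst G_add[of "\<lambda>x. c * lq x * p x * angular_square a x"]) (auto intro!: tempered_cigar tempered_angular_square)
  also have "\<dots> = G (\<lambda>x. 2 * c * angular_square a x - ((c - 1) - p x - c * lq x * p x) * angular_square a x)"
    by (rule arg_cong[where f=G]) (auto simp: fun_eq_iff algebra_simps)
  also have "\<dots> = 2 * c * G (angular_square a) - G (\<lambda>x. ((c - 1) - p x - c * lq x * p x) * angular_square a x)"
    by (subst G_diff) (auto intro!: tempered_cigar tempered_angular_square simp: G_cmult)
  finally show ?thesis unfolding angular_energy_density gap_density_mult G_cmult using c_pos by (simp add: field_simps)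
qed

text \<open>The numerator of the density is \<open>((c - 1) q - 1 - c lq) / q\<close>. Inserting the second Taylor polynomial of
  \<open>q = exp (2 lq)\<close> leaves \<open>(c - 2) (1 + lq) + 2 (c - 1) lq\<^sup>2\<close>, and here \<open>c \<ge> 2\<close>, that is \<open>d \<ge> 4\<close>, is used.
  For \<open>c = 2\<close> the density vanishes at the origin.\<close>

lemma angular_gap_pos:
  assumes "a \<noteq> 0" shows "G (\<lambda>x. (a \<bullet> x)\<^sup>2 * gap_density x) > 0"
proof (rule G_pos[of _ a])
  show "tempered (\<lambda>x. (a \<bullet> x)\<^sup>2 * gap_density x)" by (intro tempered_cigar tempered_gap_density)
  have num: "(c - 1) - p x - c * lq x * p x \<ge> 0 \<and> (lq x > 0 \<longrightarrow> (c - 1) - p x - c * lq x * p x > 0)" for x :: "real^'n"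
  proof -
    have "1 + 2 * lq x + (2 * lq x)\<^sup>2 / 2 \<le> q x"
      using exp_lower_Taylor_quadratic[of "2 * lq x"] lq_nonneg[of x] unfolding exp_lq by simp
    then have "(c - 1) * (1 + 2 * lq x + (2 * lq x)\<^sup>2 / 2) \<le> (c - 1) * q x"
      using c_ge_2 by (intro mult_left_mono) auto
    moreover have "(c - 1) * (1 + 2 * lq x + (2 * lq x)\<^sup>2 / 2)
        = 1 + c * lq x + ((c - 2) * (1 + lq x) + 2 * (c - 1) * (lq x)\<^sup>2)"
      by (simp add: power2_eq_square algebra_simps)
    ultimately have "(c - 2) * (1 + lq x) + 2 * (c - 1) * (lq x)\<^sup>2 \<le> (c - 1) * q x - 1 - c * lq x"
      by linarith
    moreover have "0 \<le> (c - 2) * (1 + lq x)" "0 \<le> 2 * (c - 1) * (lq x)\<^sup>2"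
      "lq x > 0 \<Longrightarrow> 0 < 2 * (c - 1) * (lq x)\<^sup>2"
      using c_ge_2 lq_nonneg[of x] by simp_all
    ultimately have "0 \<le> (c - 1) * q x - 1 - c * lq x \<and> (lq x > 0 \<longrightarrow> 0 < (c - 1) * q x - 1 - c * lq x)"
      by linarith
    moreover have "(c - 1) - p x - c * lq x * p x = ((c - 1) * q x - 1 - c * lq x) * p x"
      using q_nonzero[of x] by (simp add: algebra_simps)
    ultimately show ?thesis using q_pos[of x] by simp
  qed
  show "0 \<le> (a \<bullet> x)\<^sup>2 * gap_density x" for x
    unfolding gap_density_def using num[of x] c_pos by (intro mult_nonneg_nonneg divide_nonneg_pos) (auto simp: less_imp_le[OF q_pos])
  have "lq a > 0" using assms by (auto simp: lq_def q_def intro!: divide_pos_pos ln_gt_zero)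
  then have "gap_density a > 0" unfolding gap_density_def using num[of a] c_pos q_pos[of a] by simp
  then show "0 < (a \<bullet> a)\<^sup>2 * gap_density a" using assms by simp
qed

theorem eigenvalue_less_2:
  "variational_eigenvalue (CARD('n) + 2) (cigar c :: 'n tensor2) M < 2"
proof -
  obtain \<epsilon> where \<epsilon>: "\<epsilon> > 0" "\<And>a. \<epsilon> * G (\<lambda>x. (a \<bullet> x)\<^sup>2 * p x) \<le> G (\<lambda>x. (a \<bullet> x)\<^sup>2 * gap_density x)"
    using quadratic_forms_comparable[OF tempered_gap_density tempered_inverse_q angular_gap_pos] by blast
  define \<Lambda> where "\<Lambda> = max 0 (max (G (\<lambda>x. q x / c * ((p x *\<^sub>R x) \<bullet> (p x *\<^sub>R x))) / G (\<lambda>x. (radial x)\<^sup>2)) (2 - \<epsilon>))"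
  have L2: "\<Lambda> < 2" using radial_gap radial_norm_pos \<epsilon>(1) by (simp add: \<Lambda>_def divide_less_eq)
  have "variational_eigenvalue (CARD('n) + 2) (cigar c :: 'n tensor2) M \<le> ereal \<Lambda>"
  proof (rule variational_eigenvalue_upper_bound[where A="\<lambda>x. q x / c" and h=radial and w=angular_factor and Dh="\<lambda>x. p x *\<^sub>R x" and Dw=angular_factor_grad])
    show "matrix_inv (cigar c x) = (q x / c) *\<^sub>R mat 1" for x :: "real^'n"
      by (rule cigar_matrix_inv[OF c_pos])
    show "tempered (\<lambda>x::real^'n. q x / c)" unfolding divide_inverse by (intro tempered_cigar)
    show "tempered (\<lambda>x. (p x *\<^sub>R x) $ i)" for i by simp (intro tempered_cigar)
    show "G (\<lambda>x. ((a \<bullet> x) * angular_factor x)\<^sup>2) > 0" if "a \<noteq> 0" for a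
      unfolding angular_square_eq by (rule G_pos[OF tempered_angular_square, where ?x0.0=a]) (use that in \<open>simp_all add: angular_square_def q_pos less_imp_le[OF q_pos]\<close>)
    show "G (\<lambda>x. q x / c * ((p x *\<^sub>R x) \<bullet> (p x *\<^sub>R x))) \<le> \<Lambda> * G (\<lambda>x. (radial x)\<^sup>2)"
      using radial_norm_pos by (simp add: pos_divide_le_eq[symmetric] \<Lambda>_def)
    show "G (\<lambda>x. q x / c * ((angular_factor x *\<^sub>R a + (a \<bullet> x) *\<^sub>R angular_factor_grad x) \<bullet> (angular_factor x *\<^sub>R a + (a \<bullet> x) *\<^sub>R angular_factor_grad x)))
         \<le> \<Lambda> * G (\<lambda>x. ((a \<bullet> x) * angular_factor x)\<^sup>2)" for a
    proof -
      have "G (angular_square a) \<ge> 0" by (rule G_nonneg) (simp add: angular_square_def less_imp_le[OF q_pos])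
      then have "(2 - \<epsilon>) * G (angular_square a) \<le> \<Lambda> * G (angular_square a)"
        by (intro mult_right_mono) (auto simp: \<Lambda>_def)
      moreover have "\<epsilon> * G (angular_square a) \<le> G (\<lambda>x. (a \<bullet> x)\<^sup>2 * gap_density x)"
        using \<epsilon>(2)[of a] by (simp add: angular_square_def[abs_def])
      ultimately show ?thesis unfolding angular_gap angular_square_eq by (simp add: algebra_simps)
    qed
  qed (use tempered_radial radial_GDERIV G_radial radial_norm_pos tempered_angular_factor angular_factor_GDERIV tempered_angular_factor_grad in
      \<open>auto simp: radial_def angular_factor_def angular_factor_grad_def \<Lambda>_def cigar_exponent_def\<close>)
  also have "ereal \<Lambda> < 2" using L2 by simp
  finally show ?thesis .
qed

end

theorem cigar_eigenvalue:
  assumes c: "c = real CARD('n) - 2" and d: "CARD('n) \<ge> 4"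
  shows "variational_eigenvalue (CARD('n) + 2) (cigar c :: 'n::finite tensor2)
           (weighted_measure (cigar c) (cigar_potential c)) < 2"
proof -
  interpret cigar_space c "TYPE('n)"
    by unfold_locales (use c d in auto)
  show ?thesis unfolding cigar_weighted_measure[OF c_pos c] by (rule eigenvalue_less_2)
qed

section \<open>The Gaussian measure\<close>

lemma power_le_fact_exp: 
  fixes t :: real assumes "0 \<le> t" shows "t ^ k \<le> fact k * exp t"
proof -
  have "t ^ k /\<^sub>R fact k \<le> exp t"
    using sum_le_suminf[OF summable_exp_generic, of "{k}" t] assms by (simp add: exp_def)
  then show ?thesis by (simp add: field_simps)
qed

text \<open>Stated for all scales since exponents smaller than that of the Gaussian serve as integrable majorants.\<close>

lemma gaussian_weight:
  assumes s: "s > 0" and "K > 0"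
  shows "rapid_weight (\<lambda>x::real^'n. (x \<bullet> x) / s) (\<lambda>x. (2 / s) *\<^sub>R x) K"
proof
  show "GDERIV (\<lambda>x::real^'n. (x \<bullet> x) / s) x :> (2 / s) *\<^sub>R x" for x
    using GDERIV_mult[OF GDERIV_const[of "1 / s"] GDERIV_inner_self[of x]] by simp
  show "tempered (\<lambda>x. ((2 / s) *\<^sub>R x) $ i)" for i :: 'n
    unfolding vector_scaleR_component real_scaleR_def by (intro tempered_intros)
  show "integrable lborel (\<lambda>x::real^'n. (1 + x \<bullet> x) ^ k * exp (- ((x \<bullet> x) / s)))" for k
  proof (rule integrable_moments)
    show "continuous_on UNIV (\<lambda>x::real^'n. (x \<bullet> x) / s)" using s by (intro continuous_intros) auto
    fix k
    have "q x ^ k * exp (- ((x \<bullet> x) / s)) \<le> s ^ k * fact k * exp (1 / s)" for x :: "real^'n"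
    proof -
      have "(q x / s) ^ k \<le> fact k * exp (q x / s)"
        using s by (intro power_le_fact_exp) (simp add: less_imp_le[OF q_pos])
      then have "q x ^ k \<le> s ^ k * fact k * exp (q x / s)" using s by (simp add: power_divide field_simps)
      then have "q x ^ k * exp (- ((x \<bullet> x) / s)) \<le> s ^ k * fact k * exp (q x / s) * exp (- ((x \<bullet> x) / s))"
        by (rule mult_right_mono) simp
      also have "\<dots> = s ^ k * fact k * exp (1 / s)"
        unfolding mult.assoc exp_add[symmetric] by (simp add: q_def add_divide_distrib)
      finally show ?thesis .
    qed
    then show "\<exists>C. \<forall>x::real^'n. q x ^ k * exp (- ((x \<bullet> x) / s)) \<le> C" by blast
  qed
qed (rule assms)

text \<open>The total mass is left arbitrary, because Rayleigh quotients do not depend on it.\<close>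

locale gaussian =
  fixes K :: real and dummy :: "'n::finite itself"
  assumes K_pos: "K > 0"
begin

sublocale rapid_weight "\<lambda>x::real^'n. (x \<bullet> x) / 2" "\<lambda>x. x" K
  using gaussian_weight[of 2 K] K_pos by simp

end

lemma gaussian_measure_eq:
  "gaussian_measure = rapid_weight.M (\<lambda>x::real^'n. (x \<bullet> x) / 2) ((2 * pi) powr (- real CARD('n) / 2))"
proof -
  interpret rapid_weight "\<lambda>x::real^'n. (x \<bullet> x) / 2" "\<lambda>x. x" "(2 * pi) powr (- real CARD('n) / 2)"
    using gaussian_weight[of 2 "(2 * pi) powr (- real CARD('n) / 2)"] by simp
  show ?thesis
    unfolding gaussian_measure_def M_def rho_def power2_norm_eq_inner minus_divide_left by (rule refl)
qed

lemma flat_matrix_inv: "matrix_inv (flat_metric x) = 1 *\<^sub>R mat 1"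
  unfolding flat_metric_def by (simp add: matrix_inv_eqI)

context gaussian begin

text \<open>Stein's identity.\<close>

lemma G_coord_mult: "tempered F \<Longrightarrow> (\<And>x. GDERIV F x :> D x) \<Longrightarrow> tempered (\<lambda>x. D x $ i)
    \<Longrightarrow> G (\<lambda>x. F x * x $ i) = G (\<lambda>x. D x $ i)"
  using integration_by_parts[of F D i] by simp

lemma G_coord_coord: "G (\<lambda>x. x $ i * x $ j) = \<delta> i j * G (\<lambda>_. 1)"
proof -
  have "G (\<lambda>x. x $ i * x $ j) = G (\<lambda>x. axis i 1 $ j)"
    by (rule G_coord_mult) (auto intro: tempered_coord tempered_const GDERIV_coord)
  also have "\<dots> = G (\<lambda>x. \<delta> i j * 1)" by (simp add: axis_def)
  finally show ?thesis unfolding G_cmult .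
qed

lemma G_coord: "G (\<lambda>x. x $ i) = 0"
  by (rule G_odd) (auto intro: tempered_coord)

lemma G_inner_square: "G (\<lambda>x. (a \<bullet> x)\<^sup>2) = (a \<bullet> a) * G (\<lambda>_. 1)"
proof -
  have "(a \<bullet> x)\<^sup>2 = (\<Sum>i\<in>UNIV. \<Sum>j\<in>UNIV. (a $ i * a $ j) * (x $ i * x $ j))" for x :: "real^'n"
    by (simp add: power2_eq_square inner_vec_def sum_product mult_ac)
  then have "G (\<lambda>x. (a \<bullet> x)\<^sup>2) = (\<Sum>i\<in>UNIV. \<Sum>j\<in>UNIV. G (\<lambda>x. (a $ i * a $ j) * (x $ i * x $ j)))"
    by (simp add: G_sum tempered_intros)
  also have "\<dots> = (\<Sum>i\<in>UNIV. \<Sum>j\<in>UNIV. \<delta> i j * (a $ i * a $ j * G (\<lambda>_. 1)))"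
    unfolding G_cmult G_coord_coord by (intro sum.cong refl) auto
  also have "\<dots> = (\<Sum>i\<in>UNIV. a $ i * a $ i * G (\<lambda>_. 1))"
    by (simp only: sum_delta_left)
  finally show ?thesis by (simp add: inner_vec_def sum_distrib_right)
qed

text \<open>The trial space is spanned by 1, the coordinates and one Hermite polynomial \<open>x\<^sub>1\<^sup>2 - 1\<close>.\<close>

theorem gaussian_eigenvalue_le_2:
  "variational_eigenvalue (CARD('n) + 2) (flat_metric :: 'n tensor2) M \<le> ereal 2"
proof -
  fix o1 :: 'n
  define h where "h x = x $ o1 * x $ o1 - 1" for x :: "real^'n"
  have th: "tempered h" unfolding h_def[abs_def] by (intro tempered_intros)
  have DhG: "GDERIV h x :> (2 * x $ o1) *\<^sub>R axis o1 1" for x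
  proof -
    have "GDERIV h x :> (x $ o1 *\<^sub>R axis o1 1 + x $ o1 *\<^sub>R axis o1 1) - 0"
      unfolding h_def[abs_def] by (intro GDERIV_diff GDERIV_mult GDERIV_coord GDERIV_const)
    moreover have "(x $ o1 *\<^sub>R axis o1 1 + x $ o1 *\<^sub>R axis o1 1) - 0 = (2 * x $ o1) *\<^sub>R (axis o1 1 :: real^'n)"
      by (simp add: vec_eq_iff)
    ultimately show ?thesis by simp
  qed
  have h0: "G h = 0"
  proof -
    have "G h = G (\<lambda>x. x $ o1 * x $ o1) - G (\<lambda>_. 1)"
      unfolding h_def[abs_def] by (rule G_diff) (auto intro!: tempered_intros)
    then show ?thesis by (simp add: G_coord_coord)
  qed
  have hh: "G (\<lambda>x. (h x)\<^sup>2) = 2 * G (\<lambda>_. 1)"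
  proof -
    have "G (\<lambda>x. (h x * x $ o1) * x $ o1) = G (\<lambda>x. (h x *\<^sub>R axis o1 1 + x $ o1 *\<^sub>R ((2 * x $ o1) *\<^sub>R axis o1 1)) $ o1)"
    proof (rule G_coord_mult)
      show "GDERIV (\<lambda>x. h x * x $ o1) x :> h x *\<^sub>R axis o1 1 + x $ o1 *\<^sub>R ((2 * x $ o1) *\<^sub>R axis o1 1)" for x
        by (intro GDERIV_mult DhG GDERIV_coord)
    qed (auto intro!: th tempered_intros)
    also have "\<dots> = G (\<lambda>x. h x + 2 * (x $ o1 * x $ o1))"
      by (simp add: axis_def mult_ac)
    also have "\<dots> = G h + 2 * G (\<lambda>x. x $ o1 * x $ o1)"
      by (subst G_add) (auto intro!: th tempered_intros simp: G_cmult)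
    finally have 1: "G (\<lambda>x. (h x * x $ o1) * x $ o1) = 2 * G (\<lambda>_. 1)" using h0 by (simp add: G_coord_coord)
    have "G (\<lambda>x. (h x)\<^sup>2) = G (\<lambda>x. (h x * x $ o1) * x $ o1 - h x)"
      by (rule arg_cong[where f=G]) (auto simp: h_def fun_eq_iff power2_eq_square algebra_simps)
    also have "\<dots> = G (\<lambda>x. (h x * x $ o1) * x $ o1) - G h"
      by (rule G_diff) (auto intro!: th tempered_intros)
    finally show ?thesis using 1 h0 by simp
  qed
  show ?thesis
  proof (rule variational_eigenvalue_upper_bound[where A="\<lambda>_. 1" and h=h and w="\<lambda>_. 1" and Dh="\<lambda>x. (2 * x $ o1) *\<^sub>R axis o1 1" and Dw="\<lambda>_. 0"])
    show "matrix_inv (flat_metric x) = 1 *\<^sub>R mat 1" for x :: "real^'n" by (rule flat_matrix_inv)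
    show "tempered (\<lambda>x. ((2 * x $ o1) *\<^sub>R axis o1 1) $ i)" for i
      by (auto intro!: tempered_intros)
    show "0 < G (\<lambda>x. (h x)\<^sup>2)" using hh G_one_pos by simp
    show "0 < G (\<lambda>x. ((c \<bullet> x) * 1)\<^sup>2)" if "c \<noteq> 0" for c
      using that G_one_pos by (simp add: G_inner_square)
    have e: "1 * (((2 * x $ o1) *\<^sub>R (axis o1 1 :: real^'n)) \<bullet> ((2 * x $ o1) *\<^sub>R axis o1 1)) = 4 * (x $ o1 * x $ o1)" for x :: "real^'n"
      by (simp add: inner_axis_axis inner_real_def)
    show "G (\<lambda>x. 1 * (((2 * x $ o1) *\<^sub>R (axis o1 1 :: real^'n)) \<bullet> ((2 * x $ o1) *\<^sub>R axis o1 1))) \<le> 2 * G (\<lambda>x. (h x)\<^sup>2)"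
      unfolding e hh G_cmult G_coord_coord by simp
    show "G (\<lambda>x. 1 * ((1 *\<^sub>R c + (c \<bullet> x) *\<^sub>R 0) \<bullet> (1 *\<^sub>R c + (c \<bullet> x) *\<^sub>R 0))) \<le> 2 * G (\<lambda>x. ((c \<bullet> x) * 1)\<^sup>2)" for c
    proof -
      have "G (\<lambda>x. (c \<bullet> c) * 1) = (c \<bullet> c) * G (\<lambda>_. 1)" by (rule G_cmult)
      then show ?thesis using G_one_pos by (simp add: G_inner_square)
    qed
  qed (use th h0 DhG in \<open>auto simp: h_def GDERIV_const intro: tempered_const\<close>)
qed

end

section \<open>Polynomials and the Ornstein-Uhlenbeck operator\<close>

text \<open>Polynomials of degree below \<open>k\<close>, where 0 has degree below 0; inductions on \<open>k\<close> then start at the zero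
  function.\<close>

inductive poly_below :: "nat \<Rightarrow> (real^'n \<Rightarrow> real) \<Rightarrow> bool" where
  zero: "poly_below k (\<lambda>_. 0)"
| const: "poly_below (Suc k) (\<lambda>_. c)"
| coord: "poly_below k f \<Longrightarrow> poly_below (Suc k) (\<lambda>x. x $ i * f x)"
| add: "poly_below k f \<Longrightarrow> poly_below k g \<Longrightarrow> poly_below k (\<lambda>x. f x + g x)"

definition polynomial :: "(real^'n \<Rightarrow> real) \<Rightarrow> bool" where
  "polynomial f \<longleftrightarrow> (\<exists>k. poly_below k f)"

lemma poly_below_Suc: "poly_below k f \<Longrightarrow> poly_below (Suc k) f"
  by (induction rule: poly_below.induct) (auto intro: poly_below.intros)

lemma poly_below_mono: "poly_below k f \<Longrightarrow> k \<le> m \<Longrightarrow> poly_below m f"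
  by (induction m rule: nat_induct) (auto simp: le_Suc_eq intro: poly_below_Suc)

lemma poly_below_0: "poly_below 0 f \<Longrightarrow> f = (\<lambda>_. 0)"
  by (induction "0::nat" f rule: poly_below.induct) auto

lemma poly_below_1: "poly_below (Suc 0) f \<Longrightarrow> \<exists>c. f = (\<lambda>_. c)"
proof (induction "Suc 0" f rule: poly_below.induct)
  case (coord f i)
  then show ?case using poly_below_0 by fastforce
qed auto

lemma poly_below_cmult: "poly_below k f \<Longrightarrow> poly_below k (\<lambda>x. c * f x)"
proof (induction rule: poly_below.induct)
  case (coord k f i)
  from poly_below.coord[OF coord.IH, of i] show ?case by (simp add: mult_ac)
next
  case (add k f g)
  from poly_below.add[OF add.IH] show ?case by (simp add: distrib_left)
qed (auto intro: poly_below.intros)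

lemma polynomial_const: "polynomial (\<lambda>_. c)"
  unfolding polynomial_def using poly_below.const by blast

lemma polynomial_coord: "polynomial (\<lambda>x. x $ i)"
  unfolding polynomial_def using poly_below.coord[OF poly_below.const[of _ 1], of _ i] by auto

lemma polynomial_add:
  assumes "polynomial f" "polynomial g" shows "polynomial (\<lambda>x. f x + g x)"
proof -
  obtain k m where "poly_below k f" "poly_below m g" using assms unfolding polynomial_def by blast
  then have "poly_below (max k m) f" "poly_below (max k m) g" by (auto intro: poly_below_mono)
  then show ?thesis unfolding polynomial_def using poly_below.add by blast
qed

lemma polynomial_cmult: "polynomial f \<Longrightarrow> polynomial (\<lambda>x. c * f x)"
  unfolding polynomial_def using poly_below_cmult by blast

lemma polynomial_diff: "polynomial f \<Longrightarrow> polynomial g \<Longrightarrow> polynomial (\<lambda>x. f x - g x)"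
  using polynomial_add[OF _ polynomial_cmult[of g "-1"]] by simp

lemma polynomial_coord_mult: "polynomial f \<Longrightarrow> polynomial (\<lambda>x. x $ i * f x)"
  unfolding polynomial_def using poly_below.coord by blast

lemma polynomial_mult:
  assumes "polynomial f" "polynomial g" shows "polynomial (\<lambda>x. f x * g x)"
proof -
  obtain k where "poly_below k f" using assms(1) unfolding polynomial_def by blast
  then show ?thesis
  proof (induction rule: poly_below.induct)
    case (coord k f i)
    from polynomial_coord_mult[OF coord.IH, of i] show ?case by (simp add: mult.assoc)
  next
    case (add k f h)
    from polynomial_add[OF add.IH] show ?case by (simp add: distrib_right)
  qed (use assms(2) polynomial_const[of 0] polynomial_cmult[of g] in auto)
qed

lemma polynomial_sum: "finite A \<Longrightarrow> (\<And>j. j \<in> A \<Longrightarrow> polynomial (f j)) \<Longrightarrow> polynomial (\<lambda>x. \<Sum>j\<in>A. f j x)"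
  by (induction A rule: finite_induct) (auto intro: polynomial_const polynomial_add)

lemma polynomial_power: "polynomial f \<Longrightarrow> polynomial (\<lambda>x. f x ^ k)"
  by (induction k) (auto intro: polynomial_const polynomial_mult)

lemmas polynomial_intros = polynomial_const polynomial_coord polynomial_add polynomial_diff
  polynomial_mult polynomial_sum polynomial_power

lemma smooth_polynomial:
  fixes f :: "real^'n \<Rightarrow> real"
  assumes "polynomial f" shows "smooth f"
proof (rule smooth_algebra_hull_coords[of "{}"])
  obtain k where "poly_below k f" using assms unfolding polynomial_def by blast
  then show "algebra_hull ({} \<union> range (\<lambda>i x. x $ i)) f"
  proof (induction rule: poly_below.induct)
    case (coord k f i)
    then show ?case by (intro algebra_hull.mult[OF algebra_hull.base]) auto
  qed (auto intro: algebra_hull.intros)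
qed simp

lemma tempered_polynomial:
  assumes "polynomial f" shows "tempered f"
proof -
  obtain k where k: "poly_below k f" using assms unfolding polynomial_def by blast
  then show ?thesis by (induction rule: poly_below.induct) (auto intro!: tempered_intros)
qed

lemma poly_below_smooth: "poly_below k f \<Longrightarrow> smooth f"
  using smooth_polynomial polynomial_def by blast

lemma partial_coord_mult:
  assumes "smooth f"
  shows "partial i (\<lambda>x. x $ j * f x) = (\<lambda>x. x $ j * partial i f x + \<delta> j i * f x)"
  by (subst partial_mult) (auto simp: partial_coord smooth_differentiable[OF assms] GDERIV_imp_differentiable[OF GDERIV_coord])

lemma partial_add_smooth:
  "smooth f \<Longrightarrow> smooth g \<Longrightarrow> partial i (\<lambda>x. f x + g x) = (\<lambda>x. partial i f x + partial i g x)"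
  by (rule partial_add) (auto intro: smooth_differentiable)

lemma partial_cmult_smooth:
  "smooth f \<Longrightarrow> partial i (\<lambda>x. c * f x) = (\<lambda>x. c * partial i f x)"
  by (subst partial_mult) (auto simp: partial_const smooth_differentiable)

lemma smooth_const: "smooth (\<lambda>_. c)"
  by (rule smooth_polynomial[OF polynomial_const])

lemma smooth_diff:
  assumes "smooth f" "smooth g" shows "smooth (\<lambda>x. f x - g x)"
proof -
  have "algebra_hull {f. smooth f} (\<lambda>x. f x + (- 1) * g x)"
    using assms smooth_const by (intro algebra_hull.add algebra_hull.mult algebra_hull.base) auto
  from smooth_algebra_hull_smooth[OF this] show ?thesis by simp
qed

lemma partial_diff_smooth:
  assumes "smooth f" "smooth g"
  shows "partial i (\<lambda>x. f x - g x) = (\<lambda>x. partial i f x - partial i g x)"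
  using partial_add_smooth[OF assms(1) smooth_mult[OF smooth_const[of "-1"] assms(2)], of i]
    partial_cmult_smooth[OF assms(2), of i "-1"] by simp

lemma poly_below_partial: "poly_below k f \<Longrightarrow> poly_below (k - 1) (partial i f)"
proof (induction rule: poly_below.induct)
  case (coord k f j)
  show ?case
  proof (cases k)
    case 0
    then have "f = (\<lambda>_. 0)" using coord.hyps poly_below_0 by blast
    then show ?thesis by (simp add: partial_const poly_below.zero)
  next
    case (Suc m)
    have "poly_below k (\<lambda>x. x $ j * partial i f x + \<delta> j i * f x)"
      using poly_below.coord[OF coord.IH, of j] coord.hyps Suc
      by (intro poly_below.add poly_below_cmult) auto
    then show ?thesis using partial_coord_mult[OF poly_below_smooth[OF coord.hyps]] by simp
  qed
next
  case (add k f g)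
  then show ?case by (simp add: partial_add_smooth poly_below_smooth poly_below.add)
qed (auto simp: partial_const intro: poly_below.zero)

lemma polynomial_partial: "polynomial f \<Longrightarrow> polynomial (partial i f)"
  unfolding polynomial_def using poly_below_partial by blast

lemma partial_commute:
  assumes "polynomial f" shows "partial i (partial j f) = partial j (partial i f)"
proof -
  obtain k where k: "poly_below k f" using assms unfolding polynomial_def by blast
  then show ?thesis
  proof (induction rule: poly_below.induct)
    case (coord k f l)
    have s: "smooth f" by (rule poly_below_smooth[OF coord.hyps])
    have sp: "smooth (partial i f)" for i by (rule smooth_partial[OF s])
    have 1: "partial i (partial j (\<lambda>x. x $ l * f x)) = (\<lambda>x. (x $ l * partial i (partial j f) x + \<delta> l i * partial j f x) + \<delta> l j * partial i f x)" for i j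
    proof -
      have "smooth (\<lambda>x. x $ l * partial j f x)" "smooth (\<lambda>x. \<delta> l j * f x)"
        by (intro smooth_mult sp s smooth_const smooth_polynomial polynomial_coord)+
      then show ?thesis
        by (simp only: partial_coord_mult[OF s] partial_coord_mult[OF sp] partial_add_smooth partial_cmult_smooth[OF s])
    qed
    show ?case unfolding 1 coord.IH by (auto simp: fun_eq_iff)
  next
    case (add k f g)
    then show ?case by (simp add: partial_add_smooth poly_below_smooth smooth_partial)
  qed (auto simp: partial_const)
qed

text \<open>The negative of the Ornstein-Uhlenbeck operator, a nonnegative operator for the Gaussian measure.\<close>

definition ou :: "(real^'n \<Rightarrow> real) \<Rightarrow> real^'n \<Rightarrow> real" where
  "ou f x = (\<Sum>i\<in>UNIV. x $ i * partial i f x - partial i (partial i f) x)"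

lemma ou_const: "ou (\<lambda>_. c) = (\<lambda>_. 0)"
  by (simp add: ou_def fun_eq_iff partial_const)

lemma ou_add: "smooth f \<Longrightarrow> smooth g \<Longrightarrow> ou (\<lambda>x. f x + g x) = (\<lambda>x. ou f x + ou g x)"
  by (simp add: ou_def fun_eq_iff partial_add_smooth smooth_partial sum.distrib[symmetric] algebra_simps)

lemma ou_cmult: "smooth f \<Longrightarrow> ou (\<lambda>x. c * f x) = (\<lambda>x. c * ou f x)"
  by (simp add: ou_def fun_eq_iff partial_cmult_smooth smooth_partial sum_distrib_left algebra_simps)

lemma ou_coord_mult:
  assumes s: "smooth f"
  shows "ou (\<lambda>x. x $ j * f x) x = x $ j * ou f x + x $ j * f x - 2 * partial j f x"
proof -
  have sp: "smooth (partial i f)" for i by (rule smooth_partial[OF s])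
  have 2: "partial i (partial i (\<lambda>x. x $ j * f x)) = (\<lambda>x. (x $ j * partial i (partial i f) x + \<delta> j i * partial i f x) + \<delta> j i * partial i f x)" for i
  proof -
    have "smooth (\<lambda>x. x $ j * partial i f x)" "smooth (\<lambda>x. \<delta> j i * f x)"
      by (intro smooth_mult sp s smooth_const smooth_polynomial polynomial_coord)+
    then show ?thesis
      by (simp only: partial_coord_mult[OF s] partial_coord_mult[OF sp] partial_add_smooth partial_cmult_smooth[OF s])
  qed
  have "ou (\<lambda>x. x $ j * f x) x = (\<Sum>i\<in>UNIV. x $ j * (x $ i * partial i f x - partial i (partial i f) x) + \<delta> j i * (x $ i * f x) - 2 * (\<delta> j i * partial i f x))"
    unfolding ou_def unfolding 2 unfolding partial_coord_mult[OF s] by (intro sum.cong) (auto simp: algebra_simps)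
  also have "\<dots> = x $ j * ou f x + x $ j * f x - 2 * partial j f x"
    by (simp only: sum.distrib sum_subtractf sum_distrib_simps sum_delta_left) (simp add: ou_def sum_subtractf)
  finally show ?thesis .
qed

text \<open>By Euler's identity \<open>x \<bullet> \<nabla>\<close> multiplies the homogeneous part of degree \<open>k\<close> by \<open>k\<close>, while the Laplacian
  lowers the degree.\<close>

lemma ou_leading_term: "poly_below k f \<Longrightarrow> poly_below (k - 1) (\<lambda>x. ou f x - real (k - 1) * f x)"
proof (induction rule: poly_below.induct)
  case (const k c)
  then show ?case by (cases k) (auto simp: ou_const intro: poly_below.intros)
next
  case (coord k f j)
  show ?case
  proof (cases k)
    case 0
    then have "f = (\<lambda>_. 0)" using coord.hyps poly_below_0 by blast
    then show ?thesis by (simp add: ou_const poly_below.zero)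
  next
    case (Suc m)
    have eq: "ou (\<lambda>x. x $ j * f x) x - real (Suc k - 1) * (x $ j * f x)
        = x $ j * (ou f x - real (k - 1) * f x) + (- 2) * partial j f x" for x
      unfolding ou_coord_mult[OF poly_below_smooth[OF coord.hyps]] using Suc by (simp add: algebra_simps)
    have "poly_below k (\<lambda>x. x $ j * (ou f x - real (k - 1) * f x) + (- 2) * partial j f x)"
      using poly_below.coord[OF coord.IH, of j] poly_below_Suc[OF poly_below_partial[OF coord.hyps, of j]] Suc
      by (intro poly_below.add poly_below_cmult) auto
    then show ?thesis unfolding eq by simp
  qed
next
  case (add k f g)
  from poly_below.add[OF add.IH] show ?case
    by (simp add: ou_add poly_below_smooth[OF add.hyps(1)] poly_below_smooth[OF add.hyps(2)] algebra_simps)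
qed (simp add: ou_const poly_below.zero)

lemma polynomial_ou: "polynomial f \<Longrightarrow> polynomial (ou f)"
  unfolding ou_def[abs_def] by (intro polynomial_intros polynomial_partial) auto

text \<open>Induction on the degree: up to terms of lower degree, a polynomial of degree \<open>k \<ge> 1\<close> is \<open>1 / k\<close> times its
  own image. Only the constants are missed.\<close>

lemma ou_surjective:
  "poly_below k p \<Longrightarrow> \<exists>u c. polynomial u \<and> p = (\<lambda>x. ou u x + c)"
proof (induction k arbitrary: p)
  case 0
  then show ?case using poly_below_0[OF 0]
    by (intro exI[of _ "\<lambda>_. 0"] exI[of _ 0]) (simp add: ou_const polynomial_const)
next
  case (Suc k)
  show ?case
  proof (cases "k = 0")
    case True
    then obtain c where "p = (\<lambda>_. c)" using Suc.prems poly_below_1 by blast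
    then show ?thesis by (intro exI[of _ "\<lambda>_. 0"] exI[of _ c]) (simp add: ou_const polynomial_const)
  next
    case False
    have "poly_below k (\<lambda>x. ou p x - real k * p x)" using ou_leading_term[OF Suc.prems] by simp
    from Suc.IH[OF this] obtain v c where v: "polynomial v" "(\<lambda>x. ou p x - real k * p x) = (\<lambda>x. ou v x + c)" by blast
    have p: "polynomial p" using Suc.prems polynomial_def by blast
    define u where "u = (\<lambda>x. (1 / real k) * (p x + (- 1) * v x))"
    have "ou u x = (1 / real k) * (ou p x + (- 1) * ou v x)" for x
      unfolding u_def using p v(1)
      by (simp only: ou_cmult ou_add smooth_polynomial polynomial_add polynomial_cmult)
    moreover have "p x = (1 / real k) * (ou p x + (- 1) * ou v x) + (- c / real k)" for x
      using fun_cong[OF v(2), of x] False by (simp add: field_simps)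
    ultimately have "p = (\<lambda>x. ou u x + (- c / real k))" by auto
    moreover have "polynomial u" unfolding u_def by (intro polynomial_cmult polynomial_add p v)
    ultimately show ?thesis by blast
  qed
qed

context gaussian begin

lemma polynomial_GDERIV: "polynomial f \<Longrightarrow> GDERIV f x :> (\<chi> i. partial i f x)"
  by (intro differentiable_eq_GDERIV_partial smooth_differentiable smooth_polynomial)

lemma G_ou:
  assumes u: "polynomial u" and v: "polynomial v"
  shows "G (\<lambda>x. u x * ou v x) = (\<Sum>i\<in>UNIV. G (\<lambda>x. partial i u x * partial i v x))"
proof -
  note t = tempered_polynomial polynomial_intros polynomial_partial u v
  have *: "G (\<lambda>x. (u x * partial i v x) * x $ i) = G (\<lambda>x. u x * partial i (partial i v) x + partial i v x * partial i u x)" for i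
  proof -
    have "G (\<lambda>x. (u x * partial i v x) * x $ i) = G (\<lambda>x. (u x *\<^sub>R (\<chi> j. partial j (partial i v) x) + partial i v x *\<^sub>R (\<chi> j. partial j u x)) $ i)"
    proof (rule G_coord_mult)
      show "GDERIV (\<lambda>x. u x * partial i v x) x :> u x *\<^sub>R (\<chi> j. partial j (partial i v) x) + partial i v x *\<^sub>R (\<chi> j. partial j u x)" for x
        by (intro GDERIV_mult polynomial_GDERIV polynomial_partial u v)
    qed (auto intro!: t)
    then show ?thesis by simp
  qed
  have "G (\<lambda>x. u x * ou v x) = G (\<lambda>x. \<Sum>i\<in>UNIV. (u x * partial i v x) * x $ i - u x * partial i (partial i v) x)"
    by (rule arg_cong[where f=G]) (auto simp: fun_eq_iff ou_def sum_distrib_left algebra_simps)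
  also have "\<dots> = (\<Sum>i\<in>UNIV. G (\<lambda>x. (u x * partial i v x) * x $ i - u x * partial i (partial i v) x))"
    by (rule G_sum) (auto intro!: t)
  also have "\<dots> = (\<Sum>i\<in>UNIV. G (\<lambda>x. (u x * partial i v x) * x $ i) - G (\<lambda>x. u x * partial i (partial i v) x))"
    by (intro sum.cong refl G_diff) (auto intro!: t)
  also have "\<dots> = (\<Sum>i\<in>UNIV. G (\<lambda>x. partial i u x * partial i v x))"
    unfolding * by (subst G_add) (auto intro!: t simp: mult.commute)
  finally show ?thesis .
qed

text \<open>The commutator of \<open>ou\<close> with a partial derivative is that derivative; it is the source of the
  curvature term in Bochner's identity.\<close>

lemma partial_ou:
  assumes u: "polynomial u"
  shows "partial j (ou u) x = ou (partial j u) x + partial j u x"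
proof -
  have su: "smooth (partial i u)" "smooth (partial i (partial k u))" for i k
    by (intro smooth_polynomial polynomial_partial u)+
  have sm: "smooth (\<lambda>x. x $ i * partial i u x)" for i
    by (intro smooth_mult su smooth_polynomial polynomial_coord)
  have trm: "GDERIV (\<lambda>x. x $ i * partial i u x - partial i (partial i u) x) x :>
     (\<chi> j. partial j (\<lambda>x. x $ i * partial i u x - partial i (partial i u) x) x)" for i
    by (intro differentiable_eq_GDERIV_partial smooth_differentiable smooth_diff sm su)
  have "((\<lambda>x. \<Sum>i\<in>UNIV. x $ i * partial i u x - partial i (partial i u) x) has_derivative
     (\<lambda>h. \<Sum>i\<in>UNIV. h \<bullet> (\<chi> j. partial j (\<lambda>x. x $ i * partial i u x - partial i (partial i u) x) x))) (at x)"
    using trm unfolding gderiv_def by (intro has_derivative_sum) auto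
  then have "GDERIV (ou u) x :> (\<Sum>i\<in>UNIV. (\<chi> j. partial j (\<lambda>x. x $ i * partial i u x - partial i (partial i u) x) x))"
    unfolding gderiv_def ou_def[abs_def] by (simp add: inner_sum_right)
  from partial_eq_GDERIV[OF this]
  have "partial j (ou u) x = (\<Sum>i\<in>UNIV. partial j (\<lambda>x. x $ i * partial i u x - partial i (partial i u) x) x)"
    by simp
  also have "\<dots> = (\<Sum>i\<in>UNIV. (x $ i * partial i (partial j u) x - partial i (partial i (partial j u)) x) + \<delta> i j * partial i u x)"
  proof (rule sum.cong[OF refl])
    fix i
    have "partial j (partial i (partial i u)) = partial i (partial i (partial j u))"
      using partial_commute[OF u, of j i] partial_commute[OF polynomial_partial[OF u, of i], of j i] by simp
    then show "partial j (\<lambda>x. x $ i * partial i u x - partial i (partial i u) x) x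
      = (x $ i * partial i (partial j u) x - partial i (partial i (partial j u)) x) + \<delta> i j * partial i u x"
      using partial_commute[OF u, of j i]
      by (simp add: partial_diff_smooth[OF sm su(2)] partial_coord_mult[OF su(1)])
  qed
  also have "\<dots> = ou (partial j u) x + partial j u x"
    by (simp only: sum.distrib sum_delta_left) (simp add: ou_def)
  finally show ?thesis .
qed

definition dirichlet :: "(real^'n \<Rightarrow> real) \<Rightarrow> real" where
  "dirichlet u = (\<Sum>i\<in>UNIV. G (\<lambda>x. (partial i u x)\<^sup>2))"

lemma bochner_identity:
  assumes u: "polynomial u"
  shows "G (\<lambda>x. (ou u x)\<^sup>2) = (\<Sum>j\<in>UNIV. dirichlet (partial j u)) + dirichlet u"
proof -
  note t = tempered_polynomial polynomial_intros polynomial_partial polynomial_ou u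
  have "G (\<lambda>x. (ou u x)\<^sup>2) = (\<Sum>j\<in>UNIV. G (\<lambda>x. partial j (ou u) x * partial j u x))"
    using G_ou[OF polynomial_ou[OF u] u] by (simp add: power2_eq_square)
  also have "\<dots> = (\<Sum>j\<in>UNIV. G (\<lambda>x. partial j u x * ou (partial j u) x + (partial j u x)\<^sup>2))"
    by (simp add: partial_ou[OF u] power2_eq_square algebra_simps)
  also have "\<dots> = (\<Sum>j\<in>UNIV. G (\<lambda>x. partial j u x * ou (partial j u) x) + G (\<lambda>x. (partial j u x)\<^sup>2))"
    by (intro sum.cong refl G_add) (auto intro!: t)
  also have "\<dots> = (\<Sum>j\<in>UNIV. dirichlet (partial j u) + G (\<lambda>x. (partial j u x)\<^sup>2))"
    using G_ou[OF polynomial_partial[OF u] polynomial_partial[OF u]] by (simp add: dirichlet_def power2_eq_square)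
  finally show ?thesis by (simp add: sum.distrib dirichlet_def[of u])
qed

text \<open>Duality: write \<open>v = ou w\<close>, integrate by parts, and bound the energy of \<open>w\<close> by Bochner's identity with
  the Hessian term dropped.\<close>

lemma poincare_polynomial:
  assumes v: "polynomial v" and v0: "G v = 0"
  shows "G (\<lambda>x. (v x)\<^sup>2) \<le> dirichlet v"
proof -
  obtain k where "poly_below k v" using v polynomial_def by blast
  then obtain w c where w: "polynomial w" and vw: "v = (\<lambda>x. ou w x + c)" using ou_surjective by blast
  note t = tempered_polynomial polynomial_intros polynomial_partial polynomial_ou v w
  have "G v = G (\<lambda>x. 1 * ou w x) + c * G (\<lambda>_. 1)"
    unfolding vw G_cmult[symmetric] by (subst G_add[symmetric]) (auto intro!: t)
  moreover have "G (\<lambda>x. 1 * ou w x) = 0"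
    unfolding G_ou[OF polynomial_const w] by (simp add: partial_const G_def)
  ultimately have c: "c = 0" using v0 G_one_pos by simp
  have "G (\<lambda>x. (v x)\<^sup>2) = G (\<lambda>x. v x * ou w x)"
    using vw c by (simp add: power2_eq_square)
  also have "\<dots> = (\<Sum>i\<in>UNIV. G (\<lambda>x. partial i v x * partial i w x))" by (rule G_ou[OF v w])
  also have "\<dots> \<le> (\<Sum>i\<in>UNIV. G (\<lambda>x. (1/2) * ((partial i v x)\<^sup>2 + (partial i w x)\<^sup>2)))"
  proof (intro sum_mono G_mono)
    fix i x
    show "partial i v x * partial i w x \<le> (1/2) * ((partial i v x)\<^sup>2 + (partial i w x)\<^sup>2)"
      using zero_le_power2[of "partial i v x - partial i w x"] by (simp add: power2_diff)
  qed (intro t UNIV_I; simp)+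
  also have "\<dots> = (1/2) * (dirichlet v + dirichlet w)"
  proof -
    have "G (\<lambda>x. (1/2) * ((partial i v x)\<^sup>2 + (partial i w x)\<^sup>2))
        = (1/2) * (G (\<lambda>x. (partial i v x)\<^sup>2) + G (\<lambda>x. (partial i w x)\<^sup>2))" for i
      unfolding G_cmult by (subst G_add) (auto intro!: t)
    then show ?thesis by (simp only: dirichlet_def sum_distrib_left[symmetric] sum.distrib)
  qed
  finally have "G (\<lambda>x. (v x)\<^sup>2) \<le> (1/2) * (dirichlet v + dirichlet w)" .
  moreover have "dirichlet w \<le> G (\<lambda>x. (v x)\<^sup>2)"
  proof -
    have "0 \<le> (\<Sum>j\<in>UNIV. dirichlet (partial j w))"
      unfolding dirichlet_def by (intro sum_nonneg G_nonneg) simp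
    then show ?thesis using bochner_identity[OF w] vw c by simp
  qed
  ultimately show ?thesis by argo
qed

text \<open>The orthogonality says that the partial derivatives of \<open>u\<close> have mean zero. Applying the Poincare
  inequality to them shows that the Hessian term in Bochner's identity is at least the energy.\<close>

lemma second_order_poincare_polynomial:
  assumes u: "polynomial u" and orth: "\<And>i. G (\<lambda>x. x $ i * ou u x) = 0"
  shows "2 * dirichlet u \<le> G (\<lambda>x. (ou u x)\<^sup>2)"
proof -
  have "G (partial j u) = 0" for j
  proof -
    have "0 = (\<Sum>i\<in>UNIV. G (\<lambda>x. partial i (\<lambda>x. x $ j) x * partial i u x))"
      using orth[of j] G_ou[OF polynomial_coord u, of j] by simp
    also have "\<dots> = (\<Sum>i\<in>UNIV. G (\<lambda>x. \<delta> j i * partial i u x))" by (simp only: partial_coord)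
    also have "\<dots> = G (partial j u)" unfolding G_cmult sum_delta_left by simp
    finally show ?thesis by simp
  qed
  then have "G (\<lambda>x. (partial j u x)\<^sup>2) \<le> dirichlet (partial j u)" for j
    by (intro poincare_polynomial polynomial_partial u)
  then have "dirichlet u \<le> (\<Sum>j\<in>UNIV. dirichlet (partial j u))"
    unfolding dirichlet_def[of u] by (rule sum_mono)
  then show ?thesis using bochner_identity[OF u] by simp
qed

end

section \<open>Density of the polynomials\<close>

context gaussian begin

definition L2 :: "(real^'n \<Rightarrow> real) \<Rightarrow> bool" where
  "L2 f \<longleftrightarrow> f \<in> borel_measurable borel \<and> integrable lborel (\<lambda>x. (f x)\<^sup>2 * rho x)"

lemma L2_measurable: "L2 f \<Longrightarrow> f \<in> borel_measurable borel" by (simp add: L2_def)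

lemma L2_tempered: "tempered f \<Longrightarrow> L2 f"
  using tempered_integrable[OF tempered_power] by (simp add: L2_def tempered_measurable)

lemma L2_bound:
  assumes "L2 B" "f \<in> borel_measurable borel" "\<And>x. \<bar>f x\<bar> \<le> \<bar>B x\<bar>"
  shows "L2 f"
proof -
  have "integrable lborel (\<lambda>x. (f x)\<^sup>2 * rho x)"
  proof (rule Bochner_Integration.integrable_bound[where f="\<lambda>x. (B x)\<^sup>2 * rho x"])
    show "integrable lborel (\<lambda>x. (B x)\<^sup>2 * rho x)" using assms(1) by (simp add: L2_def)
    show "(\<lambda>x. (f x)\<^sup>2 * rho x) \<in> borel_measurable lborel" using assms(2) by simp
    show "AE x in lborel. norm ((f x)\<^sup>2 * rho x) \<le> norm ((B x)\<^sup>2 * rho x)"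
      using assms(3) rho_pos by (simp add: abs_mult mult_right_mono abs_le_square_iff less_imp_le)
  qed
  then show ?thesis using assms(2) by (simp add: L2_def)
qed

lemma L2_cmult: "L2 f \<Longrightarrow> L2 (\<lambda>x. c * f x)"
  by (auto simp: L2_def power_mult_distrib mult.assoc)

lemma L2_mult_integrable:
  assumes "L2 f" "L2 g" shows "integrable lborel (\<lambda>x. (f x * g x) * rho x)"
proof (rule Bochner_Integration.integrable_bound[where f="\<lambda>x. (f x)\<^sup>2 * rho x + (g x)\<^sup>2 * rho x"])
  show "integrable lborel (\<lambda>x. (f x)\<^sup>2 * rho x + (g x)\<^sup>2 * rho x)" using assms by (simp add: L2_def)
  show "(\<lambda>x. (f x * g x) * rho x) \<in> borel_measurable lborel" using assms by (auto simp: L2_def)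
  have "\<bar>f x * g x\<bar> \<le> (f x)\<^sup>2 + (g x)\<^sup>2" for x
    using zero_le_power2[of "\<bar>f x\<bar> - \<bar>g x\<bar>"] zero_le_power2[of "f x"] zero_le_power2[of "g x"]
    unfolding abs_mult power2_diff power2_abs by linarith
  then show "AE x in lborel. norm ((f x * g x) * rho x) \<le> norm ((f x)\<^sup>2 * rho x + (g x)\<^sup>2 * rho x)"
    using rho_pos by (simp add: abs_mult distrib_right[symmetric] mult_right_mono less_imp_le)
qed

lemma L2_add:
  assumes "L2 f" "L2 g" shows "L2 (\<lambda>x. f x + g x)"
proof -
  have "integrable lborel (\<lambda>x. (f x)\<^sup>2 * rho x + (g x)\<^sup>2 * rho x + 2 * ((f x * g x) * rho x))"
    using assms L2_mult_integrable[OF assms] by (simp add: L2_def)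
  moreover have "(\<lambda>x. (f x)\<^sup>2 * rho x + (g x)\<^sup>2 * rho x + 2 * ((f x * g x) * rho x)) = (\<lambda>x. (f x + g x)\<^sup>2 * rho x)"
    by (auto simp: fun_eq_iff power2_sum algebra_simps)
  ultimately show ?thesis using assms by (auto simp: L2_def)
qed

lemma L2_diff: "L2 f \<Longrightarrow> L2 g \<Longrightarrow> L2 (\<lambda>x. f x - g x)"
  using L2_add[OF _ L2_cmult[of g "-1"]] by simp

lemma L2_dist_triangle:
  assumes "L2 f" "L2 g" "L2 h"
  shows "G (\<lambda>x. (f x - h x)\<^sup>2) \<le> 2 * G (\<lambda>x. (f x - g x)\<^sup>2) + 2 * G (\<lambda>x. (g x - h x)\<^sup>2)"
proof -
  have i: "integrable lborel (\<lambda>x. (f x - g x)\<^sup>2 * rho x)" "integrable lborel (\<lambda>x. (g x - h x)\<^sup>2 * rho x)"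
    "integrable lborel (\<lambda>x. (f x - h x)\<^sup>2 * rho x)"
    using L2_diff assms unfolding L2_def by blast+
  have "G (\<lambda>x. (f x - h x)\<^sup>2) \<le> (LINT x|lborel. 2 * ((f x - g x)\<^sup>2 * rho x) + 2 * ((g x - h x)\<^sup>2 * rho x))"
    unfolding G_def
  proof (rule integral_mono)
    fix x
    have "(f x - h x)\<^sup>2 \<le> 2 * (f x - g x)\<^sup>2 + 2 * (g x - h x)\<^sup>2"
      using zero_le_power2[of "(f x - g x) - (g x - h x)"] by (simp add: power2_eq_square algebra_simps)
    then have "(f x - h x)\<^sup>2 * rho x \<le> (2 * (f x - g x)\<^sup>2 + 2 * (g x - h x)\<^sup>2) * rho x"
      using rho_pos[of x] by (intro mult_right_mono) auto
    then show "(f x - h x)\<^sup>2 * rho x \<le> 2 * ((f x - g x)\<^sup>2 * rho x) + 2 * ((g x - h x)\<^sup>2 * rho x)"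
      by (simp add: algebra_simps)
  qed (use i in auto)
  also have "\<dots> = 2 * G (\<lambda>x. (f x - g x)\<^sup>2) + 2 * G (\<lambda>x. (g x - h x)\<^sup>2)"
    using i by (simp add: G_def)
  finally show ?thesis .
qed

definition poly_closure :: "(real^'n \<Rightarrow> real) \<Rightarrow> bool" where
  "poly_closure f \<longleftrightarrow> L2 f \<and> (\<forall>e>0. \<exists>p. polynomial p \<and> G (\<lambda>x. (f x - p x)\<^sup>2) < e)"

lemma poly_closure_L2: "poly_closure f \<Longrightarrow> L2 f" by (simp add: poly_closure_def)

lemma poly_closure_polynomial: "polynomial p \<Longrightarrow> poly_closure p"
  unfolding poly_closure_def by (auto intro!: L2_tempered tempered_polynomial exI[of _ p] simp: G_def)

lemma poly_closure_closed:
  assumes f: "L2 f" and a: "\<And>e. e > 0 \<Longrightarrow> \<exists>g. poly_closure g \<and> G (\<lambda>x. (f x - g x)\<^sup>2) < e"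
  shows "poly_closure f"
  unfolding poly_closure_def
proof (intro conjI allI impI f)
  fix e :: real assume e: "e > 0"
  obtain g where g: "poly_closure g" "G (\<lambda>x. (f x - g x)\<^sup>2) < e / 4" using a[of "e/4"] e by auto
  obtain p where p: "polynomial p" "G (\<lambda>x. (g x - p x)\<^sup>2) < e / 4"
    using g(1) e unfolding poly_closure_def by (meson divide_pos_pos zero_less_numeral)
  have "G (\<lambda>x. (f x - p x)\<^sup>2) < e"
    using L2_dist_triangle[OF f poly_closure_L2[OF g(1)] L2_tempered[OF tempered_polynomial[OF p(1)]]] g(2) p(2) by linarith
  then show "\<exists>p. polynomial p \<and> G (\<lambda>x. (f x - p x)\<^sup>2) < e" using p(1) by blast
qed

text \<open>Dominated convergence in \<open>L\<^sup>2\<close>.\<close>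

lemma poly_closure_limit:
  assumes g: "\<And>n. poly_closure (g n)" and lim: "\<And>x. (\<lambda>n. g n x) \<longlonglongrightarrow> f x"
    and B: "L2 B" "\<And>n x. \<bar>g n x\<bar> \<le> B x"
  shows "poly_closure f"
proof (rule poly_closure_closed)
  have gm: "g n \<in> borel_measurable borel" for n using g poly_closure_L2 L2_measurable by blast
  have fm: "f \<in> borel_measurable borel"
    by (rule borel_measurable_LIMSEQ_real[where u=g]) (use lim gm in auto)
  have fB: "\<bar>f x\<bar> \<le> B x" for x
    by (rule LIMSEQ_le_const2[OF tendsto_rabs[OF lim]]) (use B(2) in auto)
  have "\<bar>f x\<bar> \<le> \<bar>B x\<bar>" for x using fB[of x] by linarith
  then show L2f: "L2 f" by (rule L2_bound[OF B(1) fm])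
  have "(\<lambda>n. LINT x|lborel. (f x - g n x)\<^sup>2 * rho x) \<longlonglongrightarrow> (LINT x|(lborel :: (real^'n) measure). (0::real))"
  proof (rule integral_dominated_convergence[where w="\<lambda>x. 4 * ((B x)\<^sup>2 * rho x)"])
    show "integrable lborel (\<lambda>x. 4 * ((B x)\<^sup>2 * rho x))" using B(1) by (simp add: L2_def)
    show "(\<lambda>x. (f x - g n x)\<^sup>2 * rho x) \<in> borel_measurable lborel" for n using fm gm by simp
    have "(\<lambda>n. (f x - g n x)\<^sup>2 * rho x) \<longlonglongrightarrow> (f x - f x)\<^sup>2 * rho x" for x
      by (intro tendsto_intros lim)
    then show "AE x in lborel. (\<lambda>n. (f x - g n x)\<^sup>2 * rho x) \<longlonglongrightarrow> 0" by simp
    fix n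
    have "norm ((f x - g n x)\<^sup>2 * rho x) \<le> 4 * ((B x)\<^sup>2 * rho x)" for x
    proof -
      have "\<bar>f x - g n x\<bar> \<le> 2 * B x" using fB[of x] B(2)[of n x] by linarith
      then have "\<bar>f x - g n x\<bar>\<^sup>2 \<le> (2 * B x)\<^sup>2" by (intro power_mono) auto
      then have "(f x - g n x)\<^sup>2 \<le> 4 * (B x)\<^sup>2" by (simp add: power_mult_distrib)
      then have "(f x - g n x)\<^sup>2 * rho x \<le> (4 * (B x)\<^sup>2) * rho x"
        using rho_pos[of x] by (intro mult_right_mono) auto
      then show ?thesis using rho_pos[of x] by (simp add: abs_mult)
    qed
    then show "AE x in lborel. norm ((f x - g n x)\<^sup>2 * rho x) \<le> 4 * ((B x)\<^sup>2 * rho x)" by simp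
  qed simp_all
  then have "(\<lambda>n. G (\<lambda>x. (f x - g n x)\<^sup>2)) \<longlonglongrightarrow> 0" by (simp add: G_def)
  from order_tendstoD(2)[OF this]
  show "\<exists>h. poly_closure h \<and> G (\<lambda>x. (f x - h x)\<^sup>2) < e" if "e > 0" for e
    using that g unfolding eventually_sequentially by (meson order_refl)
qed

lemma poly_closure_add:
  assumes "poly_closure f" "poly_closure g" shows "poly_closure (\<lambda>x. f x + g x)"
  unfolding poly_closure_def
proof (intro conjI allI impI)
  show L: "L2 (\<lambda>x. f x + g x)" using assms by (intro L2_add poly_closure_L2)
  fix e :: real assume "e > 0"
  then have "e / 4 > 0" by simp
  then obtain p r where p: "polynomial p" "G (\<lambda>x. (f x - p x)\<^sup>2) < e / 4"
    and r: "polynomial r" "G (\<lambda>x. (g x - r x)\<^sup>2) < e / 4"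
    using assms unfolding poly_closure_def by meson
  have Lp: "L2 p" "L2 r" using p(1) r(1) by (auto intro: L2_tempered tempered_polynomial)
  have "G (\<lambda>x. ((f x + g x) - (p x + r x))\<^sup>2)
      \<le> 2 * G (\<lambda>x. ((f x + g x) - (p x + g x))\<^sup>2) + 2 * G (\<lambda>x. ((p x + g x) - (p x + r x))\<^sup>2)"
    using assms Lp by (intro L2_dist_triangle L2_add) (auto intro: poly_closure_L2)
  also have "\<dots> < e" using p(2) r(2) by (simp add: add_diff_cancel_left add_diff_cancel_right)
  finally show "\<exists>p. polynomial p \<and> G (\<lambda>x. ((f x + g x) - p x)\<^sup>2) < e"
    using polynomial_add[OF p(1) r(1)] by (intro exI[of _ "\<lambda>x. p x + r x"]) simp
qed

text \<open>Bounded functions that map the polynomials into their closure. In contrast to the bounded elements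
  of the closure itself, they form an algebra by their definition, and they are closed under bounded pointwise
  limits. It is enough to find sufficiently many of them.\<close>

definition multiplier :: "(real^'n \<Rightarrow> real) \<Rightarrow> bool" where
  "multiplier g \<longleftrightarrow> g \<in> borel_measurable borel \<and> (\<exists>C. \<forall>x. \<bar>g x\<bar> \<le> C) \<and> (\<forall>p. polynomial p \<longrightarrow> poly_closure (\<lambda>x. g x * p x))"

lemma multiplierD: "multiplier g \<Longrightarrow> polynomial p \<Longrightarrow> poly_closure (\<lambda>x. g x * p x)"
  by (simp add: multiplier_def)

lemma multiplier_measurable: "multiplier g \<Longrightarrow> g \<in> borel_measurable borel"
  by (simp add: multiplier_def)

lemma multiplier_const: "multiplier (\<lambda>_. c)"
  by (auto simp: multiplier_def intro!: exI[of _ "\<bar>c\<bar>"] poly_closure_polynomial polynomial_cmult)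

lemma multiplier_add: 
  assumes "multiplier f" "multiplier g" shows "multiplier (\<lambda>x. f x + g x)"
proof -
  obtain C D where "\<And>x. \<bar>f x\<bar> \<le> C" "\<And>x. \<bar>g x\<bar> \<le> D" using assms unfolding multiplier_def by metis
  then have "\<bar>f x + g x\<bar> \<le> C + D" for x using abs_triangle_ineq[of "f x" "g x"] by (meson add_mono order_trans)
  moreover have "poly_closure (\<lambda>x. (f x + g x) * p x)" if "polynomial p" for p
    using poly_closure_add[OF multiplierD[OF assms(1) that] multiplierD[OF assms(2) that]] by (simp add: distrib_right)
  ultimately show ?thesis using assms by (auto simp: multiplier_def)
qed

text \<open>Approximate \<open>g p\<close> by a polynomial; multiplying by the bounded function \<open>f\<close> keeps the error small.\<close>

lemma multiplier_mult:
  assumes "multiplier f" "multiplier g" shows "multiplier (\<lambda>x. f x * g x)"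
proof -
  obtain C D where CD: "\<And>x. \<bar>f x\<bar> \<le> C" "\<And>x. \<bar>g x\<bar> \<le> D" using assms unfolding multiplier_def by metis
  then have "\<bar>f x * g x\<bar> \<le> C * D" for x
    unfolding abs_mult by (meson abs_ge_zero mult_mono order_trans)
  moreover have "poly_closure (\<lambda>x. (f x * g x) * p x)" if p: "polynomial p" for p
  proof (rule poly_closure_closed)
    have fm: "f \<in> borel_measurable borel" using assms(1) by (simp add: multiplier_def)
    have fL: "L2 (\<lambda>x. f x * h x)" if "L2 h" for h
    proof (rule L2_bound[OF L2_cmult[OF that, of C]])
      show "(\<lambda>x. f x * h x) \<in> borel_measurable borel" using fm L2_measurable[OF that] by simp
      have "\<bar>f x\<bar> \<le> \<bar>C\<bar>" for x using CD(1)[of x] by linarith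
      then show "\<bar>f x * h x\<bar> \<le> \<bar>C * h x\<bar>" for x unfolding abs_mult by (intro mult_right_mono) auto
    qed
    have gp: "poly_closure (\<lambda>x. g x * p x)" by (rule multiplierD[OF assms(2) p])
    show L: "L2 (\<lambda>x. f x * g x * p x)"
      using fL[OF poly_closure_L2[OF gp]] by (simp add: mult.assoc)
    fix e :: real assume e: "e > 0"
    have "e / (C\<^sup>2 + 1) > 0" using e by (simp add: add_nonneg_pos)
    then obtain r where r: "polynomial r" "G (\<lambda>x. (g x * p x - r x)\<^sup>2) < e / (C\<^sup>2 + 1)"
      using gp unfolding poly_closure_def by blast
    have Lr: "L2 (\<lambda>x. g x * p x - r x)"
      by (intro L2_diff poly_closure_L2[OF gp] L2_tempered tempered_polynomial r)
    have "G (\<lambda>x. (f x * g x * p x - f x * r x)\<^sup>2) \<le> G (\<lambda>x. C\<^sup>2 * (g x * p x - r x)\<^sup>2)"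
      unfolding G_def
    proof (rule integral_mono)
      show "integrable lborel (\<lambda>x. (f x * g x * p x - f x * r x)\<^sup>2 * rho x)"
        using fL[OF Lr] by (simp add: L2_def right_diff_distrib mult.assoc)
      show "integrable lborel (\<lambda>x. C\<^sup>2 * (g x * p x - r x)\<^sup>2 * rho x)"
        using Lr by (simp add: L2_def mult.assoc)
      fix x
      have "(f x)\<^sup>2 \<le> C\<^sup>2" using CD(1)[of x] by (metis abs_ge_zero power2_abs power_mono)
      then have "(f x)\<^sup>2 * ((g x * p x - r x)\<^sup>2 * rho x) \<le> C\<^sup>2 * ((g x * p x - r x)\<^sup>2 * rho x)"
        using rho_pos[of x] by (intro mult_right_mono) auto
      moreover have "f x * g x * p x - f x * r x = f x * (g x * p x - r x)" by (simp add: algebra_simps)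
      ultimately show "(f x * g x * p x - f x * r x)\<^sup>2 * rho x \<le> C\<^sup>2 * (g x * p x - r x)\<^sup>2 * rho x"
        by (simp only: power_mult_distrib mult.assoc)
    qed
    also have "\<dots> = C\<^sup>2 * G (\<lambda>x. (g x * p x - r x)\<^sup>2)" by (rule G_cmult)
    also have "\<dots> \<le> (C\<^sup>2 + 1) * G (\<lambda>x. (g x * p x - r x)\<^sup>2)"
      by (intro mult_right_mono G_nonneg) auto
    also have "\<dots> < e"
    proof -
      have "(0::real) < C\<^sup>2 + 1" by (simp add: add_nonneg_pos)
      from pos_less_divide_eq[OF this, THEN iffD1, OF r(2)] show ?thesis by (simp add: mult.commute)
    qed
    finally show "\<exists>h. poly_closure h \<and> G (\<lambda>x. (f x * g x * p x - h x)\<^sup>2) < e"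
      using multiplierD[OF assms(1) r(1)] by blast
  qed
  ultimately show ?thesis using assms by (auto simp: multiplier_def)
qed

lemma multiplier_limit:
  assumes g: "\<And>n. multiplier (g n)" and lim: "\<And>x. (\<lambda>n. g n x) \<longlonglongrightarrow> f x" and C: "\<And>n x. \<bar>g n x\<bar> \<le> C"
  shows "multiplier f"
  unfolding multiplier_def
proof (intro conjI allI impI exI)
  show "f \<in> borel_measurable borel"
    by (rule borel_measurable_LIMSEQ_real[where u=g]) (use lim multiplier_measurable[OF g] in auto)
  show "\<bar>f x\<bar> \<le> C" for x
    by (rule LIMSEQ_le_const2[OF tendsto_rabs[OF lim]]) (use C in auto)
  fix p :: "real^'n \<Rightarrow> real" assume p: "polynomial p"
  show "poly_closure (\<lambda>x. f x * p x)"
  proof (rule poly_closure_limit)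
    show "poly_closure (\<lambda>x. g n x * p x)" for n by (rule multiplierD[OF g p])
    show "(\<lambda>n. g n x * p x) \<longlonglongrightarrow> f x * p x" for x by (intro tendsto_intros lim)
    have Lp: "L2 p" by (intro L2_tempered tempered_polynomial p)
    then show "L2 (\<lambda>x. C * \<bar>p x\<bar>)"
      by (intro L2_cmult L2_bound[OF Lp]) (auto dest: L2_measurable)
    show "\<bar>g n x * p x\<bar> \<le> C * \<bar>p x\<bar>" for n x
      unfolding abs_mult by (intro mult_right_mono C) auto
  qed
qed

lemma multiplier_sum: "finite A \<Longrightarrow> (\<And>j. j \<in> A \<Longrightarrow> multiplier (f j)) \<Longrightarrow> multiplier (\<lambda>x. \<Sum>j\<in>A. f j x)"
  by (induction A rule: finite_induct) (auto intro: multiplier_const multiplier_add)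

lemma multiplier_prod: "finite A \<Longrightarrow> (\<And>j. j \<in> A \<Longrightarrow> multiplier (f j)) \<Longrightarrow> multiplier (\<lambda>x. \<Prod>j\<in>A. f j x)"
  by (induction A rule: finite_induct) (auto intro: multiplier_const multiplier_mult)

lemma multiplier_power: "multiplier f \<Longrightarrow> multiplier (\<lambda>x. f x ^ k)"
  by (induction k) (auto intro: multiplier_const multiplier_mult)

lemma multiplier_diff: "multiplier f \<Longrightarrow> multiplier g \<Longrightarrow> multiplier (\<lambda>x. f x - g x)"
  using multiplier_add[OF _ multiplier_mult[OF multiplier_const[of "-1"]], of f g] by simp

text \<open>Bernstein polynomials of \<open>\<phi>\<close> converge uniformly, and a polynomial in a multiplier is a multiplier.\<close>

lemma multiplier_continuous:
  assumes b: "multiplier b" "\<And>x. b x \<in> {0..1}" and \<phi>: "continuous_on {0..1} \<phi>"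
  shows "multiplier (\<lambda>x. \<phi> (b x))"
proof -
  obtain D where D: "\<And>t. t \<in> {0..1} \<Longrightarrow> \<bar>\<phi> t\<bar> \<le> D"
  proof -
    obtain D where "\<forall>y\<in>\<phi> ` {0..1}. norm y \<le> D"
      using compact_imp_bounded[OF compact_continuous_image[OF \<phi> compact_Icc]] unfolding bounded_iff by blast
    then have "\<bar>\<phi> t\<bar> \<le> D" if "t \<in> {0..1}" for t using that by simp
    then show ?thesis by (rule that)
  qed
  define P where "P n t = (\<Sum>k\<le>n. \<phi> (real k / real n) * Bernstein n k t)" for n t
  have conv: "\<exists>N. \<forall>n t. N \<le> n \<and> t \<in> {0..1} \<longrightarrow> \<bar>\<phi> t - P n t\<bar> < e" if "e > 0" for e
    using Bernstein_Weierstrass[OF \<phi> that] unfolding P_def by blast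
  obtain N where N: "\<And>n t. N \<le> n \<Longrightarrow> t \<in> {0..1} \<Longrightarrow> \<bar>\<phi> t - P n t\<bar> < 1" using conv[of 1] by auto
  show ?thesis
  proof (rule multiplier_limit)
    show "multiplier (\<lambda>x. P (n + N) (b x))" for n
      unfolding P_def Bernstein_def
      by (intro multiplier_sum multiplier_mult multiplier_power multiplier_diff multiplier_const b) auto
    show "(\<lambda>n. P (n + N) (b x)) \<longlonglongrightarrow> \<phi> (b x)" for x
    proof (rule LIMSEQ_ignore_initial_segment, rule metric_LIMSEQ_I)
      fix e :: real assume "e > 0"
      then show "\<exists>no. \<forall>n\<ge>no. dist (P n (b x)) (\<phi> (b x)) < e"
        using conv[of e] b(2)[of x] by (auto simp: dist_real_def abs_minus_commute)
    qed
    show "\<bar>P (n + N) (b x)\<bar> \<le> D + 1" for n x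
      using N[of "n + N" "b x"] D[of "b x"] b(2)[of x] by fastforce
  qed
qed

text \<open>The indicator is the pointwise limit of steep continuous ramps.\<close>

lemma multiplier_superlevel:
  assumes b: "multiplier b" "\<And>x. b x \<in> {0..1}"
  shows "multiplier (indicator {x. b x > 1 / 2})"
proof -
  define \<phi> where "\<phi> m t = min 1 (max 0 (real m * (t - 1 / 2)))" for m t
  show ?thesis
  proof (rule multiplier_limit)
    show "multiplier (\<lambda>x. \<phi> m (b x))" for m
      by (rule multiplier_continuous[OF b]) (auto simp: \<phi>_def intro!: continuous_intros)
    show "(\<lambda>m. \<phi> m (b x)) \<longlonglongrightarrow> indicator {x. b x > 1 / 2} x" for x
    proof (cases "b x > 1 / 2")
      case True
      obtain N :: nat where N: "1 / (b x - 1 / 2) \<le> real N" using real_arch_simple by blast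
      have "\<phi> m (b x) = 1" if "m \<ge> N" for m
      proof -
        have "1 / (b x - 1 / 2) \<le> real m" using N that by (meson of_nat_mono order_trans)
        then have "1 \<le> real m * (b x - 1 / 2)" using True by (simp add: pos_divide_le_eq)
        then show ?thesis by (simp add: \<phi>_def)
      qed
      then have "\<forall>\<^sub>F m in sequentially. \<phi> m (b x) = 1" unfolding eventually_sequentially by blast
      then show ?thesis using True by (simp add: tendsto_eventually)
    next
      case False
      then have "real m * (b x - 1 / 2) \<le> 0" for m by (intro mult_nonneg_nonpos) auto
      then have "\<phi> m (b x) = 0" for m by (simp add: \<phi>_def max_absorb1)
      then show ?thesis using False by simp
    qed
    show "\<bar>\<phi> m (b x)\<bar> \<le> 1" for m x by (auto simp: \<phi>_def)
  qed
qed

end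

context gaussian begin

text \<open>The majorant for the Taylor polynomials of the exponential multiplier below.\<close>

lemma exp_quarter_integrable:
  assumes "tempered F" shows "integrable lborel (\<lambda>x::real^'n. F x * exp (- ((x \<bullet> x) / 4)))"
proof -
  interpret Q: rapid_weight "\<lambda>x::real^'n. (x \<bullet> x) / 4" "\<lambda>x. (2 / 4) *\<^sub>R x" 1
    by (rule gaussian_weight) simp_all
  show ?thesis using Q.tempered_integrable[OF assms] by (simp add: Q.rho_def)
qed

lemma component_square_le: "(x $ i)\<^sup>2 \<le> x \<bullet> x" for x :: "real^'n"
  using component_le_norm_cart[of x i] by (metis abs_ge_zero power2_abs power2_norm_eq_inner power_mono)

text \<open>The partial sums of the exponential series are polynomials bounded by \<open>exp (x\<^sub>i\<^sup>2 / 8)\<close>, whose square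
  is still integrable for the Gaussian measure. This is why the exponent must be small.\<close>

lemma multiplier_exp: "multiplier (\<lambda>x. exp (- ((x $ i)\<^sup>2 / 8)))"
  unfolding multiplier_def
proof (intro conjI allI impI exI)
  show "(\<lambda>x::real^'n. exp (- ((x $ i)\<^sup>2 / 8))) \<in> borel_measurable borel"
    by (intro borel_measurable_continuous_onI continuous_intros continuous_on_nth) simp
  show "\<bar>exp (- ((x $ i)\<^sup>2 / 8))\<bar> \<le> 1" for x :: "real^'n" by simp
  fix p :: "real^'n \<Rightarrow> real" assume p: "polynomial p"
  define S where "S N x = (\<Sum>n<N. (- ((x $ i)\<^sup>2 / 8)) ^ n / fact n)" for N and x :: "real^'n"
  show "poly_closure (\<lambda>x. exp (- ((x $ i)\<^sup>2 / 8)) * p x)"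
  proof (rule poly_closure_limit)
    show "poly_closure (\<lambda>x. S N x * p x)" for N
    proof -
      have "S N = (\<lambda>x. \<Sum>n<N. ((- 1 / 8) ^ n / fact n) * ((x $ i) ^ 2) ^ n)"
        unfolding S_def by (auto simp: fun_eq_iff power_mult_distrib[symmetric] intro!: sum.cong)
      then have "polynomial (S N)" by (simp only:) (intro polynomial_intros; simp)
      then show ?thesis by (intro poly_closure_polynomial polynomial_mult p)
    qed
    show "(\<lambda>N. S N x * p x) \<longlonglongrightarrow> exp (- ((x $ i)\<^sup>2 / 8)) * p x" for x
    proof (rule tendsto_mult_right)
      have "(\<lambda>n. (- ((x $ i)\<^sup>2 / 8)) ^ n /\<^sub>R fact n) sums exp (- ((x $ i)\<^sup>2 / 8))"
        by (rule exp_converges)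
      moreover have "S N x = (\<Sum>n<N. (- ((x $ i)\<^sup>2 / 8)) ^ n /\<^sub>R fact n)" for N
        unfolding S_def by (intro sum.cong refl) (simp only: divide_inverse_commute real_scaleR_def)
      ultimately show "(\<lambda>N. S N x) \<longlonglongrightarrow> exp (- ((x $ i)\<^sup>2 / 8))"
        unfolding sums_def by simp
    qed
    show "\<bar>S N x * p x\<bar> \<le> exp ((x $ i)\<^sup>2 / 8) * \<bar>p x\<bar>" for N x
      unfolding abs_mult
    proof (rule mult_right_mono)
      have "\<bar>S N x\<bar> \<le> (\<Sum>n<N. \<bar>(- ((x $ i)\<^sup>2 / 8)) ^ n / fact n\<bar>)"
        unfolding S_def by (rule sum_abs)
      also have "\<dots> = (\<Sum>n<N. ((x $ i)\<^sup>2 / 8) ^ n /\<^sub>R fact n)"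
      proof (intro sum.cong refl)
        have "\<bar>(- a) ^ n / fact n\<bar> = a ^ n /\<^sub>R fact n" if "0 \<le> a" for a :: real and n
          using that by (simp add: abs_mult power_abs divide_inverse)
        then show "\<bar>(- ((x $ i)\<^sup>2 / 8)) ^ n / fact n\<bar> = ((x $ i)\<^sup>2 / 8) ^ n /\<^sub>R fact n" for n
          by simp
      qed
      also have "\<dots> \<le> exp ((x $ i)\<^sup>2 / 8)"
        unfolding exp_def by (rule sum_le_suminf[OF summable_exp_generic]) auto
      finally show "\<bar>S N x\<bar> \<le> exp ((x $ i)\<^sup>2 / 8)" .
    qed simp
    have tp: "tempered (\<lambda>x. K * (p x)\<^sup>2)" by (intro tempered_intros tempered_polynomial p)
    have pm: "p \<in> borel_measurable borel" by (intro tempered_measurable tempered_polynomial p)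
    have em: "(\<lambda>x::real^'n. exp ((x $ i)\<^sup>2 / 8)) \<in> borel_measurable borel"
      by (intro borel_measurable_continuous_onI continuous_intros continuous_on_nth) simp
    have "integrable lborel (\<lambda>x. (exp ((x $ i)\<^sup>2 / 8) * \<bar>p x\<bar>)\<^sup>2 * rho x)"
    proof (rule Bochner_Integration.integrable_bound[OF exp_quarter_integrable[OF tp]])
      show "(\<lambda>x. (exp ((x $ i)\<^sup>2 / 8) * \<bar>p x\<bar>)\<^sup>2 * rho x) \<in> borel_measurable lborel"
        using pm em by simp
      have "(exp ((x $ i)\<^sup>2 / 8) * \<bar>p x\<bar>)\<^sup>2 * rho x \<le> (K * (p x)\<^sup>2) * exp (- ((x \<bullet> x) / 4))" for x
      proof -
        have "(exp ((x $ i)\<^sup>2 / 8))\<^sup>2 * exp (- ((x \<bullet> x) / 2)) = exp ((x $ i)\<^sup>2 / 4 - (x \<bullet> x) / 2)"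
          by (simp add: exp_double[symmetric] exp_add[symmetric])
        also have "\<dots> \<le> exp (- ((x \<bullet> x) / 4))" using component_square_le[of x i] by simp
        finally have "(K * (p x)\<^sup>2) * ((exp ((x $ i)\<^sup>2 / 8))\<^sup>2 * exp (- ((x \<bullet> x) / 2))) \<le> (K * (p x)\<^sup>2) * exp (- ((x \<bullet> x) / 4))"
          using K_pos by (intro mult_left_mono) auto
        then show ?thesis by (simp add: rho_def power_mult_distrib mult_ac)
      qed
      then show "AE x in lborel. norm ((exp ((x $ i)\<^sup>2 / 8) * \<bar>p x\<bar>)\<^sup>2 * rho x) \<le> norm ((K * (p x)\<^sup>2) * exp (- ((x \<bullet> x) / 4)))"
        using rho_pos K_pos by (simp add: abs_mult less_imp_le)
    qed
    then show "L2 (\<lambda>x. exp ((x $ i)\<^sup>2 / 8) * \<bar>p x\<bar>)"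
      unfolding L2_def using em pm by auto
  qed
qed

text \<open>The function \<open>(x\<^sub>i - t) exp (- x\<^sub>i\<^sup>2 / 8)\<close> is a bounded multiplier which is positive exactly on the
  half-space. An affine change brings its values into the unit interval and the threshold to \<open>1 / 2\<close>.\<close>

lemma multiplier_halfspace: "multiplier (indicator {x. t < x $ i})"
proof -
  define e where "e x = exp (- ((x $ i)\<^sup>2 / 8))" for x :: "real^'n"
  have me: "multiplier e" unfolding e_def[abs_def] by (rule multiplier_exp)
  have e01: "0 < e x" "e x \<le> 1" for x by (auto simp: e_def)
  have eb: "\<bar>x $ i * e x\<bar> \<le> 4" for x
  proof -
    have "\<bar>x $ i\<bar> \<le> 4 * (1 + (x $ i)\<^sup>2 / 8)"
      using zero_le_power2[of "\<bar>x $ i\<bar> - 1"] unfolding power2_diff by simp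
    also have "\<dots> \<le> 4 * exp ((x $ i)\<^sup>2 / 8)"
      by (intro mult_left_mono exp_ge_add_one_self) simp
    finally have "\<bar>x $ i\<bar> * e x \<le> 4 * exp ((x $ i)\<^sup>2 / 8) * e x" using e01(1)[of x] by (intro mult_right_mono) auto
    also have "\<dots> = 4" by (simp add: e_def mult.assoc exp_minus_inverse)
    finally show ?thesis using e01(1)[of x] by (simp add: abs_mult)
  qed
  have mxe: "multiplier (\<lambda>x. x $ i * e x)"
    unfolding multiplier_def
  proof (intro conjI allI impI exI)
    show "(\<lambda>x. x $ i * e x) \<in> borel_measurable borel"
      using multiplier_measurable[OF me] tempered_measurable[OF tempered_coord] by simp
    show "\<bar>x $ i * e x\<bar> \<le> 4" for x by (rule eb)
    show "poly_closure (\<lambda>x. x $ i * e x * p x)" if "polynomial p" for p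
      using multiplierD[OF me polynomial_coord_mult[OF that, of i]] by (simp add: mult_ac)
  qed
  define C where "C = 2 * (4 + \<bar>t\<bar>)"
  have C: "C > 0" by (simp add: C_def)
  define b where "b x = 1 / 2 + (1 / C) * (x $ i * e x - t * e x)" for x
  have mb: "multiplier b"
    unfolding b_def[abs_def] by (intro multiplier_add multiplier_diff multiplier_mult multiplier_const me mxe)
  have b01: "b x \<in> {0..1}" for x
  proof -
    have "\<bar>t * e x\<bar> \<le> \<bar>t\<bar>" using e01[of x] by (simp add: abs_mult mult_left_le)
    then have "\<bar>x $ i * e x - t * e x\<bar> \<le> C / 2"
      using eb[of x] abs_triangle_ineq4[of "x $ i * e x" "t * e x"] unfolding C_def by argo
    then have "\<bar>b x - 1 / 2\<bar> \<le> 1 / 2" using C by (simp add: b_def abs_mult divide_le_eq)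
    from this[unfolded abs_diff_le_iff] show ?thesis by simp
  qed
  have "b x > 1 / 2 \<longleftrightarrow> t < x $ i" for x
  proof -
    have "b x > 1 / 2 \<longleftrightarrow> 0 < (1 / C) * ((x $ i - t) * e x)" by (simp add: b_def left_diff_distrib)
    also have "\<dots> \<longleftrightarrow> t < x $ i" using C e01(1)[of x] by (simp add: zero_less_mult_iff zero_less_divide_iff)
    finally show ?thesis .
  qed
  then show ?thesis using multiplier_superlevel[OF mb b01] by simp
qed

text \<open>The sets whose indicators are multipliers form a \<open>\<sigma>\<close>-algebra, and half-spaces generate the Borel sets.\<close>

lemma multiplier_indicator_borel:
  assumes "A \<in> sets (borel :: (real^'n) measure)"
  shows "multiplier (indicator A)"
proof -
  let ?H = "(\<lambda>(a, i). {x::real^'n. a < x \<bullet> i}) ` (UNIV \<times> Basis)"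
  have "sets (borel :: (real^'n) measure) = sigma_sets UNIV ?H"
    by (subst borel_eq_halfspace_greater) (rule sets_measure_of, simp)
  with assms have "A \<in> sigma_sets UNIV ?H" by simp
  then show ?thesis
  proof (induction rule: sigma_sets.induct)
    case (Basic A)
    then obtain a j where "A = {x. a < x $ j}" by (auto simp: Basis_vec_def inner_axis)
    then show ?case using multiplier_halfspace by simp
  next
    case Empty
    show ?case using multiplier_const[of 0] by (simp add: indicator_def[abs_def])
  next
    case (Compl A)
    have "indicator (UNIV - A) = (\<lambda>x. 1 - indicator A x :: real)" by (auto simp: fun_eq_iff indicator_def)
    then show ?case using multiplier_diff[OF multiplier_const Compl.IH] by simp
  next
    case (Union A)
    show ?case
    proof (rule multiplier_limit)
      show "multiplier (\<lambda>x. 1 - (\<Prod>i<n. 1 - indicator (A i) x))" for n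
        by (intro multiplier_diff multiplier_const multiplier_prod Union.IH) auto
      have eq: "1 - (\<Prod>i<n. 1 - indicator (A i) x) = (if x \<in> (\<Union>i<n. A i) then 1 else 0 :: real)" for n x
      proof (cases "x \<in> (\<Union>i<n. A i)")
        case True
        then obtain i where "i < n" "x \<in> A i" by blast
        then have "(\<Prod>i<n. 1 - indicator (A i) x) = (0::real)"
          by (intro prod_zero bexI[of _ i]) auto
        then show ?thesis using True by simp
      next
        case False
        then have "(\<Prod>i<n. 1 - indicator (A i) x) = (1::real)" by (intro prod.neutral) auto
        then show ?thesis using False by simp
      qed
      show "(\<lambda>n. 1 - (\<Prod>i<n. 1 - indicator (A i) x)) \<longlonglongrightarrow> indicat_real (\<Union>i. A i) x" for x
      proof (cases "x \<in> (\<Union>i. A i)")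
        case True
        then obtain i where i: "x \<in> A i" by blast
        have "(if x \<in> (\<Union>i<n. A i) then 1 else 0 :: real) = 1" if "n \<ge> Suc i" for n
          using i that by auto
        then have "\<forall>\<^sub>F n in sequentially. (if x \<in> (\<Union>i<n. A i) then 1 else 0 :: real) = 1"
          unfolding eventually_sequentially by blast
        then show ?thesis unfolding eq using True by (simp add: tendsto_eventually)
      next
        case False
        then have "(if x \<in> (\<Union>i<n. A i) then 1 else 0 :: real) = 0" for n by auto
        then show ?thesis unfolding eq using False by (simp del: UN_iff)
      qed
      show "\<bar>1 - (\<Prod>i<n. 1 - indicator (A i) x)\<bar> \<le> (1::real)" for n x unfolding eq by simp
    qed
  qed
qed

text \<open>Approximate by simple functions dominated by \<open>2 |f|\<close>; these are combinations of indicators, hence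
  multipliers, and are applied to the polynomial 1.\<close>

theorem polynomials_dense:
  assumes f: "L2 f" shows "poly_closure f"
proof -
  have fm: "f \<in> borel_measurable borel" by (rule L2_measurable[OF f])
  obtain F where F: "\<And>i. simple_function borel (F i)" "\<And>x. (\<lambda>i. F i x) \<longlonglongrightarrow> f x"
      "\<And>i x. dist (F i x) 0 \<le> 2 * dist (f x) 0"
    using borel_measurable_implies_sequence_metric[OF fm, of 0] by auto
  show ?thesis
  proof (rule poly_closure_limit)
    fix i
    have "finite (range (F i))" using simple_functionD(1)[OF F(1)[of i]] by simp
    moreover have "F i -` {y} \<in> sets borel" for y
      using simple_functionD(2)[OF F(1)[of i], of "{y}"] by simp
    ultimately have "multiplier (\<lambda>x. \<Sum>y\<in>range (F i). y * indicator (F i -` {y}) x)"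
      by (intro multiplier_sum multiplier_mult multiplier_const multiplier_indicator_borel)
    moreover have "(\<Sum>y\<in>range (F i). y * indicator (F i -` {y}) x) = F i x" for x
      using \<open>finite (range (F i))\<close> by (simp add: indicator_def if_distrib cong: if_cong)
    ultimately have "multiplier (F i)" by simp
    from multiplierD[OF this polynomial_const[of 1]] show "poly_closure (F i)" by simp
    show "\<bar>F i x\<bar> \<le> 2 * \<bar>f x\<bar>" for x using F(3)[of i x] by simp
  next
    show "L2 (\<lambda>x. 2 * \<bar>f x\<bar>)"
      using fm by (intro L2_cmult L2_bound[OF f]) auto
  qed (rule F(2))
qed

end

section \<open>Weak differentials against polynomials\<close>

text \<open>Radial, so that its gradient is explicit: the gradient is bounded by \<open>4 |x|\<close> uniformly in \<open>n\<close> and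
  tends to zero pointwise, which is all that dominated convergence needs.\<close>

definition cutoff :: "nat \<Rightarrow> real^'n \<Rightarrow> real" where
  "cutoff n x = flat_exp 0 (real n - x \<bullet> x)"

lemma GDERIV_flat_exp_radial:
  "GDERIV (\<lambda>x. flat_exp k (c - x \<bullet> x)) x :>
     (- 2 * (flat_exp (k + 2) (c - x \<bullet> x) - k * flat_exp (k + 1) (c - x \<bullet> x))) *\<^sub>R x"
proof -
  have "GDERIV (\<lambda>x. c - x \<bullet> x) x :> - (2 *\<^sub>R x)"
    using GDERIV_diff[OF GDERIV_const[of c] GDERIV_inner_self[of x]] by simp
  from GDERIV_DERIV_compose[OF this flat_exp_DERIV] show ?thesis
    by (rule GDERIV_subst) (simp add: vec_eq_iff algebra_simps)
qed

lemma smooth_cutoff: "smooth (cutoff n :: real^'n \<Rightarrow> real)"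
proof (rule smooth_algebra_hull_coords)
  let ?H = "range (\<lambda>k (x::real^'n). flat_exp k (real n - x \<bullet> x))"
  let ?G = "?H \<union> range (\<lambda>i x. x $ i)"
  have b: "algebra_hull ?G (\<lambda>x. flat_exp k (real n - x \<bullet> x))" "algebra_hull ?G (\<lambda>x. x $ i)" for k i
    by (auto intro!: algebra_hull.base)
  show "algebra_hull ?G (cutoff n)" using b(1)[of 0] by (simp add: cutoff_def[abs_def])
  fix f i x assume "f \<in> ?H"
  then obtain k where f: "f = (\<lambda>x. flat_exp k (real n - x \<bullet> x))" by blast
  have "partial i f = (\<lambda>x. (- 2) * (flat_exp (k + 2) (real n - x \<bullet> x)
      + (- real k) * flat_exp (k + 1) (real n - x \<bullet> x)) * x $ i)"
    unfolding f by (rule ext, subst partial_eq_GDERIV[OF GDERIV_flat_exp_radial]) simp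
  moreover have "algebra_hull ?G \<dots>"
    by (intro algebra_hull.mult algebra_hull.add algebra_hull.const b)
  ultimately show "f differentiable (at x) \<and> algebra_hull ?G (partial i f)"
    using GDERIV_imp_differentiable[OF GDERIV_flat_exp_radial] f by simp
qed

lemma cutoff_bounds: "0 \<le> cutoff n x" "cutoff n x \<le> 1"
  by (simp_all add: cutoff_def flat_exp_nonneg flat_exp_le_1)

lemma partial_cutoff: "partial i (cutoff n) x = - 2 * flat_exp 2 (real n - x \<bullet> x) * x $ i"
  unfolding cutoff_def[abs_def] by (subst partial_eq_GDERIV[OF GDERIV_flat_exp_radial]) (simp add: numeral_2_eq_2)

lemma partial_cutoff_bound: "\<bar>partial i (cutoff n) x\<bar> \<le> 4 * \<bar>x $ i\<bar>"
proof -
  have "flat_exp 2 t \<le> 2" for t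
    using flat_exp_bound[of t 2 0] by (cases "t \<ge> 0") (simp_all add: flat_exp_def numeral_2_eq_2)
  then have "2 * flat_exp 2 (real n - x \<bullet> x) * \<bar>x $ i\<bar> \<le> 2 * 2 * \<bar>x $ i\<bar>"
    by (intro mult_right_mono mult_left_mono) auto
  then show ?thesis
    using flat_exp_nonneg[of 2 "real n - x \<bullet> x"] by (simp add: partial_cutoff abs_mult)
qed

lemma cutoff_tendsto: "(\<lambda>n. cutoff n x) \<longlonglongrightarrow> 1"
proof -
  have inf: "filterlim (\<lambda>n. real n - x \<bullet> x) at_top sequentially"
    using filterlim_tendsto_add_at_top[OF tendsto_const[of "- (x \<bullet> x)"] filterlim_real_sequentially] by simp
  have "(\<lambda>n. exp (- inverse (real n - x \<bullet> x))) \<longlonglongrightarrow> exp (- 0)"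
    by (intro tendsto_exp tendsto_minus tendsto_inverse_0_at_top inf)
  moreover have "\<forall>\<^sub>F n in sequentially. exp (- inverse (real n - x \<bullet> x)) = cutoff n x"
    using inf[unfolded filterlim_at_top_dense, rule_format, of 0]
    by eventually_elim (simp add: cutoff_def flat_exp_def divide_inverse)
  ultimately show ?thesis by (simp add: tendsto_cong)
qed

lemma partial_cutoff_tendsto: "(\<lambda>n. partial i (cutoff n) x) \<longlonglongrightarrow> 0"
proof -
  have inf: "filterlim (\<lambda>n. real n - x \<bullet> x) at_top sequentially"
    using filterlim_tendsto_add_at_top[OF tendsto_const[of "- (x \<bullet> x)"] filterlim_real_sequentially] by simp
  have "(\<lambda>n. flat_exp 2 (real n - x \<bullet> x)) \<longlonglongrightarrow> 0"
  proof (rule Lim_null_comparison)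
    show "\<forall>\<^sub>F n in sequentially. norm (flat_exp 2 (real n - x \<bullet> x)) \<le> inverse (real n - x \<bullet> x) * inverse (real n - x \<bullet> x)"
      using inf[unfolded filterlim_at_top_dense, rule_format, of 0]
      by eventually_elim (simp add: flat_exp_def power2_eq_square divide_inverse mult_left_le)
    show "(\<lambda>n. inverse (real n - x \<bullet> x) * inverse (real n - x \<bullet> x)) \<longlonglongrightarrow> 0"
      using tendsto_mult[OF tendsto_inverse_0_at_top[OF inf] tendsto_inverse_0_at_top[OF inf]] by simp
  qed
  from tendsto_mult[OF tendsto_mult[OF tendsto_const[of "- 2"] this] tendsto_const[of "x $ i"]]
  show ?thesis by (simp add: partial_cutoff)
qed

lemma test_function_mult_cutoff:
  fixes f :: "real^'n \<Rightarrow> real"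
  assumes "smooth f" shows "test_function (\<lambda>x. f x * cutoff n x)"
proof -
  have "support_on UNIV (\<lambda>x. f x * cutoff n x) \<subseteq> cball 0 (sqrt n)"
  proof
    fix x assume "x \<in> support_on UNIV (\<lambda>x. f x * cutoff n x)"
    then have "real n - x \<bullet> x > 0" by (auto simp: support_on_def cutoff_def flat_exp_def split: if_splits)
    then show "x \<in> cball 0 (sqrt n)" by (simp add: norm_eq_sqrt_inner)
  qed
  then have "compact (closure (support_on UNIV (\<lambda>x. f x * cutoff n x)))"
    by (meson bounded_cball bounded_subset compact_closure)
  then show ?thesis unfolding test_function_def using smooth_mult[OF assms smooth_cutoff] by blast
qed

context gaussian begin

lemma smooth_rho: "smooth rho"
proof (rule smooth_algebra_hull_coords)
  let ?G = "{rho} \<union> range (\<lambda>i x. x $ i)"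
  show "algebra_hull ?G rho" by (intro algebra_hull.base) auto
  fix f :: "real^'n \<Rightarrow> real" and i x assume "f \<in> {rho}"
  then have f: "f = rho" by simp
  have "partial i f = (\<lambda>x. (- 1) * (rho x * x $ i))"
    unfolding f by (rule ext, subst partial_eq_GDERIV[OF rho_GDERIV]) simp
  moreover have "algebra_hull ?G \<dots>"
    by (intro algebra_hull.mult algebra_hull.const algebra_hull.base) auto
  ultimately show "f differentiable (at x) \<and> algebra_hull ?G (partial i f)"
    using GDERIV_imp_differentiable[OF rho_GDERIV] f by simp
qed

lemma partial_rho: "partial i rho x = - (rho x * x $ i)"
  by (subst partial_eq_GDERIV[OF rho_GDERIV]) simp

text \<open>Use the cut-off product of \<open>r\<close> and the Gaussian density as test function and remove the cut-off by
  dominated convergence.\<close>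

lemma weak_differential_polynomial:
  assumes w: "has_weak_differential f v" and f: "L2 f" and v: "L2 (\<lambda>x. v x $ i)" and r: "polynomial r"
  shows "G (\<lambda>x. f x * (x $ i * r x - partial i r x)) = G (\<lambda>x. v x $ i * r x)"
proof -
  note t = tempered_polynomial polynomial_intros polynomial_partial r
  have sr: "smooth r" "smooth (partial i r)" by (auto intro: smooth_polynomial polynomial_partial r)
  define \<psi> where "\<psi> x = r x * rho x" for x
  have s\<psi>: "smooth \<psi>" unfolding \<psi>_def[abs_def] by (intro smooth_mult sr smooth_rho)
  have p\<psi>: "partial i \<psi> x = (partial i r x - x $ i * r x) * rho x" for x
    unfolding \<psi>_def[abs_def]
    by (subst partial_mult) (auto simp: smooth_differentiable sr smooth_rho partial_rho algebra_simps)
  have p\<psi>c: "partial i (\<lambda>x. \<psi> x * cutoff n x) x = \<psi> x * partial i (cutoff n) x + cutoff n x * partial i \<psi> x" for n x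
    by (subst partial_mult) (auto simp: smooth_differentiable s\<psi> smooth_cutoff)
  have m: "f \<in> borel_measurable borel" "(\<lambda>x. v x $ i) \<in> borel_measurable borel"
    using f v by (auto dest: L2_measurable)
  have ms: "smooth h \<Longrightarrow> h \<in> borel_measurable borel" for h :: "real^'n \<Rightarrow> real"
    by (intro borel_measurable_continuous_onI smooth_continuous)
  have [measurable]: "f \<in> borel_measurable borel" "(\<lambda>x. v x $ i) \<in> borel_measurable borel"
    "\<psi> \<in> borel_measurable borel" "partial i \<psi> \<in> borel_measurable borel" "(cutoff n :: real^'n \<Rightarrow> real) \<in> borel_measurable borel"
    "partial i (cutoff n) \<in> borel_measurable borel" for n
    by (intro m ms s\<psi> smooth_partial smooth_cutoff)+
  have eq: "(LINT x|lborel. f x * (\<psi> x * partial i (cutoff n) x + cutoff n x * partial i \<psi> x))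
      = - (LINT x|lborel. v x $ i * (\<psi> x * cutoff n x))" for n
    using w test_function_mult_cutoff[OF s\<psi>, of n] unfolding has_weak_differential_def p\<psi>c[symmetric] by blast
  have L1: "(\<lambda>n. LINT x|lborel. f x * (\<psi> x * partial i (cutoff n) x + cutoff n x * partial i \<psi> x))
      \<longlonglongrightarrow> (LINT x|lborel. f x * (\<psi> x * 0 + 1 * partial i \<psi> x))"
  proof (rule integral_dominated_convergence)
    show "AE x in lborel. (\<lambda>n. f x * (\<psi> x * partial i (cutoff n) x + cutoff n x * partial i \<psi> x))
        \<longlonglongrightarrow> f x * (\<psi> x * 0 + 1 * partial i \<psi> x)"
      by (intro always_eventually allI tendsto_intros cutoff_tendsto partial_cutoff_tendsto)
    have "integrable lborel (\<lambda>x. \<bar>(f x * (x $ i * r x)) * rho x\<bar>)" "integrable lborel (\<lambda>x. \<bar>(f x * (partial i r x - x $ i * r x)) * rho x\<bar>)"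
      by (intro integrable_abs L2_mult_integrable f L2_tempered t)+
    then show "integrable lborel (\<lambda>x. 4 * \<bar>(f x * (x $ i * r x)) * rho x\<bar> + \<bar>(f x * (partial i r x - x $ i * r x)) * rho x\<bar>)"
      by simp
    fix n
    have "\<bar>f x * (\<psi> x * partial i (cutoff n) x + cutoff n x * partial i \<psi> x)\<bar>
        \<le> 4 * \<bar>(f x * (x $ i * r x)) * rho x\<bar> + \<bar>(f x * (partial i r x - x $ i * r x)) * rho x\<bar>" for x
    proof -
      have "\<bar>\<psi> x * partial i (cutoff n) x\<bar> \<le> \<bar>\<psi> x\<bar> * (4 * \<bar>x $ i\<bar>)"
        unfolding abs_mult by (intro mult_left_mono partial_cutoff_bound) simp
      moreover have "\<bar>cutoff n x * partial i \<psi> x\<bar> \<le> 1 * \<bar>partial i \<psi> x\<bar>"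
        unfolding abs_mult using cutoff_bounds[of n x] by (intro mult_right_mono) auto
      ultimately have "\<bar>\<psi> x * partial i (cutoff n) x + cutoff n x * partial i \<psi> x\<bar> \<le> \<bar>\<psi> x\<bar> * (4 * \<bar>x $ i\<bar>) + \<bar>partial i \<psi> x\<bar>"
        by linarith
      then have "\<bar>f x\<bar> * \<bar>\<psi> x * partial i (cutoff n) x + cutoff n x * partial i \<psi> x\<bar> \<le> \<bar>f x\<bar> * (\<bar>\<psi> x\<bar> * (4 * \<bar>x $ i\<bar>) + \<bar>partial i \<psi> x\<bar>)"
        by (intro mult_left_mono) auto
      moreover have "4 * \<bar>(f x * (x $ i * r x)) * rho x\<bar> = \<bar>f x\<bar> * (\<bar>\<psi> x\<bar> * (4 * \<bar>x $ i\<bar>))"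
        by (simp add: \<psi>_def abs_mult)
      moreover have "\<bar>(f x * (partial i r x - x $ i * r x)) * rho x\<bar> = \<bar>f x\<bar> * \<bar>partial i \<psi> x\<bar>"
        by (simp add: p\<psi> abs_mult)
      ultimately show ?thesis
        unfolding abs_mult[of "f x" "\<psi> x * partial i (cutoff n) x + cutoff n x * partial i \<psi> x"]
        by (simp only: distrib_left)
    qed
    then show "AE x in lborel. norm (f x * (\<psi> x * partial i (cutoff n) x + cutoff n x * partial i \<psi> x))
        \<le> 4 * \<bar>(f x * (x $ i * r x)) * rho x\<bar> + \<bar>(f x * (partial i r x - x $ i * r x)) * rho x\<bar>" by simp
  qed measurable
  have L2: "(\<lambda>n. - (LINT x|lborel. v x $ i * (\<psi> x * cutoff n x))) \<longlonglongrightarrow> - (LINT x|lborel. v x $ i * (\<psi> x * 1))"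
  proof (rule tendsto_minus, rule integral_dominated_convergence)
    show "AE x in lborel. (\<lambda>n. v x $ i * (\<psi> x * cutoff n x)) \<longlonglongrightarrow> v x $ i * (\<psi> x * 1)"
      by (intro always_eventually allI tendsto_intros cutoff_tendsto)
    show "integrable lborel (\<lambda>x. \<bar>(v x $ i * r x) * rho x\<bar>)"
      by (intro integrable_abs L2_mult_integrable v L2_tempered t)
    fix n
    have "\<bar>v x $ i * (\<psi> x * cutoff n x)\<bar> \<le> \<bar>(v x $ i * r x) * rho x\<bar>" for x
    proof -
      have "\<bar>(v x $ i * r x) * rho x\<bar> * \<bar>cutoff n x\<bar> \<le> \<bar>(v x $ i * r x) * rho x\<bar> * 1"
        using cutoff_bounds[of n x] by (intro mult_left_mono) auto
      then show ?thesis by (simp add: \<psi>_def abs_mult mult_ac)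
    qed
    then show "AE x in lborel. norm (v x $ i * (\<psi> x * cutoff n x)) \<le> \<bar>(v x $ i * r x) * rho x\<bar>" by simp
  qed measurable
  have "(LINT x|lborel. f x * (\<psi> x * 0 + 1 * partial i \<psi> x)) = - (LINT x|lborel. v x $ i * (\<psi> x * 1))"
    using L1 unfolding eq by (rule LIMSEQ_unique) (rule L2)
  moreover have "(LINT x|lborel. f x * (\<psi> x * 0 + 1 * partial i \<psi> x)) = - G (\<lambda>x. f x * (x $ i * r x - partial i r x))"
    unfolding G_minus[symmetric] unfolding G_def by (rule Bochner_Integration.integral_cong) (auto simp: p\<psi> algebra_simps)
  moreover have "(LINT x|lborel. v x $ i * (\<psi> x * 1)) = G (\<lambda>x. v x $ i * r x)"
    unfolding G_def by (rule Bochner_Integration.integral_cong) (auto simp: \<psi>_def)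
  ultimately show ?thesis by simp
qed

text \<open>Duality with \<open>ou u = p\<close> for a polynomial \<open>p\<close> close to \<open>f\<close>:
  \<open>\<integral> f p = \<integral> v \<bullet> \<nabla>u \<le> \<integral> |v|\<^sup>2 / 4 + \<integral> |\<nabla>u|\<^sup>2 \<le> \<integral> |v|\<^sup>2 / 4 + \<integral> p\<^sup>2 / 2\<close>. As \<open>p\<close> tends to \<open>f\<close> this is
  the claim.\<close>

lemma second_order_poincare:
  assumes w: "has_weak_differential f v" and f: "L2 f" and v: "\<And>i. L2 (\<lambda>x. v x $ i)"
    and f1: "G f = 0" and fx: "\<And>i. G (\<lambda>x. f x * x $ i) = 0"
  shows "2 * G (\<lambda>x. (f x)\<^sup>2) \<le> G (\<lambda>x. v x \<bullet> v x)"
proof -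
  note G1 = G_one_pos
  note t = L2_tempered tempered_polynomial polynomial_intros
  have Li: "integrable lborel (\<lambda>x. (a x * b x) * rho x)" if "L2 a" "L2 b" for a b
    by (rule L2_mult_integrable[OF that])
  have L1: "L2 (\<lambda>_. 1)" by (intro t)
  have lin: "G (\<lambda>x. f x * (a + c \<bullet> x)) = 0" for a c
  proof -
    have "f x * (a + c \<bullet> x) * rho x = a * ((f x * 1) * rho x) + (\<Sum>i\<in>UNIV. c $ i * ((f x * x $ i) * rho x))" for x
      by (simp add: inner_vec_def sum_distrib_left sum_distrib_right algebra_simps)
    then have "G (\<lambda>x. f x * (a + c \<bullet> x)) = a * G (\<lambda>x. f x * 1) + (\<Sum>i\<in>UNIV. c $ i * G (\<lambda>x. f x * x $ i))"
      unfolding G_def using Li[OF f L1] Li[OF f] by (simp add: t)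
    then show ?thesis using f1 fx by simp
  qed
  have "2 * G (\<lambda>x. (f x)\<^sup>2) \<le> G (\<lambda>x. v x \<bullet> v x) + 2 * e" if e: "e > 0" for e
  proof -
    obtain p0 where p0: "polynomial p0" "G (\<lambda>x. (f x - p0 x)\<^sup>2) < e"
      using polynomials_dense[OF f] e unfolding poly_closure_def by blast
    \<comment> \<open>Remove the components of the approximant along 1 and the coordinates. As \<open>f\<close> is orthogonal to
      them, this does not increase the distance to \<open>f\<close>.\<close>
    define a where "a = G p0 / G (\<lambda>_. 1)"
    define c where "c = (\<chi> i. G (\<lambda>x. p0 x * x $ i) / G (\<lambda>_. 1))"
    define l where "l x = a + c \<bullet> x" for x
    define p where "p x = p0 x - l x" for x
    have pl: "polynomial l" unfolding l_def[abs_def] inner_vec_def inner_real_def by (intro polynomial_intros) auto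
    have pp: "polynomial p" unfolding p_def[abs_def] by (intro polynomial_intros p0 pl)
    note tt = tempered_polynomial polynomial_intros pl pp p0(1)
    have Gl: "G l = a * G (\<lambda>_. 1)"
    proof -
      have "G (\<lambda>x. a * 1 + (\<Sum>i\<in>UNIV. c $ i * x $ i)) = a * G (\<lambda>_. 1) + (\<Sum>i\<in>UNIV. c $ i * G (\<lambda>x. x $ i))"
        by (subst G_add, (intro tt; simp)+, subst G_sum, (intro tt; simp)+) (simp only: G_cmult)
      moreover have "l = (\<lambda>x. a * 1 + (\<Sum>i\<in>UNIV. c $ i * x $ i))"
        by (simp add: l_def[abs_def] inner_vec_def)
      ultimately show ?thesis by (simp add: G_coord)
    qed
    have Glx: "G (\<lambda>x. l x * x $ j) = c $ j * G (\<lambda>_. 1)" for j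
    proof -
      have "l x * x $ j = a * x $ j + (\<Sum>i\<in>UNIV. c $ i * (x $ i * x $ j))" for x
        by (simp add: l_def inner_vec_def sum_distrib_right distrib_right mult.assoc)
      then have "G (\<lambda>x. l x * x $ j) = G (\<lambda>x. a * x $ j + (\<Sum>i\<in>UNIV. c $ i * (x $ i * x $ j)))" by simp
      also have "\<dots> = a * G (\<lambda>x. x $ j) + (\<Sum>i\<in>UNIV. c $ i * G (\<lambda>x. x $ i * x $ j))"
        by (subst G_add, (intro tt; simp)+, subst G_sum, (intro tt; simp)+) (simp only: G_cmult)
      also have "\<dots> = (\<Sum>i\<in>UNIV. \<delta> i j * (c $ i * G (\<lambda>_. 1)))"
        unfolding G_coord G_coord_coord by (auto intro!: sum.cong)
      finally show ?thesis unfolding sum_delta_left .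
    qed
    have p1: "G p = 0"
      unfolding p_def[abs_def] using G1 by (subst G_diff) (auto intro!: tt simp: Gl a_def)
    have px: "G (\<lambda>x. p x * x $ i) = 0" for i
    proof -
      have "G (\<lambda>x. p x * x $ i) = G (\<lambda>x. p0 x * x $ i - l x * x $ i)" by (simp add: p_def left_diff_distrib)
      also have "\<dots> = G (\<lambda>x. p0 x * x $ i) - G (\<lambda>x. l x * x $ i)" by (rule G_diff) (intro tt)+
      finally show ?thesis using G1 by (simp add: Glx c_def)
    qed
    have plin: "G (\<lambda>x. p x * l x) = 0"
    proof -
      have "p x * l x = a * p x + (\<Sum>i\<in>UNIV. c $ i * (p x * x $ i))" for x
        by (simp add: l_def inner_vec_def sum_distrib_left algebra_simps)
      then have "G (\<lambda>x. p x * l x) = G (\<lambda>x. a * p x + (\<Sum>i\<in>UNIV. c $ i * (p x * x $ i)))" by simp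
      also have "\<dots> = a * G p + (\<Sum>i\<in>UNIV. c $ i * G (\<lambda>x. p x * x $ i))"
        by (subst G_add, (intro tt; simp)+, subst G_sum, (intro tt; simp)+) (simp only: G_cmult)
      finally show ?thesis using p1 px by simp
    qed
    have Lp: "L2 p" "L2 l" "L2 p0" by (intro L2_tempered tt)+
    have err: "G (\<lambda>x. (f x - p x)\<^sup>2) < e"
    proof -
      have id: "(f x - p0 x)\<^sup>2 * rho x = (f x - p x)\<^sup>2 * rho x + (l x)\<^sup>2 * rho x - 2 * ((f x * l x) * rho x) + 2 * ((p x * l x) * rho x)" for x
        by (simp add: p_def power2_eq_square algebra_simps)
      have i: "integrable lborel (\<lambda>x. (f x - p x)\<^sup>2 * rho x)" "integrable lborel (\<lambda>x. (l x)\<^sup>2 * rho x)"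
        using L2_diff[OF f Lp(1)] Lp(2) by (simp_all add: L2_def)
      have "G (\<lambda>x. (f x - p0 x)\<^sup>2) = G (\<lambda>x. (f x - p x)\<^sup>2) + G (\<lambda>x. (l x)\<^sup>2) - 2 * G (\<lambda>x. f x * l x) + 2 * G (\<lambda>x. p x * l x)"
        unfolding G_def id using i Li[OF f Lp(2)] Li[OF Lp(1,2)] by simp
      moreover have "G (\<lambda>x. f x * l x) = 0" using lin by (simp add: l_def)
      moreover have "0 \<le> G (\<lambda>x. (l x)\<^sup>2)" by (rule G_nonneg) simp
      ultimately show ?thesis using p0(2) plin by linarith
    qed
    \<comment> \<open>Solve \<open>ou u = p\<close>; the constant is zero because \<open>p\<close> has mean zero.\<close>
    obtain k where "poly_below k p" using pp polynomial_def by blast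
    then obtain u b where u: "polynomial u" and pu: "p = (\<lambda>x. ou u x + b)" using ou_surjective by blast
    have b: "b = 0"
    proof -
      have "G p = G (\<lambda>x. 1 * ou u x) + b * G (\<lambda>_. 1)"
        unfolding pu G_cmult[symmetric] by (subst G_add[symmetric]) (auto intro!: tempered_polynomial polynomial_ou polynomial_const u)
      moreover have "G (\<lambda>x. 1 * ou u x) = 0"
        unfolding G_ou[OF polynomial_const u] by (simp add: partial_const G_def)
      ultimately show ?thesis using p1 G1 by simp
    qed
    have pou: "p x = ou u x" for x using pu b by simp
    have small: "2 * dirichlet u \<le> G (\<lambda>x. (p x)\<^sup>2)"
      unfolding pou by (rule second_order_poincare_polynomial[OF u]) (use px in \<open>simp add: pou mult.commute\<close>)
    have Lu: "L2 (partial i u)" "L2 (\<lambda>x. x $ i * partial i u x - partial i (partial i u) x)" for i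
      by (intro L2_tempered tempered_polynomial polynomial_intros polynomial_partial u)+
    have dual: "G (\<lambda>x. f x * p x) = (\<Sum>i\<in>UNIV. G (\<lambda>x. v x $ i * partial i u x))"
    proof -
      have "G (\<lambda>x. f x * p x) = (LINT x|lborel. (\<Sum>i\<in>UNIV. (f x * (x $ i * partial i u x - partial i (partial i u) x)) * rho x))"
        unfolding G_def by (simp add: pou ou_def sum_distrib_left sum_distrib_right)
      also have "\<dots> = (\<Sum>i\<in>UNIV. G (\<lambda>x. f x * (x $ i * partial i u x - partial i (partial i u) x)))"
        unfolding G_def by (rule Bochner_Integration.integral_sum) (rule Li[OF f Lu(2)])
      also have "\<dots> = (\<Sum>i\<in>UNIV. G (\<lambda>x. v x $ i * partial i u x))"
        by (intro sum.cong refl weak_differential_polynomial[OF w f v] polynomial_partial u)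
      finally show ?thesis .
    qed
    have young: "G (\<lambda>x. v x $ i * partial i u x) \<le> (1/4) * G (\<lambda>x. (v x $ i)\<^sup>2) + G (\<lambda>x. (partial i u x)\<^sup>2)" for i
    proof -
      have i: "integrable lborel (\<lambda>x. (v x $ i)\<^sup>2 * rho x)" "integrable lborel (\<lambda>x. (partial i u x)\<^sup>2 * rho x)"
        using v Lu(1) by (simp_all add: L2_def)
      have "G (\<lambda>x. v x $ i * partial i u x) \<le> (LINT x|lborel. (1/4) * ((v x $ i)\<^sup>2 * rho x) + (partial i u x)\<^sup>2 * rho x)"
        unfolding G_def
      proof (rule integral_mono)
        show "integrable lborel (\<lambda>x. (v x $ i * partial i u x) * rho x)" by (rule Li[OF v Lu(1)])
        fix x
        have "v x $ i * partial i u x \<le> (1/4) * (v x $ i)\<^sup>2 + (partial i u x)\<^sup>2"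
          using zero_le_power2[of "v x $ i / 2 - partial i u x"] by (simp add: power2_eq_square algebra_simps)
        then have "v x $ i * partial i u x * rho x \<le> ((1/4) * (v x $ i)\<^sup>2 + (partial i u x)\<^sup>2) * rho x"
          using rho_pos[of x] by (intro mult_right_mono) auto
        then show "v x $ i * partial i u x * rho x \<le> (1/4) * ((v x $ i)\<^sup>2 * rho x) + (partial i u x)\<^sup>2 * rho x"
          by (simp add: algebra_simps)
      qed (use i in simp)
      also have "\<dots> = (1/4) * G (\<lambda>x. (v x $ i)\<^sup>2) + G (\<lambda>x. (partial i u x)\<^sup>2)"
        unfolding G_def using i by simp
      finally show ?thesis .
    qed
    have vv: "G (\<lambda>x. v x \<bullet> v x) = (\<Sum>i\<in>UNIV. G (\<lambda>x. (v x $ i)\<^sup>2))"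
    proof -
      have "G (\<lambda>x. v x \<bullet> v x) = (LINT x|lborel. (\<Sum>i\<in>UNIV. (v x $ i)\<^sup>2 * rho x))"
        unfolding G_def by (simp add: inner_vec_def power2_eq_square sum_distrib_right)
      also have "\<dots> = (\<Sum>i\<in>UNIV. G (\<lambda>x. (v x $ i)\<^sup>2))"
        unfolding G_def by (rule Bochner_Integration.integral_sum) (use v in \<open>simp add: L2_def\<close>)
      finally show ?thesis .
    qed
    have fp: "G (\<lambda>x. f x * p x) \<le> (1/4) * G (\<lambda>x. v x \<bullet> v x) + (1/2) * G (\<lambda>x. (p x)\<^sup>2)"
    proof -
      have "G (\<lambda>x. f x * p x) \<le> (\<Sum>i\<in>UNIV. (1/4) * G (\<lambda>x. (v x $ i)\<^sup>2) + G (\<lambda>x. (partial i u x)\<^sup>2))"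
        unfolding dual by (intro sum_mono young)
      also have "\<dots> = (1/4) * G (\<lambda>x. v x \<bullet> v x) + dirichlet u"
        unfolding vv dirichlet_def by (simp only: sum.distrib sum_distrib_left[symmetric])
      finally show ?thesis using small by linarith
    qed
    have "G (\<lambda>x. (f x - p x)\<^sup>2) = G (\<lambda>x. (f x)\<^sup>2) + G (\<lambda>x. (p x)\<^sup>2) - 2 * G (\<lambda>x. f x * p x)"
    proof -
      have id: "(f x - p x)\<^sup>2 * rho x = (f x)\<^sup>2 * rho x + (p x)\<^sup>2 * rho x - 2 * ((f x * p x) * rho x)" for x
        by (simp add: power2_eq_square algebra_simps)
      show ?thesis unfolding G_def id using f Lp(1) Li[OF f Lp(1)] by (simp add: L2_def)
    qed
    with fp err show ?thesis by linarith
  qed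
  note approx = this
  show ?thesis
  proof (rule field_le_epsilon)
    fix e :: real assume "e > 0"
    then show "2 * G (\<lambda>x. (f x)\<^sup>2) \<le> G (\<lambda>x. v x \<bullet> v x) + e" using approx[of "e / 2"] by simp
  qed
qed

text \<open>Fewer equations than unknowns: \<open>N\<close> vectors in dimension below \<open>N\<close> are dependent, either as a set or
  because two of them coincide.\<close>

lemma underdetermined_system:
  fixes y :: "nat \<Rightarrow> 'a::euclidean_space"
  assumes "DIM('a) < N"
  obtains c where "(\<Sum>k<N. c k *\<^sub>R y k) = 0" "\<exists>k<N. c k \<noteq> (0::real)"
proof (cases "inj_on y {..<N}")
  case True
  then have "card (y ` {..<N}) = N" by (simp add: card_image)
  then have "dependent (y ` {..<N})"
    using assms by (intro dependent_biggerset) auto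
  then obtain u where u: "\<exists>v\<in>y ` {..<N}. u v \<noteq> 0" "(\<Sum>v\<in>y ` {..<N}. u v *\<^sub>R v) = 0"
    by (subst (asm) dependent_finite) auto
  have "(\<Sum>k<N. u (y k) *\<^sub>R y k) = 0"
    using u(2) by (simp add: sum.reindex[OF True])
  then show ?thesis using u(1) that[of "\<lambda>k. u (y k)"] by auto
next
  case False
  then obtain i j where ij: "i < N" "j < N" "i \<noteq> j" "y i = y j" by (auto simp: inj_on_def)
  define c where "c k = (if k = i then 1 else if k = j then - 1 else 0 :: real)" for k
  have "(\<Sum>k<N. c k *\<^sub>R y k) = (\<Sum>k<N. (if k = i then y i else 0) - (if k = j then y j else 0))"
    using ij(3) by (intro sum.cong) (auto simp: c_def)
  also have "\<dots> = 0" using ij by (simp add: sum_subtractf)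
  finally have "(\<Sum>k<N. c k *\<^sub>R y k) = 0" .
  moreover have "\<exists>k<N. c k \<noteq> 0" using ij(1) by (intro exI[of _ i]) (simp add: c_def)
  ultimately show ?thesis by (rule that)
qed

section \<open>The Gaussian eigenvalue and the counterexample\<close>

theorem gaussian_eigenvalue_ge_2:
  "ereal 2 \<le> variational_eigenvalue (CARD('n) + 2) (flat_metric :: 'n tensor2) M"
  unfolding variational_eigenvalue_def
proof (rule INF_greatest)
  fix E assume "E \<in> {E. sobolev_subspace (flat_metric :: 'n tensor2) M (CARD('n) + 2) E}"
  then obtain b where E: "E \<subseteq> W12 flat_metric M" and ind: "ae_independent M (CARD('n) + 2) b"
    and bE: "\<And>i. i < CARD('n) + 2 \<Longrightarrow> b i \<in> E" and span: "E = ae_span M (CARD('n) + 2) b"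
    unfolding sobolev_subspace_def by blast
  have W: "L2 f" if "f \<in> E" for f
    using that E integrable_M[of "\<lambda>x. (f x)\<^sup>2"] unfolding W12_def L2_def by auto
  \<comment> \<open>A vector with the \<open>d + 1\<close> inner products of the \<open>k\<close>-th basis function with 1 and the coordinates.\<close>
  define y where "y k = (G (b k), \<chi> i. G (\<lambda>x. b k x * x $ i))" for k
  obtain c where c: "(\<Sum>k<CARD('n) + 2. c k *\<^sub>R y k) = 0" "\<exists>k<CARD('n) + 2. c k \<noteq> 0"
    by (rule underdetermined_system[of "CARD('n) + 2" y]) simp
  define f where "f x = (\<Sum>k<CARD('n) + 2. c k * b k x)" for x
  have bm: "b k \<in> borel_measurable borel" if "k < CARD('n) + 2" for k
    using L2_measurable[OF W[OF bE[OF that]]] .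
  have fm: "f \<in> borel_measurable borel"
    unfolding f_def[abs_def] using bm by (intro borel_measurable_sum borel_measurable_times) auto
  have fE: "f \<in> E" unfolding span ae_span_def using fm by (auto simp: f_def)
  have fne: "\<not> (AE x in M. f x = 0)"
    using ind c(2) unfolding ae_independent_def f_def by blast
  have G_f: "G (\<lambda>x. f x * h x) = (\<Sum>k<CARD('n) + 2. c k * G (\<lambda>x. b k x * h x))" if "L2 h" for h
  proof -
    have i: "integrable lborel (\<lambda>x. (b k x * h x) * rho x)" if "k < CARD('n) + 2" for k
      by (rule L2_mult_integrable[OF W[OF bE[OF that]] \<open>L2 h\<close>])
    have "G (\<lambda>x. f x * h x) = (LINT x|lborel. (\<Sum>k<CARD('n) + 2. c k * ((b k x * h x) * rho x)))"
      unfolding G_def f_def by (simp only: sum_distrib_right mult.assoc)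
    also have "\<dots> = (\<Sum>k<CARD('n) + 2. LINT x|lborel. c k * ((b k x * h x) * rho x))"
      by (intro Bochner_Integration.integral_sum integrable_mult_right i) simp
    finally show ?thesis by (simp only: integral_mult_right_zero G_def)
  qed
  have "fst (\<Sum>k<CARD('n) + 2. c k *\<^sub>R y k) = 0" "snd (\<Sum>k<CARD('n) + 2. c k *\<^sub>R y k) $ i = 0" for i
    unfolding c(1) by simp_all
  then have "(\<Sum>k<CARD('n) + 2. c k * G (b k)) = 0" "(\<Sum>k<CARD('n) + 2. c k * G (\<lambda>x. b k x * x $ i)) = 0" for i
    unfolding fst_sum snd_sum sum_component y_def by simp_all
  then have f1: "G f = 0" and fx: "G (\<lambda>x. f x * x $ i) = 0" for i
    using G_f[OF L2_tempered[OF tempered_const[of 1]]] G_f[OF L2_tempered[OF tempered_coord[of i]]] by simp_all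
  obtain v where v: "has_weak_differential f v" using fE E unfolding W12_def by blast
  define v' where "v' = weak_differential f"
  have wv: "has_weak_differential f v'"
    unfolding v'_def weak_differential_def by (rule someI[of "has_weak_differential f", OF v])
  have gn: "grad_norm_sq flat_metric f = (\<lambda>x. v' x \<bullet> v' x)"
    by (rule ext) (simp add: grad_norm_sq_conformal[where A="\<lambda>_. 1", OF flat_matrix_inv] v'_def)
  have vm: "v' \<in> borel_measurable borel"
    using wv by (simp add: has_weak_differential_def locally_integrable_def)
  have vi: "(\<lambda>x. v' x $ i) \<in> borel_measurable borel" for i
    by (rule borel_measurable_continuous_on[where f="\<lambda>y. y $ i", OF _ vm]) (auto intro!: continuous_on_nth continuous_intros)
  have vvm: "(\<lambda>x. v' x \<bullet> v' x) \<in> borel_measurable borel" using vm by simp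
  have int: "integrable lborel (\<lambda>x. (v' x \<bullet> v' x) * rho x)"
    using fE E integrable_M[OF vvm] unfolding W12_def gn[symmetric] by auto
  have Lv: "L2 (\<lambda>x. v' x $ i)" for i
    unfolding L2_def
  proof (intro conjI vi Bochner_Integration.integrable_bound[OF int])
    show "(\<lambda>x. (v' x $ i)\<^sup>2 * rho x) \<in> borel_measurable lborel" using vi by simp
    have "(v' x $ i)\<^sup>2 * rho x \<le> (v' x \<bullet> v' x) * rho x" for x
      using rho_pos[of x] by (intro mult_right_mono component_square_le) auto
    then show "AE x in lborel. norm ((v' x $ i)\<^sup>2 * rho x) \<le> norm ((v' x \<bullet> v' x) * rho x)"
      using rho_pos by (simp add: abs_mult less_imp_le)
  qed
  have ineq: "2 * G (\<lambda>x. (f x)\<^sup>2) \<le> G (\<lambda>x. v' x \<bullet> v' x)"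
    by (rule second_order_poincare[OF wv W[OF fE] Lv f1 fx])
  have f2m: "(\<lambda>x. (f x)\<^sup>2) \<in> borel_measurable borel" using fm by simp
  have pos: "G (\<lambda>x. (f x)\<^sup>2) > 0"
  proof -
    have "G (\<lambda>x. (f x)\<^sup>2) \<noteq> 0"
    proof
      assume "G (\<lambda>x. (f x)\<^sup>2) = 0"
      then have "AE x in lborel. (f x)\<^sup>2 * rho x = 0"
        unfolding G_def using W[OF fE] rho_pos
        by (subst (asm) integral_nonneg_eq_0_iff_AE) (auto simp: L2_def less_imp_le)
      then have "AE x in lborel. f x = 0" by eventually_elim (use rho_pos in \<open>simp add: less_imp_neq[symmetric]\<close>)
      then show False using fne by (simp add: AE_M)
    qed
    moreover have "0 \<le> G (\<lambda>x. (f x)\<^sup>2)" by (rule G_nonneg) simp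
    ultimately show ?thesis by linarith
  qed
  have "rayleigh flat_metric M f = G (\<lambda>x. v' x \<bullet> v' x) / G (\<lambda>x. (f x)\<^sup>2)"
    unfolding rayleigh_def gn integral_M[OF vvm] integral_M[OF f2m] ..
  then have "2 \<le> rayleigh flat_metric M f" using ineq pos by (simp add: le_divide_eq)
  then show "ereal 2 \<le> (SUP f\<in>{f\<in>E. \<not> (AE x in M. f x = 0)}. ereal (rayleigh flat_metric M f))"
    using fE fne by (intro SUP_upper2[of f]) auto
qed

end

theorem theorem2:
  assumes "CARD('n::finite) \<ge> 4"
  shows "\<exists>(g :: real^'n \<Rightarrow> real^'n^'n) (W :: real^'n \<Rightarrow> real).
           weighted_manifold g W \<and> CD_infinity 1 g W \<and> ricci_nonneg g \<and>
           variational_eigenvalue (CARD('n) + 2) g (weighted_measure g W) < 2 \<and>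
           2 = variational_eigenvalue (CARD('n) + 2)
                 (flat_metric :: real^'n \<Rightarrow> real^'n^'n) gaussian_measure"
proof -
  define c where "c = real CARD('n) - 2"
  have c: "c > 0" using assms by (simp add: c_def)
  have "weighted_manifold (cigar c :: 'n tensor2) (cigar_potential c)"
    unfolding weighted_manifold_def using cigar_riemannian[OF c] cigar_complete[OF c] cigar_potential_smooth by blast
  moreover have "CD_infinity 1 (cigar c :: 'n tensor2) (cigar_potential c)"
    by (rule cigar_CD[OF c c_def])
  moreover have "ricci_nonneg (cigar c :: 'n tensor2)"
    by (rule cigar_ricci_nonneg[OF c c_def])
  moreover have "variational_eigenvalue (CARD('n) + 2) (cigar c :: 'n tensor2) (weighted_measure (cigar c) (cigar_potential c)) < 2"
    by (rule cigar_eigenvalue[OF c_def assms])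
  moreover have "2 = variational_eigenvalue (CARD('n) + 2) (flat_metric :: 'n tensor2) gaussian_measure"
  proof -
    interpret gaussian "(2 * pi) powr (- real CARD('n) / 2)" "TYPE('n)"
      by unfold_locales simp
    have "variational_eigenvalue (CARD('n) + 2) (flat_metric :: 'n tensor2) M = ereal 2"
      by (rule antisym[OF gaussian_eigenvalue_le_2 gaussian_eigenvalue_ge_2])
    then show ?thesis unfolding gaussian_measure_eq by simp
  qed
  ultimately show ?thesis by blast
qed

end
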